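(* Let $\alpha=[a_0;a_1,a_2,\dots]$ be irrational with convergents $p_k/q_k$, and assume that \[ \frac{\log a_k}{a_{k+1}} \le T \quad \text{for all } k \ge k_0 \] with some constants $k_0, T \ge 1$. Let $N=\sum_{k=0}^{K-1} b_k q_k$ be the Ostrowski expansion of a non-negative integer, and set \[ N^*=\sum_{k=0}^{K-1} b_k^* q_k, \qquad b_k^*=\lfloor (5/6) a_{k+1} \rfloor . \] Then \[ \log P_N(\alpha ) = \log P_{N^*}(\alpha ) - \sum_{k=0}^{K-1} d_k(N) + O_T \left( \sum_{k=1}^K \frac{1}{a_k} \right) + O_{\alpha}(1) \] with some real numbers $d_k(N)$ satisfying the following for all $0 \le k \le K-1$: (i) $d_k(N) \ge 0.2326\, (b_k- b_k^* )^2/a_{k+1}$, with equality if $b_k=b_k^*$; (ii) if $b_k \le 0.99\, a_{k+1}$, then \[ d_k (N) = a_{k+1} \int_{b_k/a_{k+1}}^{b_k^*/a_{k+1}} \log |2 \sin (\pi x)| \, \mathrm{d}x + O_T \left( \frac{|b_k-b_k^*|}{a_{k+1}} + I_{\{ b_k \le 0.01 a_{k+1} \}} \log a_{k+1} \right) , \] where $I_{\{ b_k \le 0.01 a_{k+1}\}}$ is $1$ if $b_k \le 0.01 a_{k+1}$ and $0$ otherwise.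
   Context: For real $\alpha$ and integer $N\ge 0$, $P_N(\alpha)=\prod_{n=1}^N |2\sin(\pi n\alpha)|$ (the Sudler product; empty product $=1$). $p_k/q_k=[a_0;a_1,\dots,a_k]$ are the convergents, so $q_0=1$, $q_1=a_1$, $q_{k+1}=a_{k+1}q_k+q_{k-1}$. The Ostrowski expansion of a non-negative integer $N$ is its unique representation $N=\sum_{k=0}^{K-1} b_k q_k$ with integers $0 \le b_0<a_1$, $0 \le b_k \le a_{k+1}$, such that $b_{k-1}=0$ whenever $b_k=a_{k+1}$. Notation: $O_T(\cdot)$ denotes a bound with implied constant depending only on $T$; $O_\alpha(\cdot)$ denotes a bound with implied constant that may depend on $\alpha$ (including $k_0,T$), but not on $N$ or $K$. *)

theory Defs
  imports "HOL-Analysis.Analysis" "HOL-Analysis.Interval_Integral"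
begin

fun cf_rem :: "real \<Rightarrow> nat \<Rightarrow> real" where
  "cf_rem x 0 = x"
| "cf_rem x (Suc n) = 1 / frac (cf_rem x n)"

definition cf_a :: "real \<Rightarrow> nat \<Rightarrow> int" where
  "cf_a x n = \<lfloor>cf_rem x n\<rfloor>"

fun cf_q :: "real \<Rightarrow> nat \<Rightarrow> int" where
  "cf_q x 0 = 1"
| "cf_q x (Suc 0) = cf_a x 1"
| "cf_q x (Suc (Suc n)) = cf_a x (Suc (Suc n)) * cf_q x (Suc n) + cf_q x n"

definition sudler :: "real \<Rightarrow> nat \<Rightarrow> real" where
  "sudler \<alpha> N = (\<Prod>n = 1..N. \<bar>2 * sin (pi * real n * \<alpha>)\<bar>)"

definition ostrowski_digits :: "real \<Rightarrow> nat \<Rightarrow> (nat \<Rightarrow> nat) \<Rightarrow> bool" where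
  "ostrowski_digits \<alpha> K b \<longleftrightarrow>
     (0 < K \<longrightarrow> int (b 0) < cf_a \<alpha> 1) \<and>
     (\<forall>k<K. int (b k) \<le> cf_a \<alpha> (Suc k)) \<and>
     (\<forall>k. 1 \<le> k \<and> k < K \<and> int (b k) = cf_a \<alpha> (Suc k) \<longrightarrow> b (k - 1) = 0)"

definition bstar :: "real \<Rightarrow> nat \<Rightarrow> int" where
  "bstar \<alpha> k = \<lfloor>(5/6) * real_of_int (cf_a \<alpha> (Suc k))\<rfloor>"

end

theory Submission
  imports Defs "HOL-Real_Asymp.Real_Asymp"
begin

text \<open>
  Let \<open>S(r | x)\<close> be the double sine function with periods \<open>1\<close> and \<open>x\<close>. Its two functional
  equations \<open>S(r + x) = S(r) / (2 sin (\<pi> r))\<close> and \<open>S(r + 1) = S(r) / (2 sin (\<pi> r / x))\<close> give the exact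
  reciprocity \<open>P\<^sub>N(x) / P\<^sub>M(1/x) = S(x | x) / S((N+1) x - M | x)\<close>. Iterating along the Gauss map
  \<open>x\<^sub>k \<mapsto> x\<^bsub>k+1\<^esub> = 1/x\<^sub>k - a\<^bsub>k+1\<^esub>\<close> while removing the lowest Ostrowski digit, one obtains
  \<open>log P\<^sub>N(\<alpha>) = \<Sum>\<^sub>k log S(x\<^sub>k | x\<^sub>k) - log S(r\<^sub>k | x\<^sub>k)\<close> without any error term, where
  \<open>r\<^sub>k = x\<^sub>k (b\<^sub>k + 1 - s\<^bsub>k+1\<^esub>)\<close> and \<open>s\<^bsub>k+1\<^esub>\<close> depends on the higher digits only.

  The difference of the \<open>k\<close>-th terms for \<open>N\<close> and \<open>N\<^sup>*\<close> is evaluated by shifting \<open>r\<^sub>k\<close> in steps of \<open>x\<^sub>k\<close> to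
  the vicinity of \<open>5/6\<close>, the zero of \<open>log \<bar>2 sin (\<pi> t)\<bar>\<close>: this produces a Riemann sum, and near \<open>5/6\<close>
  the convexity of \<open>log S\<close> together with its functional equation makes \<open>log S\<close> constant up to
  \<open>O(1/a\<^bsub>k+1\<^esub>)\<close>. If \<open>b\<^sub>k\<close> is close to \<open>a\<^bsub>k+1\<^esub>\<close> and \<open>b\<^bsub>k-1\<^esub> = 0\<close>, then \<open>r\<^bsub>k-1\<^esub>\<close> is near the zero and
  \<open>r\<^sub>k\<close> near the pole of \<open>S\<close>; the term \<open>log (1 - s\<^sub>k)\<close> is moved from one digit to the other so that
  the two singularities cancel.
\<close>

section \<open>The double sine function\<close>

text \<open>Everything comes from one integral: \<open>ldsin x r\<close> integrates a kernel in
  which \<open>r\<close> enters only through \<open>A = 2*r - 1 - x\<close>, inside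
  \<open>sinh (A*t)\<close> and a linear term. Addition formulas for \<open>sinh\<close> give both
  functional equations, oddness gives the reflection \<open>r \<mapsto> 1 + x - r\<close>, and
  convexity of \<open>sinh\<close> gives convexity of log S on the right half of the strip
  \<open>0 < r < 1 + x\<close>. As the decomposition over digits is an identity, errors arise only
  digit by digit, and each has to be O(1/a) uniformly in \<alpha>. The constant 0.2326 leaves hardly
  any room: the integral supplies 0.232603, and the surplus 0.000003 alone pays for the Riemann sum
  errors to the left of 5/6, including a term log a for digits below 0.01 a. Hence the lower bound
  is first obtained for very large a. The remaining a require a bound by a multiple of a, and it is
  the transfer of log (1 - s) that keeps this bound valid near the zero and the pole of S. In the
  end a digit term is raised to the quadratic lower bound where it falls short and set to 0 when the
  digits agree; this costs O(1/a) and rids (i) of any error term.\<close>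

lemma set_integrable_inverse_square:
  fixes B :: real assumes "B > 0"
  shows "set_integrable lborel {B..} (\<lambda>t. 1 / t ^ 2)"
proof -
  have "((\<lambda>t. t powr (-2)) has_integral -(B powr (-2+1)) / (-2+1)) {B..}"
    using has_integral_powr_to_inf[of "-2" B] assms by simp
  hence "(\<lambda>t. t powr (-2)) integrable_on {B..}" by blast
  hence "(\<lambda>t. t powr (-2)) absolutely_integrable_on {B..}"
    by (rule nonnegative_absolutely_integrable_1) auto
  hence "(\<lambda>t. 1 / t ^ 2) absolutely_integrable_on {B..}"
    by (rule absolutely_integrable_spike[where S = "{}"])
       (use assms in \<open>auto simp: powr_minus powr_numeral divide_simps\<close>)
  thus ?thesis
    by (simp add: set_integrable_def integrable_completion)
qed

text \<open>Three pieces: a right neighbourhood of 0 (bounded by the limit), a compact interval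
  (continuity) and a tail (comparison with \<open>C / t ^ 2\<close>).\<close>

lemma set_integrable_greaterThan_0_criterion:
  fixes g :: "real \<Rightarrow> real"
  assumes cont: "continuous_on {0<..} g"
    and lim: "(g \<longlongrightarrow> l) (at_right 0)"
    and bnd: "\<And>t. t \<ge> B \<Longrightarrow> \<bar>g t\<bar> \<le> C / t ^ 2"
  shows "set_integrable lborel {0<..} g"
proof -
  define B' where "B' = max B 1"
  have meas: "set_borel_measurable borel S g" if "S \<subseteq> {0<..}" "S \<in> sets borel" for S
    using that cont by (intro set_measurable_continuous_on) (auto intro: continuous_on_subset)
  have "eventually (\<lambda>t. dist (g t) l < 1) (at_right 0)"
    using lim tendstoD[of g l "at_right 0" 1] by simp
  then obtain d where d: "d > 0" "\<And>t. 0 < t \<Longrightarrow> t < d \<Longrightarrow> \<bar>g t - l\<bar> < 1"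
    by (auto simp: eventually_at_right_field dist_real_def)
  have "continuous_on {d/2..B'} g"
    using d by (intro continuous_on_subset[OF cont]) auto
  hence "bounded (g ` {d/2..B'})"
    by (intro compact_imp_bounded compact_continuous_image) auto
  then obtain M where "\<forall>y\<in>g ` {d/2..B'}. norm y \<le> M"
    unfolding bounded_iff by blast
  hence M: "\<bar>g t\<bar> \<le> M" if "t \<in> {d/2..B'}" for t using that by auto
  have bound1: "\<bar>g t\<bar> \<le> max M (\<bar>l\<bar> + 1)" if "t \<in> {0<..B'}" for t
  proof (cases "t < d")
    case True thus ?thesis using d(2)[of t] that by auto
  next
    case False thus ?thesis using M[of t] that d by auto
  qed
  have "set_integrable lborel {0<..B'} (\<lambda>_. max M (\<bar>l\<bar> + 1))"
    unfolding set_integrable_def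
    by (intro integrable_scaleR_left integrable_real_indicator) (auto simp: B'_def)
  hence 1: "set_integrable lborel {0<..B'} g"
    by (rule set_integrable_bound) (use meas[of "{0<..B'}"] bound1 in \<open>auto simp: set_borel_measurable_def greaterThanAtMost_def\<close>)
  have "set_integrable lborel {B'..} (\<lambda>t. C * (1 / t ^ 2))"
    by (intro set_integrable_mult_right set_integrable_inverse_square) (auto simp: B'_def)
  hence 2: "set_integrable lborel {B'..} g"
  proof (rule set_integrable_bound)
    show "set_borel_measurable lborel {B'..} g"
    proof -
      have "{B'..} \<subseteq> {0<..}" by (auto simp: B'_def)
      thus ?thesis using meas[of "{B'..}"] by (simp add: set_borel_measurable_def)
    qed
    show "AE t in lborel. t \<in> {B'..} \<longrightarrow> norm (g t) \<le> norm (C * (1 / t ^ 2))"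
      using bnd by (intro AE_I2) (force simp: B'_def abs_if)
  qed
  have "set_integrable lborel ({0<..B'} \<union> {B'..}) g"
    using 1 2 by (intro set_integrable_Un) auto
  moreover have "{0<..B'} \<union> {B'..} = {0<..}" by (auto simp: B'_def)
  ultimately show ?thesis by simp
qed

text \<open>With \<open>A = 2*r - 1 - x\<close> this is the classical integrand for the logarithm of
  the double sine function with periods 1 and \<open>x\<close>. Subtracting
  \<open>A / (2*x*t)\<close> removes the pole of the hyperbolic quotient at 0; that quotient is odd
  in \<open>t\<close>, so a finite limit is left after the division by \<open>t\<close>.\<close>

definition sinh_ker :: "real \<Rightarrow> real \<Rightarrow> real \<Rightarrow> real" where
  "sinh_ker x A t = (sinh (A*t) / (2 * sinh t * sinh (x*t)) - A / (2*x*t)) / t"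

lemma sinh_ker_uminus: "sinh_ker x (-A) t = - sinh_ker x A t"
  by (simp add: sinh_ker_def diff_divide_distrib)

lemma sinh_ge_exp:
  fixes y t :: real assumes "y > 0" "t \<ge> 1"
  shows "sinh (y*t) \<ge> (1 - exp (-2*y)) / 2 * exp (y*t)"
proof -
  have "exp (-(2*y*t)) \<le> exp (-2*y)" using assms by simp
  hence "(1 - exp (-2*y)) / 2 * exp (y*t) \<le> (1 - exp (-(2*y*t))) / 2 * exp (y*t)"
    by (intro mult_right_mono) auto
  also have "\<dots> = sinh (y*t)"
    by (simp add: sinh_def algebra_simps exp_add[symmetric] exp_minus[symmetric] diff_divide_distrib)
  finally show ?thesis .
qed

lemma abs_sinh_le_exp: "\<bar>sinh (y::real)\<bar> \<le> exp \<bar>y\<bar>"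
proof -
  have "\<bar>sinh y\<bar> = sinh \<bar>y\<bar>" by simp
  also have "\<dots> \<le> exp \<bar>y\<bar>" by (simp add: sinh_def) (smt (verit) exp_gt_zero)
  finally show ?thesis .
qed

text \<open>The hypothesis on \<open>A\<close> is \<open>0 < r < 1 + x\<close> in disguise. The gap
  \<open>1 + x - \<bar>A\<bar>\<close> makes the hyperbolic quotient decay exponentially; decay of
  order 1/t is all that is extracted, since after the division by \<open>t\<close> the subtracted
  term is of order 1/t^2 anyway.\<close>

lemma sinh_ker_bound:
  fixes x A :: real assumes x: "x > 0" and A: "\<bar>A\<bar> < 1 + x"
  obtains C where "\<And>t. t \<ge> 1 \<Longrightarrow> \<bar>sinh_ker x A t\<bar> \<le> C / t ^ 2"
proof
  define \<delta> where "\<delta> = 1 + x - \<bar>A\<bar>"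
  have \<delta>: "\<delta> > 0" using A by (simp add: \<delta>_def)
  define c1 where "c1 = (1 - exp (-2*(1::real))) / 2"
  define c2 where "c2 = (1 - exp (-2*x)) / 2"
  have c: "c1 > 0" "c2 > 0" using x by (auto simp: c1_def c2_def)
  show "\<bar>sinh_ker x A t\<bar> \<le> (1 / (2 * c1 * c2 * \<delta>) + \<bar>A\<bar> / (2*x)) / t ^ 2" if t: "t \<ge> 1" for t
  proof -
    have s: "sinh t \<ge> c1 * exp t" "sinh (x*t) \<ge> c2 * exp (x*t)"
      using sinh_ge_exp[of 1 t] sinh_ge_exp[of x t] x t by (auto simp: c1_def c2_def)
    have "exp (\<delta> * t) \<ge> \<delta> * t" using exp_ge_add_one_self[of "\<delta>*t"] by linarith
    hence e: "exp (\<bar>A\<bar>*t) * (\<delta> * t) \<le> exp t * exp (x*t)"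
    proof -
      have "exp (\<bar>A\<bar>*t) * (\<delta> * t) \<le> exp (\<bar>A\<bar>*t) * exp (\<delta>*t)"
        using \<open>exp (\<delta> * t) \<ge> \<delta> * t\<close> by (intro mult_left_mono) auto
      also have "\<dots> = exp t * exp (x*t)"
        by (simp add: exp_add[symmetric] \<delta>_def algebra_simps)
      finally show ?thesis .
    qed
    have "(c1 * exp t) * (c2 * exp (x*t)) \<le> sinh t * sinh (x*t)"
      using s c t by (intro mult_mono) auto
    have "\<bar>sinh (A*t)\<bar> \<le> exp (\<bar>A\<bar>*t)" using abs_sinh_le_exp[of "A*t"] t by (simp add: abs_mult)
    hence "\<bar>sinh (A*t) / (2 * sinh t * sinh (x*t))\<bar> \<le> exp (\<bar>A\<bar>*t) / (2 * ((c1 * exp t) * (c2 * exp (x*t))))"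
      unfolding abs_divide using t x c \<open>(c1 * exp t) * (c2 * exp (x*t)) \<le> sinh t * sinh (x*t)\<close>
      by (intro frac_le) (auto simp: abs_mult mult.assoc)
    also have "\<dots> = (exp (\<bar>A\<bar>*t) * (\<delta>*t)) / (exp t * exp (x*t)) * (1 / (2*c1*c2*\<delta>) / t)"
      using c \<delta> t by simp
    also have "\<dots> \<le> 1 * (1 / (2*c1*c2*\<delta>) / t)"
      using e c \<delta> t by (intro mult_right_mono) (auto simp: divide_le_eq_1)
    also have "\<dots> = 1 / (2*c1*c2*\<delta>) / t" by simp
    finally have 1: "\<bar>sinh (A*t) / (2 * sinh t * sinh (x*t))\<bar> \<le> 1 / (2*c1*c2*\<delta>) / t" .
    have 2: "\<bar>A / (2*x*t)\<bar> = \<bar>A\<bar> / (2*x) / t" using x t by (simp add: abs_mult)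
    have "\<bar>sinh_ker x A t\<bar> \<le> (1 / (2*c1*c2*\<delta>) / t + \<bar>A\<bar> / (2*x) / t) / t"
      unfolding sinh_ker_def abs_divide using t 1 2 c \<delta>
      x by (intro frac_le) (auto intro!: order_trans[OF abs_triangle_ineq4] simp del: divide_divide_eq_left)
    also have "\<dots> = (1 / (2 * c1 * c2 * \<delta>) + \<bar>A\<bar> / (2*x)) / t ^ 2"
      by (simp add: power2_eq_square add_divide_distrib)
    finally show ?thesis .
  qed
qed

lemma sinh_ker_tendsto_0:
  assumes "x > 0"
  shows "(sinh_ker x A \<longlongrightarrow> A*(A^2-1-x^2)/(12*x)) (at_right 0)"
proof -
  \<comment> \<open>The expansion is computed for positive \<open>A\<close>; oddness in
    \<open>A\<close> gives the rest.\<close>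
  have pos: "((\<lambda>t. (sinh (A*t) / (2 * sinh t * sinh (x*t)) - A / (2*x*t)) / t) \<longlongrightarrow> A*(A^2-1-x^2)/(12*x)) (at_right 0)"
    if "A > 0" for A
    using that assms by (real_asymp simp: field_simps power2_eq_square)
  consider "A > 0" | "A = 0" | "- A > 0" by linarith
  thus ?thesis
  proof cases
    case 1 thus ?thesis using pos[of A] by (simp add: sinh_ker_def[abs_def])
  next
    case 2 thus ?thesis by (simp add: sinh_ker_def[abs_def])
  next
    case 3
    have "((\<lambda>t. - sinh_ker x (-A) t) \<longlongrightarrow> - ((-A)*((-A)^2-1-x^2)/(12*x))) (at_right 0)"
      using pos[OF 3] by (intro tendsto_minus) (simp add: sinh_ker_def[abs_def])
    thus ?thesis by (simp add: sinh_ker_uminus)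
  qed
qed

lemma set_integrable_sinh_ker:
  assumes "x > 0" "\<bar>A\<bar> < 1 + x"
  shows "set_integrable lborel {0<..} (sinh_ker x A)"
proof -
  obtain C where "\<And>t. t \<ge> 1 \<Longrightarrow> \<bar>sinh_ker x A t\<bar> \<le> C / t ^ 2"
    using sinh_ker_bound assms by blast
  moreover have "continuous_on {0<..} (sinh_ker x A)"
    unfolding sinh_ker_def using assms by (intro continuous_intros) auto
  ultimately show ?thesis
    using sinh_ker_tendsto_0 assms by (intro set_integrable_greaterThan_0_criterion) auto
qed

section \<open>Frullani integrals and the logarithm of the cosine\<close>

lemma frullani_exp:
  fixes p q :: real assumes "0 < p" "p \<le> q"
  shows "has_bochner_integral lborel (\<lambda>t. indicator {0<..} t * ((exp (-p*t) - exp (-q*t)) / t)) (ln q - ln p)"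
proof (rule has_bochner_integral_nn_integral)
  \<comment> \<open>The integrand is the integral of \<open>exp (-u*t)\<close> over \<open>u\<close>
    in \<open>{p..q}\<close>; nonnegativity allows the order of integration to be exchanged.\<close>
  let ?h = "\<lambda>t u::real. ennreal (exp (-u*t) * indicator {p..q} u * indicator {0<..} t)"
  show "(\<lambda>t. indicator {0<..} t * ((exp (-p*t) - exp (-q*t)) / t)) \<in> borel_measurable lborel"
    by measurable
  show "AE t in lborel. 0 \<le> indicator {0<..} t * ((exp (-p*t) - exp (-q*t)) / t)"
    using assms by (intro AE_I2) (auto simp: indicator_def)
  show "0 \<le> ln q - ln p" using assms by simp
  have inner1: "(\<integral>\<^sup>+u. ?h t u \<partial>lborel) = ennreal (indicator {0<..} t * ((exp (-p*t) - exp (-q*t)) / t))" for t :: real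
  proof (cases "t > 0")
    case True
    have "(\<integral>\<^sup>+u. ?h t u \<partial>lborel) = (\<integral>\<^sup>+u. ennreal (exp (-u*t)) * indicator {p..q} u \<partial>lborel)"
      using True by (intro nn_integral_cong) (auto simp: indicator_def)
    also have "\<dots> = ennreal ((- exp (-q*t) / t) - (- exp (-p*t) / t))"
      using True assms by (intro nn_integral_FTC_Icc) (auto intro!: derivative_eq_intros)
    finally show ?thesis using True by (simp add: diff_divide_distrib)
  qed simp
  have inner2: "(\<integral>\<^sup>+t. ?h t u \<partial>lborel) = ennreal (1 / u) * indicator {p..q} u" for u :: real
  proof (cases "u \<in> {p..q}")
    case True
    hence u: "u > 0" using assms by auto
    have "(\<integral>\<^sup>+t. ?h t u \<partial>lborel) = (\<integral>\<^sup>+t. ennreal (exp (-u*t)) * indicator {0..} t \<partial>lborel)"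
    proof (rule nn_integral_cong_AE)
      show "AE t in lborel. ?h t u = ennreal (exp (-u*t)) * indicator {0..} t"
        using AE_lborel_singleton[of "0::real"]
      proof eventually_elim
        case (elim t)
        thus ?case using True by (cases "t > 0") auto
      qed
    qed
    also have "\<dots> = ennreal (0 - (- exp (-u*0) / u))"
    proof (rule nn_integral_FTC_atLeast)
      show "((\<lambda>t. - exp (-u*t) / u) \<longlongrightarrow> 0) at_top" using u by real_asymp
    qed (use u in \<open>auto intro!: derivative_eq_intros\<close>)
    finally show ?thesis using True by simp
  qed simp
  have "(\<integral>\<^sup>+t. ennreal (indicator {0<..} t * ((exp (-p*t) - exp (-q*t)) / t)) \<partial>lborel)
      = (\<integral>\<^sup>+t. (\<integral>\<^sup>+u. ?h t u \<partial>lborel) \<partial>lborel)"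
    by (simp only: inner1)
  also have "\<dots> = (\<integral>\<^sup>+u. (\<integral>\<^sup>+t. ?h t u \<partial>lborel) \<partial>lborel)"
    by (rule lborel_pair.Fubini') measurable
  also have "\<dots> = (\<integral>\<^sup>+u. ennreal (1 / u) * indicator {p..q} u \<partial>lborel)"
    by (simp only: inner2)
  also have "\<dots> = ennreal (ln q - ln p)"
    using assms by (intro nn_integral_FTC_Icc) (auto intro!: derivative_eq_intros)
  finally show "(\<integral>\<^sup>+t. ennreal (indicator {0<..} t * ((exp (-p*t) - exp (-q*t)) / t)) \<partial>lborel) = ennreal (ln q - ln p)" .
qed

text \<open>Since \<open>cos (pi*a/2) = sin (pi*a) / (2 * sin (pi*a/2))\<close>, Euler's product for
  \<open>a\<close> with \<open>2*n\<close> factors is divided by the one for \<open>a/2\<close> with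
  \<open>n\<close> factors: the even-indexed factors cancel and the odd ones remain.\<close>

lemma ln_cos_sums:
  fixes a :: real assumes "\<bar>a\<bar> < 1"
  shows "(\<lambda>n. - ln (1 - a^2 / (2 * real n + 1)^2)) sums (- ln (cos (pi * a / 2)))"
proof (cases "a = 0")
  case False
  let ?P = "\<lambda>y n. pi * y * (\<Prod>k=1..n. 1 - y^2 / of_nat k^2)"
  have lim1: "(\<lambda>n. ?P a (2*n)) \<longlonglongrightarrow> sin (pi * a)"
    using LIMSEQ_subseq_LIMSEQ[OF sin_product_formula_real[of a], of "\<lambda>n. 2*n"]
    by (simp add: o_def strict_mono_def)
  have lim2: "(\<lambda>n. ?P (a/2) n) \<longlonglongrightarrow> sin (pi * (a/2))"
    by (rule sin_product_formula_real)
  have lt: "\<bar>pi * (a/2)\<bar> < pi / 2" using assms by (simp add: abs_mult)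
  have s0: "sin (pi * (a/2)) \<noteq> 0"
  proof
    assume "sin (pi * (a/2)) = 0"
    moreover have "- pi < pi * (a/2)" "pi * (a/2) < pi" using lt pi_gt_zero by linarith+
    ultimately have "pi * (a/2) = 0" using sin_eq_0_pi by blast
    thus False using False by simp
  qed
  have "(\<lambda>n. ?P a (2*n) / (2 * ?P (a/2) n)) \<longlonglongrightarrow> sin (pi * a) / (2 * sin (pi * (a/2)))"
    using s0 by (intro tendsto_intros lim1 lim2) auto
  also have "sin (pi * a) / (2 * sin (pi * (a/2))) = cos (pi * a / 2)"
    using s0 sin_double[of "pi * a / 2"] by simp
  also have "(\<lambda>n. ?P a (2*n) / (2 * ?P (a/2) n)) = (\<lambda>n. \<Prod>k<n. 1 - a^2 / (2 * real k + 1)^2)"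
  proof
    fix n
    have nz: "(1 - (a/2)^2 / (real k)^2) \<noteq> 0" if "k \<ge> 1" for k
    proof -
      have "(a/2)^2 < 1" using assms by (simp add: abs_square_less_1)
      moreover have "(real k)^2 \<ge> 1" using that by simp
      ultimately have "(a/2)^2 < (real k)^2" by linarith
      moreover have "0 < (real k)^2" using that by simp
      ultimately have "(a/2)^2 / (real k)^2 < 1" by (simp only: divide_less_eq_1_pos)
      thus ?thesis by linarith
    qed
    have "(\<Prod>k=1..2*n. 1 - a^2 / of_nat k^2) = (\<Prod>k=1..n. 1 - (a/2)^2 / of_nat k^2) * (\<Prod>k<n. 1 - a^2 / (2 * real k + 1)^2)"
    proof (induction n)
      case (Suc n)
      have *: "{1..2 * Suc n} = insert (2*n+2) (insert (2*n+1) {1..2*n})" by auto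
      have **: "{1..Suc n} = insert (Suc n) {1..n}" by auto
      have e: "a^2 / of_nat (2*n+2)^2 = (a/2)^2 / (of_nat (Suc n))^2"
      proof -
        have "of_nat (2*n+2) = (2 * of_nat (Suc n) :: real)" by simp
        thus ?thesis by (simp only: power_mult_distrib power_divide) simp
      qed
      have e': "of_nat (2*n+1) = (2 * real n + 1)" by simp
      have "(\<Prod>k=1..2 * Suc n. 1 - a^2 / of_nat k^2) = (1 - a^2 / of_nat (2*n+2)^2) * ((1 - a^2 / of_nat (2*n+1)^2) * (\<Prod>k=1..2*n. 1 - a^2 / of_nat k^2))"
        unfolding * by (subst prod.insert, simp, simp, subst prod.insert) auto
      also have "\<dots> = (\<Prod>k=1..Suc n. 1 - (a/2)^2 / of_nat k^2) * (\<Prod>k<Suc n. 1 - a^2 / (2 * real k + 1)^2)"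
        unfolding Suc.IH e e' ** by (subst prod.insert, simp, simp, subst prod.lessThan_Suc) (simp only: mult_ac)
      finally show ?case .
    qed simp
    moreover have "(\<Prod>k=1..n. 1 - (a/2)^2 / of_nat k^2) \<noteq> 0" using nz by auto
    ultimately show "?P a (2*n) / (2 * ?P (a/2) n) = (\<Prod>k<n. 1 - a^2 / (2 * real k + 1)^2)"
      using False by simp
  qed
  finally have lim: "(\<lambda>n. \<Prod>k<n. 1 - a^2 / (2 * real k + 1)^2) \<longlonglongrightarrow> cos (pi * a / 2)" .
  have cpos: "cos (pi * a / 2) > 0"
  proof -
    have "pi * a / 2 = pi * (a/2)" by simp
    thus ?thesis using lt by (intro cos_gt_zero_pi) linarith+
  qed
  have pos: "1 - a^2 / (2 * real k + 1)^2 > 0" for k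
  proof -
    have "a^2 < 1" using assms by (simp add: abs_square_less_1)
    moreover have "(2 * real k + 1)^2 \<ge> 1" by simp
    ultimately have "a^2 < (2 * real k + 1)^2" by linarith
    thus ?thesis by simp
  qed
  have "(\<lambda>n. - ln (\<Prod>k<n. 1 - a^2 / (2 * real k + 1)^2)) \<longlonglongrightarrow> - ln (cos (pi * a / 2))"
    using cpos by (intro tendsto_intros lim) auto
  also have "(\<lambda>n. - ln (\<Prod>k<n. 1 - a^2 / (2 * real k + 1)^2)) = (\<lambda>n. \<Sum>k<n. - ln (1 - a^2 / (2 * real k + 1)^2))"
  proof
    fix n
    show "- ln (\<Prod>k<n. 1 - a^2 / (2 * real k + 1)^2) = (\<Sum>k<n. - ln (1 - a^2 / (2 * real k + 1)^2))"
      unfolding sum_negf neg_equal_iff_equal by (rule ln_prod, simp, metis pos less_irrefl)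
  qed
  finally show ?thesis by (simp add: sums_def)
qed simp

text \<open>Expanding \<open>1 / sinh t\<close> as a geometric series in \<open>exp (-2*t)\<close>
  turns the integral into a series of Frullani integrals, which is the series of
  \<open>ln_cos_sums\<close>. All terms are nonnegative, so termwise integration is monotone
  convergence.\<close>

lemma integral_cosh_sinh:
  fixes a :: real assumes a: "\<bar>a\<bar> < 1"
  shows "has_bochner_integral lborel (\<lambda>t. indicator {0<..} t * ((cosh (a*t) - 1) / (t * sinh t))) (- ln (cos (pi * a / 2)))"
proof (rule has_bochner_integral_nn_integral)
  define h where "h n t = indicator {0<..} t * ((exp (-(2*real n+1-a)*t) + exp (-(2*real n+1+a)*t) - 2 * exp (-(2*real n+1)*t)) / t)" for n :: nat and t :: real
  define v where "v n = - ln (1 - a^2 / (2 * real n + 1)^2)" for n :: nat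
  have h_eq: "h n t = indicator {0<..} t * (2 * exp (-t) * ((exp (-2*t)) ^ n) * ((cosh (a*t) - 1) / t))" for n t
  proof -
    have "exp (-(2*real n+1-a)*t) = exp (-t) * (exp (-2*t)) ^ n * exp (a*t)"
      "exp (-(2*real n+1+a)*t) = exp (-t) * (exp (-2*t)) ^ n * exp (-(a*t))"
      "exp (-(2*real n+1)*t) = exp (-t) * (exp (-2*t)) ^ n"
      by (simp_all add: exp_of_nat_mult[symmetric] exp_add[symmetric] algebra_simps)
    thus ?thesis unfolding h_def cosh_def by (cases "t > 0") (simp_all add: field_simps)
  qed
  have h_nonneg: "h n t \<ge> 0" for n t
    unfolding h_eq using cosh_real_ge_1[of "a*t"] by (auto simp: indicator_def)
  have h_sums: "(\<lambda>n. h n t) sums (indicator {0<..} t * ((cosh (a*t) - 1) / (t * sinh t)))" for t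
  proof (cases "t > 0")
    case True
    have "(\<lambda>n. (exp (-2*t)) ^ n) sums (1 / (1 - exp (-2*t)))"
      using True by (intro geometric_sums) auto
    hence "(\<lambda>n. (2 * exp (-t) * ((cosh (a*t) - 1) / t)) * (exp (-2*t)) ^ n) sums ((2 * exp (-t) * ((cosh (a*t) - 1) / t)) * (1 / (1 - exp (-2*t))))"
      by (rule sums_mult)
    also have "(2 * exp (-t) * ((cosh (a*t) - 1) / t)) * (1 / (1 - exp (-2*t))) = (cosh (a*t) - 1) / (t * sinh t)"
    proof -
      have "exp (-2*t) = exp (-t) * exp (-t)" by (simp add: exp_add[symmetric])
      moreover have "exp t = 1 / exp (-t)" by (simp add: exp_minus field_simps)
      moreover have "exp (-t) < 1" using True by simp
      moreover have "exp (-t) > 0" by simp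
      moreover have "exp (-t) * exp (-t) < 1" using mult_strict_mono[of "exp (-t)" 1 "exp (-t)" 1] \<open>exp (-t) < 1\<close> by simp
      moreover have "2 * e * (c / t) * (1 / (1 - e * e)) = c / (t * ((1 / e - e) / 2))" if "e > 0" "e * e < 1" for e c :: real
      proof -
        have "(1 / e - e) / 2 = (1 - e * e) / (2 * e)" using that by (simp add: field_simps)
        show ?thesis unfolding \<open>(1 / e - e) / 2 = (1 - e * e) / (2 * e)\<close> using that by (simp add: mult_ac)
      qed
      ultimately show ?thesis unfolding sinh_def by (simp add: scaleR_conv_of_real)
    qed
    also have "(\<lambda>n. (2 * exp (-t) * ((cosh (a*t) - 1) / t)) * (exp (-2*t)) ^ n) = (\<lambda>n. h n t)"
      using True by (auto simp: h_eq)
    finally show ?thesis using True by simp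
  qed (simp add: h_def)
  have h_meas [measurable]: "h n \<in> borel_measurable lborel" for n
    unfolding h_def by measurable
  have int_h: "has_bochner_integral lborel (h n) (v n)" for n
  proof -
    \<comment> \<open>A second difference of exponentials is a difference of two Frullani
      integrands; \<open>\<bar>a\<bar>\<close> puts the exponents in increasing order.\<close>
    let ?p = "2*real n+1-\<bar>a\<bar>" and ?c = "2*real n+1" and ?q = "2*real n+1+\<bar>a\<bar>"
    have p: "?p > 0" using a by linarith
    have "has_bochner_integral lborel (\<lambda>t. indicator {0<..} t * ((exp (-?p*t) - exp (-?c*t)) / t) -
            indicator {0<..} t * ((exp (-?c*t) - exp (-?q*t)) / t)) ((ln ?c - ln ?p) - (ln ?q - ln ?c))"
      using p by (intro has_bochner_integral_diff frullani_exp) auto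
    also have "(\<lambda>t. indicator {0<..} t * ((exp (-?p*t) - exp (-?c*t)) / t) -
            indicator {0<..} t * ((exp (-?c*t) - exp (-?q*t)) / t)) = h n"
    proof
      fix t
      have "exp (-?p*t) + exp (-?q*t) = exp (-(2*real n+1-a)*t) + exp (-(2*real n+1+a)*t)"
        by (cases "a \<ge> 0") simp_all
      moreover have "i * ((P - c) / t) - i * ((c - Q) / t) = i * ((P + Q - 2 * c) / t)" for i P c Q :: real
        by (simp add: diff_divide_distrib add_divide_distrib algebra_simps)
      ultimately show "indicator {0<..} t * ((exp (-?p*t) - exp (-?c*t)) / t) -
            indicator {0<..} t * ((exp (-?c*t) - exp (-?q*t)) / t) = h n t"
        by (simp only: h_def)
    qed
    also have "(ln ?c - ln ?p) - (ln ?q - ln ?c) = - ln ((?p * ?q) / (?c * ?c))"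
      using p by (simp add: ln_div ln_mult)
    also have "(?p * ?q) / (?c * ?c) = 1 - a^2 / ?c^2"
    proof -
      have "(\<bar>a\<bar>)^2 = a^2" by simp
      hence "?p * ?q = ?c^2 - a^2" by (simp add: algebra_simps power2_eq_square)
      thus ?thesis by (simp add: diff_divide_distrib power2_eq_square)
    qed
    finally show ?thesis by (simp add: v_def)
  qed
  have v_nonneg: "v n \<ge> 0" for n
    using int_h[of n] h_nonneg[of n] integral_nonneg_AE[of "h n" lborel]
    by (simp add: has_bochner_integral_iff)
  have v_sums: "v sums (- ln (cos (pi * a / 2)))"
    unfolding v_def by (rule ln_cos_sums[OF a])
  have "(\<integral>\<^sup>+t. ennreal (indicator {0<..} t * ((cosh (a*t) - 1) / (t * sinh t))) \<partial>lborel)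
      = (\<integral>\<^sup>+t. (\<Sum>n. ennreal (h n t)) \<partial>lborel)"
    by (simp only: suminf_ennreal2[OF h_nonneg sums_summable[OF h_sums]] sums_unique[OF h_sums, symmetric])
  also have "\<dots> = (\<Sum>n. \<integral>\<^sup>+t. ennreal (h n t) \<partial>lborel)"
    by (intro nn_integral_suminf) auto
  also have "\<dots> = (\<Sum>n. ennreal (v n))"
  proof (intro suminf_cong)
    fix n
    show "(\<integral>\<^sup>+t. ennreal (h n t) \<partial>lborel) = ennreal (v n)"
      using int_h[of n] h_nonneg[of n] nn_integral_eq_integral[of lborel "h n"]
      by (simp add: has_bochner_integral_iff)
  qed
  also have "\<dots> = ennreal (- ln (cos (pi * a / 2)))"
    by (simp only: suminf_ennreal2[OF v_nonneg sums_summable[OF v_sums]] sums_unique[OF v_sums, symmetric])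
  finally show "(\<integral>\<^sup>+t. ennreal (indicator {0<..} t * ((cosh (a*t) - 1) / (t * sinh t))) \<partial>lborel) = ennreal (- ln (cos (pi * a / 2)))" .
  show "(\<lambda>t. indicator {0<..} t * ((cosh (a*t) - 1) / (t * sinh t))) \<in> borel_measurable lborel"
    unfolding sinh_def cosh_def by measurable
  show "AE t in lborel. 0 \<le> indicator {0<..} t * ((cosh (a*t) - 1) / (t * sinh t))"
    using cosh_real_ge_1 by (intro AE_I2) (auto simp: indicator_def)
  show "0 \<le> - ln (cos (pi * a / 2))"
    using sums_unique[OF v_sums] suminf_nonneg[OF sums_summable[OF v_sums] v_nonneg] by simp
qed

section \<open>The two functional equations of the double sine function\<close>

definition lsin :: "real \<Rightarrow> real" where
  "lsin t = ln \<bar>2 * sin (pi * t)\<bar>"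

text \<open>The change of \<open>sinh_ker\<close> under \<open>r \<mapsto> r + x\<close>, with
  \<open>a = 2*r - 1\<close>; for \<open>0 < r < 1\<close> its integral will be
  \<open>- lsin r\<close>.\<close>

definition cosh_ker :: "real \<Rightarrow> real \<Rightarrow> real" where
  "cosh_ker a t = (cosh (a*t) / sinh t - 1 / t) / t"

lemma diff_diff_divide: "(a / d - p) / t - (b / d - q) / t = ((a - b) / d - (p - q)) / (t::real)"
  by (simp add: diff_divide_distrib)

lemma sinh_ker_diff_x:
  assumes "x > 0" "t > 0"
  shows "sinh_ker x (a + x) t - sinh_ker x (a - x) t = cosh_ker a t"
proof -
  have s: "sinh t \<noteq> 0" "sinh (x*t) \<noteq> 0" using assms by auto
  have "sinh ((a + x) * t) - sinh ((a - x) * t) = 2 * cosh (a*t) * sinh (x*t)"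
    by (simp add: distrib_right left_diff_distrib sinh_add sinh_diff)
  hence "(sinh ((a + x) * t) - sinh ((a - x) * t)) / (2 * sinh t * sinh (x*t)) = cosh (a*t) / sinh t"
    using s by simp
  moreover have "(a + x) / (2*x*t) - (a - x) / (2*x*t) = 1 / t"
    using assms by (simp add: diff_divide_distrib[symmetric])
  ultimately show ?thesis
    unfolding sinh_ker_def cosh_ker_def diff_diff_divide by simp
qed

text \<open>The two periods exchange their roles: now \<open>sinh t\<close> cancels, and rescaling
  \<open>t\<close> by \<open>x\<close> normalises the remaining period to 1.\<close>

lemma sinh_ker_diff_1:
  assumes "x > 0" "t > 0"
  shows "sinh_ker x (a + 1) t - sinh_ker x (a - 1) t = x * cosh_ker (a / x) (x * t)"
proof -
  have s: "sinh t \<noteq> 0" "sinh (x*t) \<noteq> 0" using assms by auto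
  have "sinh ((a + 1) * t) - sinh ((a - 1) * t) = 2 * cosh (a*t) * sinh t"
    by (simp add: distrib_right left_diff_distrib sinh_add sinh_diff)
  hence "(sinh ((a + 1) * t) - sinh ((a - 1) * t)) / (2 * sinh t * sinh (x*t)) = cosh (a*t) / sinh (x*t)"
    using s by simp
  moreover have "(a + 1) / (2*x*t) - (a - 1) / (2*x*t) = 1 / (x * t)"
    using assms by (simp add: diff_divide_distrib[symmetric])
  moreover have "x * cosh_ker (a / x) (x * t) = (cosh (a*t) / sinh (x*t) - 1 / (x * t)) / t"
    using assms by (simp add: cosh_ker_def)
  ultimately show ?thesis
    unfolding sinh_ker_def diff_diff_divide by simp
qed

text \<open>Integrability is inherited from the double sine kernel, taken with
  \<open>x = 1\<close>.\<close>

lemma set_integrable_cosh_ker: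
  assumes "\<bar>a\<bar> < 1"
  shows "set_integrable lborel {0<..} (cosh_ker a)"
proof -
  have "set_integrable lborel {0<..} (\<lambda>t. sinh_ker 1 (a + 1) t - sinh_ker 1 (a - 1) t)"
    using assms by (intro set_integral_diff set_integrable_sinh_ker) auto
  thus ?thesis
    by (rule set_integrable_cong[THEN iffD1, rotated -1]) (auto simp: sinh_ker_diff_x)
qed

lemma set_lebesgue_integral_scale_pos:
  fixes f :: "real \<Rightarrow> real" assumes "c > 0"
  shows "(LBINT t:{0<..}. c * f (c * t)) = (LBINT t:{0<..}. f t)"
proof -
  have "(LBINT t:{0<..}. f t) = \<bar>c\<bar> * (\<integral>t. indicator {0<..} (0 + c * t) *\<^sub>R f (0 + c * t) \<partial>lborel)"
    unfolding set_lebesgue_integral_def using assms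
    by (subst lborel_integral_real_affine[of c _ 0]) auto
  also have "\<dots> = c * (LBINT t:{0<..}. f (c * t))"
    unfolding set_lebesgue_integral_def using assms
    by (intro arg_cong2[of _ _ _ _ "(*)"] Bochner_Integration.integral_cong)
       (auto simp: indicator_def zero_less_mult_iff)
  finally show ?thesis by simp
qed

lemma integral_cosh_ker_diff:
  assumes "\<bar>a\<bar> < 1"
  shows "(LBINT t:{0<..}. cosh_ker a t) = (LBINT t:{0<..}. cosh_ker 0 t) - ln (cos (pi * a / 2))"
proof -
  have "(LBINT t:{0<..}. cosh_ker a t) - (LBINT t:{0<..}. cosh_ker 0 t) = (LBINT t:{0<..}. cosh_ker a t - cosh_ker 0 t)"
    using assms by (intro set_integral_diff(2)[symmetric] set_integrable_cosh_ker) auto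
  also have "\<dots> = (LBINT t:{0<..}. (cosh (a*t) - 1) / (t * sinh t))"
    by (intro set_lebesgue_integral_cong) (auto simp: cosh_ker_def diff_divide_distrib mult.commute)
  also have "\<dots> = - ln (cos (pi * a / 2))"
    using integral_cosh_sinh[OF assms]
    by (simp add: set_lebesgue_integral_def has_bochner_integral_iff)
  finally show ?thesis by simp
qed

text \<open>Duplication fixes the constant. As \<open>sinh t = 2 * sinh (t/2) * cosh (t/2)\<close>,
  the kernel for 1/2 is half of a rescaled copy of the kernel for 0, so its integral is half as
  large; the two integrals also differ by \<open>ln (cos (pi/4)) = - ln 2 / 2\<close>.\<close>

lemma integral_cosh_ker_0: "(LBINT t:{0<..}. cosh_ker 0 t) = - ln 2"
proof -
  have eq: "cosh_ker (1/2) t = 1/2 * (1/2 * cosh_ker 0 (1/2 * t))" if "t > 0" for t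
  proof -
    have "sinh t = 2 * sinh (t/2) * cosh (t/2)" using sinh_double[of "t/2"] by simp
    moreover have "sinh (t/2) \<noteq> 0" "cosh (t/2) \<noteq> 0"
      using that cosh_real_pos[of "t/2"] by (auto simp del: cosh_real_pos)
    ultimately show ?thesis using that unfolding cosh_ker_def by (simp add: field_simps)
  qed
  have "(LBINT t:{0<..}. cosh_ker (1/2) t) = (LBINT t:{0<..}. 1/2 * (1/2 * cosh_ker 0 (1/2 * t)))"
    by (intro set_lebesgue_integral_cong) (auto simp: eq)
  also have "\<dots> = 1/2 * (LBINT t:{0<..}. 1/2 * cosh_ker 0 (1/2 * t))"
    by (rule set_integral_mult_right)
  also have "\<dots> = 1/2 * (LBINT t:{0<..}. cosh_ker 0 t)"
    by (subst set_lebesgue_integral_scale_pos) auto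
  finally have "(LBINT t:{0<..}. cosh_ker (1/2) t) = 1/2 * (LBINT t:{0<..}. cosh_ker 0 t)" .
  moreover have "(LBINT t:{0<..}. cosh_ker (1/2) t) = (LBINT t:{0<..}. cosh_ker 0 t) - ln (cos (pi * (1/2) / 2))"
    by (rule integral_cosh_ker_diff) auto
  moreover have "ln (cos (pi * (1/2) / 2)) = - ln 2 / 2"
    by (simp add: cos_45 ln_div ln_sqrt)
  ultimately show ?thesis by simp
qed

lemma integral_cosh_ker:
  assumes "0 < r" "r < 1"
  shows "(LBINT t:{0<..}. cosh_ker (2*r - 1) t) = - lsin r"
proof -
  have "cos (pi * (2*r - 1) / 2) = cos (pi/2 - pi * r)"
    by (subst cos_minus[symmetric]) (simp add: algebra_simps diff_divide_distrib)
  hence c: "cos (pi * (2*r - 1) / 2) = sin (pi * r)" by (simp add: cos_diff)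
  have s: "sin (pi * r) > 0" using assms by (intro sin_gt_zero) auto
  show ?thesis
    using assms s by (subst integral_cosh_ker_diff) (auto simp: c integral_cosh_ker_0 lsin_def ln_mult abs_mult)
qed

text \<open>The logarithm of the double sine function \<open>S\<^sub>2(r | 1, x)\<close>.\<close>

definition ldsin :: "real \<Rightarrow> real \<Rightarrow> real" where
  "ldsin x r = (LBINT t:{0<..}. sinh_ker x (2*r - 1 - x) t)"

lemma ldsin_add_x:
  assumes "x > 0" "0 < r" "r < 1"
  shows "ldsin x (r + x) = ldsin x r - lsin r"
proof -
  have "ldsin x (r + x) - ldsin x r = (LBINT t:{0<..}. sinh_ker x (2*(r+x) - 1 - x) t - sinh_ker x (2*r - 1 - x) t)"
    unfolding ldsin_def using assms by (intro set_integral_diff(2)[symmetric] set_integrable_sinh_ker) auto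
  also have "\<dots> = (LBINT t:{0<..}. cosh_ker (2*r - 1) t)"
  proof (intro set_lebesgue_integral_cong)
    show "\<forall>t. t \<in> {0<..} \<longrightarrow> sinh_ker x (2*(r+x) - 1 - x) t - sinh_ker x (2*r - 1 - x) t = cosh_ker (2*r - 1) t"
      using sinh_ker_diff_x[of x _ "2*r - 1"] assms by (simp add: algebra_simps)
  qed simp
  also have "\<dots> = - lsin r" by (rule integral_cosh_ker) fact+
  finally show ?thesis by simp
qed

lemma ldsin_add_1:
  assumes "x > 0" "0 < r" "r < x"
  shows "ldsin x (r + 1) = ldsin x r - lsin (r / x)"
proof -
  have "ldsin x (r + 1) - ldsin x r = (LBINT t:{0<..}. sinh_ker x (2*(r+1) - 1 - x) t - sinh_ker x (2*r - 1 - x) t)"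
    unfolding ldsin_def using assms by (intro set_integral_diff(2)[symmetric] set_integrable_sinh_ker) auto
  also have "\<dots> = (LBINT t:{0<..}. x * cosh_ker (2*(r/x) - 1) (x*t))"
  proof (intro set_lebesgue_integral_cong)
    have "2*(r/x) - 1 = (2*r - x) / x" using assms by (simp add: diff_divide_distrib)
    thus "\<forall>t. t \<in> {0<..} \<longrightarrow> sinh_ker x (2*(r+1) - 1 - x) t - sinh_ker x (2*r - 1 - x) t = x * cosh_ker (2*(r/x) - 1) (x*t)"
      using sinh_ker_diff_1[of x _ "2*r - x"] assms by (simp add: algebra_simps)
  qed simp
  also have "\<dots> = (LBINT t:{0<..}. cosh_ker (2*(r/x) - 1) t)"
    by (rule set_lebesgue_integral_scale_pos) fact
  also have "\<dots> = - lsin (r/x)" using assms by (intro integral_cosh_ker) auto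
  finally show ?thesis by simp
qed

lemma ldsin_reflect: "ldsin x (1 + x - r) = - ldsin x r"
proof -
  have "ldsin x (1 + x - r) = (LBINT t:{0<..}. sinh_ker x (- (2*r - 1 - x)) t)"
    by (simp add: ldsin_def algebra_simps)
  also have "\<dots> = - ldsin x r"
    unfolding sinh_ker_uminus ldsin_def set_lebesgue_integral_def by simp
  finally show ?thesis .
qed

section \<open>Convexity of log S\<close>

lemma convex_on_sinh: "convex_on {0..} (sinh :: real \<Rightarrow> real)"
proof (rule f''_ge0_imp_convex)
  show "DERIV sinh y :> cosh y" "DERIV cosh y :> sinh y" for y :: real
    by (auto intro!: derivative_eq_intros)
qed auto

text \<open>For \<open>r \<ge> (1+x)/2\<close> the number \<open>2*r - 1 - x\<close> is nonnegative,
  where \<open>sinh\<close> is convex; the denominators are positive and the subtracted term is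
  linear in \<open>r\<close>, so the integrand is convex in \<open>r\<close> for each
  \<open>t\<close>.\<close>

lemma convex_on_ldsin:
  assumes x: "x > 0"
  shows "convex_on {(1+x)/2..<1+x} (ldsin x)"
proof (rule convex_onI)
  fix u r r' :: real
  assume u: "0 < u" "u < 1" and r: "r \<in> {(1+x)/2..<1+x}" "r' \<in> {(1+x)/2..<1+x}"
  let ?c = "(1 - u) * r + u * r'"
  let ?A = "\<lambda>r. 2*r - 1 - x"
  have mem: "?c \<in> {(1+x)/2..<1+x}"
    using convexD_alt[of "{(1+x)/2..<1+x}" r r' u] u r by simp
  have int: "set_integrable lborel {0<..} (sinh_ker x (?A r))" if "r \<in> {(1+x)/2..<1+x}" for r
    using that x by (intro set_integrable_sinh_ker) auto
  have "ldsin x ?c \<le> (LBINT t:{0<..}. (1-u) * sinh_ker x (?A r) t + u * sinh_ker x (?A r') t)"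
    unfolding ldsin_def
  proof (rule set_integral_mono)
    show "set_integrable lborel {0<..} (\<lambda>t. (1-u) * sinh_ker x (?A r) t + u * sinh_ker x (?A r') t)"
      by (intro set_integral_add set_integrable_mult_right int r)
    fix t :: real assume t: "t \<in> {0<..}"
    have lin: "?A ?c = (1-u) * ?A r + u * ?A r'" by (simp add: algebra_simps)
    have "sinh ((1-u) * (?A r * t) + u * (?A r' * t)) \<le> (1-u) * sinh (?A r * t) + u * sinh (?A r' * t)"
      using convex_onD[OF convex_on_sinh, of u "?A r * t" "?A r' * t"] u r t by auto
    hence "sinh (?A ?c * t) \<le> (1-u) * sinh (?A r * t) + u * sinh (?A r' * t)"
      unfolding lin by (simp add: algebra_simps)
    hence "sinh (?A ?c * t) / (2 * sinh t * sinh (x*t)) \<le> ((1-u) * sinh (?A r * t) + u * sinh (?A r' * t)) / (2 * sinh t * sinh (x*t))"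
      using t x by (intro divide_right_mono) simp_all
    from divide_right_mono[OF diff_right_mono[OF this, of "?A ?c / (2*x*t)"], of t]
    have "(sinh (?A ?c * t) / (2 * sinh t * sinh (x*t)) - ?A ?c / (2*x*t)) / t
       \<le> (((1-u) * sinh (?A r * t) + u * sinh (?A r' * t)) / (2 * sinh t * sinh (x*t)) - ?A ?c / (2*x*t)) / t"
      using t by simp
    also have "\<dots> = (1-u) * sinh_ker x (?A r) t + u * sinh_ker x (?A r') t"
      unfolding lin sinh_ker_def by (simp add: add_divide_distrib diff_divide_distrib right_diff_distrib)
    finally show "sinh_ker x (?A ?c) t \<le> (1-u) * sinh_ker x (?A r) t + u * sinh_ker x (?A r') t"
      by (simp add: sinh_ker_def)
  qed (intro int mem)
  also have "\<dots> = (LBINT t:{0<..}. (1-u) * sinh_ker x (?A r) t) + (LBINT t:{0<..}. u * sinh_ker x (?A r') t)"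
    by (intro set_integral_add(2) set_integrable_mult_right int r)
  also have "\<dots> = (1-u) * ldsin x r + u * ldsin x r'"
    by (simp add: ldsin_def)
  finally show "ldsin x ((1 - u) *\<^sub>R r + u *\<^sub>R r') \<le> (1 - u) * ldsin x r + u * ldsin x r'" by simp
qed simp

section \<open>Reciprocity for Sudler products\<close>

lemma lsin_minus [simp]: "lsin (-t) = lsin t"
  by (simp add: lsin_def abs_mult)

lemma lsin_add_of_int [simp]: "lsin (t + of_int m) = lsin t"
  by (simp add: lsin_def distrib_left sin_add abs_mult sin_npi_int cos_npi_int)

lemma lsin_diff_of_int [simp]: "lsin (t - of_int m) = lsin t"
  using lsin_add_of_int[of t "-m"] by simp

lemma lsin_one_minus: "lsin (1 - t) = lsin t"
  using lsin_add_of_int[of "-t" 1] by (simp add: algebra_simps)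

lemma lsin_eq: "0 < t \<Longrightarrow> t < 1 \<Longrightarrow> lsin t = ln (2 * sin (pi * t))"
  using sin_gt_zero[of "pi * t"] by (simp add: lsin_def)

lemma lsin_half: "lsin (1/2) = ln 2"
  by (simp add: lsin_def)

lemma sin_pi_mult_irrational_nonzero:
  assumes "x \<notin> \<rat>" "n > 0"
  shows "sin (pi * real n * x) \<noteq> 0"
proof
  assume "sin (pi * real n * x) = 0"
  then obtain i :: int where "pi * real n * x = of_int i * pi"
    by (auto simp: sin_zero_iff_int2)
  hence "pi * (real n * x) = pi * of_int i" by (simp add: mult_ac)
  hence "real n * x = of_int i" by simp
  hence "x = of_int i / of_int (int n)" using assms by (simp add: field_simps)
  thus False using assms by auto
qed

lemma sudler_pos:
  assumes "x \<notin> \<rat>" shows "sudler x N > 0"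
  unfolding sudler_def using sin_pi_mult_irrational_nonzero[OF assms] by (intro prod_pos) auto

lemma sudler_Suc: "sudler x (Suc N) = sudler x N * \<bar>2 * sin (pi * real (Suc N) * x)\<bar>"
  by (simp add: sudler_def)

lemma ln_sudler_Suc:
  assumes "x \<notin> \<rat>"
  shows "ln (sudler x (Suc N)) = ln (sudler x N) + lsin (real (Suc N) * x)"
  using sudler_pos[OF assms, of N] sin_pi_mult_irrational_nonzero[OF assms, of "Suc N"]
  by (simp only: sudler_Suc lsin_def) (subst ln_mult_pos, auto simp: mult.assoc)

lemma ln_sudler_0 [simp]: "ln (sudler x 0) = 0"
  by (simp add: sudler_def)

lemma sudler_add_of_int: "sudler (x + of_int m) N = sudler x N"
proof -
  have "\<bar>2 * sin (pi * real n * (x + of_int m))\<bar> = \<bar>2 * sin (pi * real n * x)\<bar>" for n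
  proof -
    have "pi * real n * (x + of_int m) = pi * real n * x + pi * of_int (int n * m)"
      by (simp add: algebra_simps)
    thus ?thesis by (simp only: sin_add sin_npi_int cos_npi_int) (simp add: abs_mult)
  qed
  thus ?thesis by (simp only: sudler_def)
qed

text \<open>A lattice walk from \<open>(0, 0)\<close> to \<open>(N, M)\<close> keeps
  \<open>(N+1)*x - M\<close> inside \<open>(0, 1+x)\<close>: above \<open>x\<close> the last step
  has raised \<open>N\<close>, below \<open>x\<close> it has raised \<open>M\<close>, and each step
  is one functional equation.\<close>

theorem sudler_reciprocity:
  assumes x: "x > 0" "x \<notin> \<rat>"
    and "0 < (real N + 1) * x - real M" "(real N + 1) * x - real M < 1 + x"
  shows "ln (sudler x N) - ln (sudler (1/x) M) = ldsin x x - ldsin x ((real N + 1) * x - real M)"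
  using assms(3,4)
proof (induction "N + M" arbitrary: N M rule: less_induct)
  case less
  define r where "r = (real N + 1) * x - real M"
  have ix: "1/x \<notin> \<rat>" using x by (metis Rats_1 Rats_divide div_by_1 divide_divide_eq_right mult_1)
  show ?case
  proof (cases "r > x")
    case True
    have "N \<noteq> 0"
    proof
      assume "N = 0" thus False using True by (simp add: r_def)
    qed
    then obtain N' where N: "N = Suc N'" by (cases N) auto
    have r': "(real N' + 1) * x - real M = r - x" by (simp add: r_def N algebra_simps)
    have "ln (sudler x N') - ln (sudler (1/x) M) = ldsin x x - ldsin x (r - x)"
      using less.hyps[of N' M] True less.prems x unfolding r' by (auto simp: N r_def)
    moreover have "ldsin x (r - x + x) = ldsin x (r - x) - lsin (r - x)"
      using True less.prems x by (intro ldsin_add_x) (auto simp: r_def)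
    moreover have "lsin (r - x) = lsin (real (Suc N') * x)"
      using lsin_diff_of_int[of "real (Suc N') * x" "int M"] by (simp add: r'[symmetric] algebra_simps)
    ultimately show ?thesis unfolding N r_def[unfolded N, symmetric] using ln_sudler_Suc[OF x(2), of N'] by simp
  next
    case False
    show ?thesis
    proof (cases "M = 0")
      case True
      have "N = 0"
      proof (rule ccontr)
        assume "N \<noteq> 0"
        hence "real N * x > 0" using x by simp
        thus False using False True by (simp add: r_def algebra_simps)
      qed
      thus ?thesis using True by simp
    next
      case False
      then obtain M' where M: "M = Suc M'" by (cases M) auto
      \<comment> \<open>Irrationality excludes the boundary between the two kinds of steps.\<close>
      have "r \<noteq> x"
      proof
        assume "r = x"
        hence e: "real N * x = real M" by (simp add: r_def algebra_simps)
        have "N \<noteq> 0"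
        proof
          assume "N = 0" thus False using e False by simp
        qed
        hence "x = real M / real N" using e by (simp add: field_simps)
        thus False using x by auto
      qed
      hence rx: "r < x" using \<open>\<not> r > x\<close> by simp
      have r0: "r > 0" using less.prems by (simp add: r_def)
      have r': "(real N + 1) * x - real M' = r + 1" by (simp add: r_def M algebra_simps)
      have "ln (sudler x N) - ln (sudler (1/x) M') = ldsin x x - ldsin x (r + 1)"
        using less.hyps[of N M'] rx r0 x unfolding r' by (auto simp: M)
      moreover have "ldsin x (r + 1) = ldsin x r - lsin (r / x)"
        using rx r0 x by (intro ldsin_add_1) auto
      moreover have "lsin (r / x) = lsin (real (Suc M') * (1/x))"
      proof -
        have "r / x = - (real (Suc M') * (1/x)) + of_int (int N + 1)"
          using x by (simp add: r_def M field_simps)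
        thus ?thesis by (simp only: lsin_add_of_int lsin_minus)
      qed
      ultimately show ?thesis unfolding M r_def[unfolded M, symmetric] using ln_sudler_Suc[OF ix, of M'] by simp
    qed
  qed
qed

section \<open>Size of log S from convexity and special values\<close>

lemma convex_on_three_slopes:
  fixes f :: "real \<Rightarrow> real"
  assumes "convex_on I f" "a \<in> I" "c \<in> I" "a < b" "b < c"
  shows "(f b - f a) / (b - a) \<le> (f c - f b) / (c - b)"
proof -
  have *: "(f p - f q) / (p - q) = (f q - f p) / (q - p)" for p q
    by (metis minus_diff_eq minus_divide_divide)
  show ?thesis
    using convex_on_slope_le[OF assms] *[of a b] *[of a c] *[of b c] by linarith
qed

text \<open>The reflection fixes the first point. The other two are each exchanged by it with a
  point from which one shift leads back, so a functional equation with
  \<open>lsin (1/2) = ln 2\<close> determines the value.\<close>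

lemma ldsin_special_values:
  assumes "0 < x"
  shows "ldsin x ((1+x)/2) = 0" "ldsin x (1 + x/2) = - ln 2 / 2" "ldsin x (1/2 + x) = - ln 2 / 2"
proof -
  show "ldsin x ((1+x)/2) = 0" using ldsin_reflect[of x "(1+x)/2"] by (simp add: field_simps)
  have "ldsin x (x/2 + 1) = ldsin x (x/2) - lsin (1/2)"
    using assms ldsin_add_1[of x "x/2"] by simp
  moreover have "ldsin x (x/2 + 1) = - ldsin x (x/2)"
    using ldsin_reflect[of x "x/2"] by (simp add: field_simps)
  ultimately show "ldsin x (1 + x/2) = - ln 2 / 2" using lsin_half by (simp add: add.commute)
  have "ldsin x (1/2 + x) = ldsin x (1/2) - lsin (1/2)"
    using assms ldsin_add_x[of x "1/2"] by simp
  moreover have "ldsin x (1/2 + x) = - ldsin x (1/2)"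
    using ldsin_reflect[of x "1/2"] by (simp add: field_simps)
  ultimately show "ldsin x (1/2 + x) = - ln 2 / 2" using lsin_half by simp
qed

text \<open>Convexity pins the function between its values at \<open>(1+x)/2\<close>,
  \<open>1/2 + x\<close> and \<open>1 + x/2\<close>. From above the outer chord suffices. From
  below, the two equal values serve to the left of \<open>1/2 + x\<close>; to the right, the chord
  from \<open>(1+x)/2\<close> to \<open>1/2 + x\<close> is prolonged. Its slope is
  \<open>- ln 2 / x\<close>, hence the order 1/x.\<close>

lemma ldsin_bound_right:
  assumes x: "0 < x" "x < 1" and v: "(1+x)/2 \<le> v" "v \<le> 1 + x/2"
  shows "\<bar>ldsin x v\<bar> \<le> ln 2 / (2*x)"
proof -
  let ?I = "{(1+x)/2..<1+x}" and ?c = "(1+x)/2" and ?d = "1 + x/2" and ?p = "1/2 + x"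
  note cvx = convex_on_ldsin[OF x(1)] and sv = ldsin_special_values[OF x(1)]
  have l2: "0 < ln (2::real)" "ln 2 / (2*x) > 0" "ln 2 / 2 \<le> ln 2 / (2*x)" using x by (auto simp: field_simps)
  have upper: "ldsin x v \<le> 0"
  proof (cases "v = ?c \<or> v = ?d")
    case True
    thus ?thesis
    proof
      assume "v = ?c" thus ?thesis by (simp only: sv order_refl)
    next
      assume "v = ?d" thus ?thesis using sv(2) l2(1) by simp
    qed
  next
    case False
    have "(ldsin x v - ldsin x ?c) / (v - ?c) \<le> (ldsin x ?d - ldsin x v) / (?d - v)"
      using False v x by (intro convex_on_three_slopes[OF cvx]) auto
    hence *: "ldsin x v / (v - ?c) \<le> (- ln 2 / 2 - ldsin x v) / (?d - v)"
      unfolding sv by simp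
    show ?thesis
    proof (rule ccontr)
      assume n: "\<not> ldsin x v \<le> 0"
      hence "ldsin x v / (v - ?c) > 0" using v False by (intro divide_pos_pos) auto
      moreover have "(- ln 2 / 2 - ldsin x v) / (?d - v) < 0"
        using v False by (intro divide_neg_pos) (use l2(1) n in linarith, auto)
      ultimately show False using * by linarith
    qed
  qed
  have lower: "ldsin x v \<ge> - (ln 2 / (2*x))"
  proof (cases "v < ?p")
    case True
    have "ldsin x v \<ge> - ln 2 / 2"
    proof (rule ccontr)
      assume n: "\<not> ?thesis"
      have "(ldsin x ?p - ldsin x v) / (?p - v) \<le> (ldsin x ?d - ldsin x ?p) / (?d - ?p)"
        using True v x by (intro convex_on_three_slopes[OF cvx]) auto
      hence "(ldsin x ?p - ldsin x v) / (?p - v) \<le> 0" unfolding sv by simp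
      moreover have "(ldsin x ?p - ldsin x v) / (?p - v) > 0"
        using n True unfolding sv by (intro divide_pos_pos) auto
      ultimately show False by linarith
    qed
    thus ?thesis using l2 by simp
  next
    case False
    show ?thesis
    proof (cases "v = ?p")
      case True thus ?thesis using sv l2 by simp
    next
      case neq: False
      have "(ldsin x ?p - ldsin x ?c) / (?p - ?c) \<le> (ldsin x v - ldsin x ?p) / (v - ?p)"
        using False v x neq by (intro convex_on_three_slopes[OF cvx]) auto
      hence *: "(- ln 2 / 2) / (x/2) \<le> (ldsin x v + ln 2 / 2) / (v - ?p)"
        unfolding sv by (simp add: field_simps)
      have "(- ln 2 / 2) / (x/2) * (v - ?p) \<le> ldsin x v + ln 2 / 2"
        using * False neq by (subst (asm) pos_le_divide_eq) auto
      moreover have "(- ln 2 / 2) / (x/2) * (v - ?p) \<ge> (- ln 2 / 2) / (x/2) * (1/2 - x/2)"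
        using v x l2 by (intro mult_left_mono_neg) (auto simp: divide_nonpos_pos)
      moreover have "(- ln 2 / 2) / (x/2) * (1/2 - x/2) = - (ln 2 / (2*x)) + ln 2 / 2"
        using x by (simp add: field_simps)
      ultimately show ?thesis by linarith
    qed
  qed
  show ?thesis using upper lower l2 by linarith
qed

lemma ldsin_bound:
  assumes x: "0 < x" "x < 1" and v: "x/2 \<le> v" "v \<le> 1 + x/2"
  shows "\<bar>ldsin x v\<bar> \<le> ln 2 / (2*x)"
proof (cases "(1+x)/2 \<le> v")
  case True thus ?thesis using assms by (intro ldsin_bound_right)
next
  case False
  have "\<bar>ldsin x (1 + x - v)\<bar> \<le> ln 2 / (2*x)"
    using False assms by (intro ldsin_bound_right) auto
  thus ?thesis by (simp add: ldsin_reflect)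
qed

text \<open>One shift by \<open>x\<close> leaves the vicinity of the zero of S, so the whole
  singularity at 0 is that of \<open>lsin\<close>.\<close>

lemma ldsin_bound_left:
  assumes x: "0 < x" "x < 1" and v: "0 < v" "v < x/2"
  shows "\<bar>ldsin x v - lsin v\<bar> \<le> ln 2 / (2*x)"
proof -
  have "ldsin x (v + x) = ldsin x v - lsin v" using assms by (intro ldsin_add_x) auto
  moreover have "\<bar>ldsin x (v + x)\<bar> \<le> ln 2 / (2*x)" using assms by (intro ldsin_bound) auto
  ultimately show ?thesis by simp
qed

text \<open>Over a step of length \<open>x\<close> the increment of \<open>ldsin\<close> is known
  exactly; by convexity the slope on \<open>[u, v]\<close> lies between that of the step ending at
  \<open>u\<close> and that of the step starting at \<open>v\<close>.\<close>

lemma ldsin_slope_bounds: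
  assumes x: "0 < x" and uv: "(1+x)/2 \<le> u - x" "u < v" "v < 1"
  shows "(ldsin x v - ldsin x u) / (v - u) \<le> - lsin v / x"
    and "(ldsin x v - ldsin x u) / (v - u) \<ge> - lsin (u - x) / x"
proof -
  note cvx = convex_on_ldsin[OF x(1)]
  have "(ldsin x v - ldsin x u) / (v - u) \<le> (ldsin x (v + x) - ldsin x v) / (v + x - v)"
    using assms by (intro convex_on_three_slopes[OF cvx]) auto
  also have "ldsin x (v + x) = ldsin x v - lsin v" using assms by (intro ldsin_add_x) auto
  finally show "(ldsin x v - ldsin x u) / (v - u) \<le> - lsin v / x" by simp
  have "(ldsin x u - ldsin x (u - x)) / (u - (u - x)) \<le> (ldsin x v - ldsin x u) / (v - u)"
    using assms by (intro convex_on_three_slopes[OF cvx]) auto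
  also have "ldsin x u = ldsin x (u - x) - lsin (u - x)" using assms ldsin_add_x[of x "u - x"] by auto
  finally show "(ldsin x v - ldsin x u) / (v - u) \<ge> - lsin (u - x) / x"
    using \<open>ldsin x u = _\<close> by simp
qed

section \<open>The function log |2 sin (pi t)| and its integral\<close>

lemma has_real_derivative_lsin:
  assumes "0 < t" "t < 1"
  shows "(lsin has_real_derivative pi * cos (pi * t) / sin (pi * t)) (at t)"
proof -
  have s: "sin (pi * u) > 0" if "u \<in> {0<..<1}" for u using that by (intro sin_gt_zero) auto
  have "((\<lambda>t. ln (2 * sin (pi * t))) has_real_derivative pi * cos (pi * t) / sin (pi * t)) (at t)"
    using s[of t] assms by (auto intro!: derivative_eq_intros simp: field_simps)
  thus ?thesis
    by (rule has_field_derivative_transform_within_open[of _ _ _ "{0<..<1}"]) (use assms in \<open>auto simp: lsin_eq\<close>)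
qed

lemma has_real_derivative_neg_cot:
  assumes "0 < t" "t < 1"
  shows "((\<lambda>t. - (pi * cos (pi * t) / sin (pi * t))) has_real_derivative pi^2 / (sin (pi * t))^2) (at t)"
proof -
  have s: "sin (pi * t) > 0" using assms by (intro sin_gt_zero) auto
  have "((\<lambda>t. - (pi * cos (pi * t) / sin (pi * t))) has_real_derivative
     pi^2 * ((sin (pi * t))^2 + (cos (pi * t))^2) / (sin (pi * t))^2) (at t)"
  proof -
    have cc: "cos (pi*t) * (cos (pi*t) * y) = y - sin (pi*t) * (sin (pi*t) * y)" for y
    proof -
      have "cos (pi*t) * cos (pi*t) = 1 - sin (pi*t) * sin (pi*t)"
        using sin_cos_squared_add[of "pi*t"] by (simp add: power2_eq_square)
      thus ?thesis by (simp add: mult.assoc[symmetric] left_diff_distrib)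
    qed
    show ?thesis
      using s by (auto intro!: derivative_eq_intros simp: power2_eq_square field_simps cc)
  qed
  thus ?thesis by simp
qed

lemma convex_on_neg_lsin: "convex_on {0<..<1} (\<lambda>t. - lsin t)"
proof (rule f''_ge0_imp_convex)
  fix t :: real assume t: "t \<in> {0<..<1}"
  show "((\<lambda>t. - lsin t) has_real_derivative - (pi * cos (pi * t) / sin (pi * t))) (at t)"
    using t by (intro DERIV_minus has_real_derivative_lsin) auto
  show "((\<lambda>t. - (pi * cos (pi * t) / sin (pi * t))) has_real_derivative pi^2 / (sin (pi * t))^2) (at t)"
    using t by (intro has_real_derivative_neg_cot) auto
qed auto

lemma sin_pi_ge_twice:
  assumes "0 \<le> t" "t \<le> 1/2"
  shows "sin (pi * t) \<ge> 2 * t"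
proof -
  have "convex_on {0..1/2} (\<lambda>t. - sin (pi * t))"
  proof (rule f''_ge0_imp_convex[where f' = "\<lambda>t. - (pi * cos (pi * t))" and f'' = "\<lambda>t. pi^2 * sin (pi * t)"])
    fix t :: real assume t: "t \<in> {0..1/2}"
    show "((\<lambda>t. - sin (pi * t)) has_real_derivative - (pi * cos (pi * t))) (at t)"
      by (auto intro!: derivative_eq_intros)
    show "((\<lambda>t. - (pi * cos (pi * t))) has_real_derivative pi^2 * sin (pi * t)) (at t)"
      by (auto intro!: derivative_eq_intros simp: power2_eq_square)
    have "sin (pi * t) \<ge> 0" using t by (intro sin_ge_zero) (auto simp: mult_le_cancel_left1)
    thus "0 \<le> pi^2 * sin (pi * t)" by simp
  qed simp
  from convex_onD_Icc'[OF this, of t] assms show ?thesis by simp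
qed

lemma sin_pi_ge_twice': "1/2 \<le> t \<Longrightarrow> t \<le> 1 \<Longrightarrow> sin (pi * t) \<ge> 2 * (1 - t)"
  using sin_pi_ge_twice[of "1 - t"] by (simp add: right_diff_distrib sin_diff)

text \<open>The factor 400 is 4 / 0.01: between 1/2 and 0.995 the sine is at least 0.01, and
  \<open>pi < 4\<close>. The weight 1/u reflects the singularity of the derivative at 0.\<close>

lemma lsin_lipschitz:
  assumes "0 < u" "u \<le> v" "v \<le> 0.995"
  shows "\<bar>lsin v - lsin u\<bar> \<le> 400 * (v - u) / u"
proof (cases "u = v")
  case False
  hence "u < v" using assms by simp
  then obtain z where z: "u < z" "z < v" "lsin v - lsin u = (v - u) * (pi * cos (pi * z) / sin (pi * z))"
    using MVT2[of u v lsin "\<lambda>z. pi * cos (pi * z) / sin (pi * z)"] has_real_derivative_lsin assms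
    by (auto)
  have s: "pi * z \<le> 400 * sin (pi * z)"
  proof (cases "z \<le> 1/2")
    case True
    have "pi * z \<le> 4 * z" using pi_less_4 z assms by (intro mult_right_mono) auto
    also have "\<dots> \<le> 400 * sin (pi * z)" using sin_pi_ge_twice[of z] True z assms by simp
    finally show ?thesis .
  next
    case False
    have "pi * z \<le> 4 * 1" using pi_less_4 z assms by (intro mult_mono) auto
    also have "\<dots> \<le> 400 * sin (pi * z)" using sin_pi_ge_twice'[of z] False z assms by simp
    finally show ?thesis .
  qed
  have "pi * z > 0" using z assms by simp
  hence s0: "sin (pi * z) > 0" using s by linarith
  have "\<bar>pi * cos (pi * z) / sin (pi * z)\<bar> \<le> pi * 1 / sin (pi * z)"
    unfolding abs_divide using s0 by (intro frac_le) (auto simp: abs_mult)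
  also have "\<dots> \<le> 400 / z" using s s0 z assms by (simp add: field_simps)
  also have "\<dots> \<le> 400 / u" using z assms by (intro divide_left_mono) auto
  finally have "\<bar>pi * cos (pi * z) / sin (pi * z)\<bar> * (v - u) \<le> 400 / u * (v - u)"
    using assms by (intro mult_right_mono) auto
  thus ?thesis unfolding z(3) abs_mult using assms by (simp add: mult.commute)
qed simp

lemma lsin_1_6 [simp]: "lsin (1/6) = 0"
  by (simp add: lsin_def sin_30)

lemma lsin_5_6 [simp]: "lsin (5/6) = 0"
  using lsin_one_minus[of "1/6"] by simp

lemma lsin_below_tangent:
  assumes "0 < t" "t < 1"
  shows "lsin t \<le> - (pi * sqrt 3) * (t - 5/6)"
proof -
  have c: "cos (pi * (5/6)) = - (sqrt 3 / 2)" "sin (pi * (5/6)) = 1/2"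
  proof -
    have *: "pi * (5/6) = pi - pi/6" by simp
    show "cos (pi * (5/6)) = - (sqrt 3 / 2)" "sin (pi * (5/6)) = 1/2"
      unfolding * by (simp_all only: cos_diff sin_diff cos_30 sin_30 cos_pi sin_pi)
  qed
  have "- lsin t - - lsin (5/6) \<ge> (- (pi * cos (pi * (5/6)) / sin (pi * (5/6)))) * (t - 5/6)"
  proof (rule convex_on_imp_above_tangent[OF convex_on_neg_lsin])
    show "((\<lambda>t. - lsin t) has_real_derivative - (pi * cos (pi * (5/6)) / sin (pi * (5/6)))) (at (5/6) within {0<..<1})"
      by (rule has_field_derivative_at_within, intro DERIV_minus has_real_derivative_lsin) auto
  qed (use assms in \<open>auto simp: interior_open\<close>)
  thus ?thesis unfolding c by (simp add: algebra_simps)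
qed

lemma lsin_nonpos_left: "0 < t \<Longrightarrow> t \<le> 1/6 \<Longrightarrow> lsin t \<le> 0"
proof -
  assume t: "0 < t" "t \<le> 1/6"
  have "pi * t \<le> pi * (1/6)" using t by (intro mult_left_mono) auto
  moreover have "pi * t > 0" using t by simp
  ultimately have "sin (pi * t) \<le> sin (pi/6)" by (intro sin_monotone_2pi_le) (use pi_gt_zero in linarith)+
  thus ?thesis using t sin_gt_zero[of "pi*t"] by (subst lsin_eq) (auto simp: sin_30)
qed

lemma lsin_ge_chord:
  assumes "1/2 \<le> t" "t \<le> 5/6"
  shows "lsin t \<ge> 3 * ln 2 * (5/6 - t)"
proof -
  have "convex_on {1/2..5/6} (\<lambda>t. - lsin t)"
    by (rule convex_on_subset[OF convex_on_neg_lsin]) auto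
  from convex_onD_Icc''[OF this, of t] assms show ?thesis
    by (simp add: lsin_half)
qed

lemma lsin_nonneg_mid:
  assumes "1/6 \<le> t" "t \<le> 5/6"
  shows "lsin t \<ge> 0"
proof (cases "t \<ge> 1/2")
  case True
  have "3 * ln 2 * (5/6 - t) \<ge> 0" using assms by simp
  thus ?thesis using lsin_ge_chord[of t] assms True by linarith
next
  case False
  have "3 * ln 2 * (5/6 - (1 - t)) \<ge> 0" using assms by simp
  thus ?thesis using lsin_ge_chord[of "1 - t"] assms False lsin_one_minus[of t] by linarith
qed

lemma abs_lsin_le:
  assumes "0 < t" "t \<le> 1/2"
  shows "\<bar>lsin t\<bar> \<le> 1 - ln t"
proof -
  have s: "sin (pi * t) \<ge> 2 * t" using sin_pi_ge_twice assms by auto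
  have "lsin t \<ge> ln (4 * t)" using s assms by (subst lsin_eq) auto
  moreover have "ln (4 * t) \<ge> ln t" using assms by simp
  moreover have "lsin t \<le> ln 2" using s assms by (subst lsin_eq) auto
  moreover have "ln 2 \<le> (1::real)" using ln_le_minus_one[of "2::real"] by simp
  moreover have "ln t \<le> 0" using assms by simp
  ultimately show ?thesis by linarith
qed

section \<open>Integrability of log |2 sin (pi t)| and its integral over [0, 1/2]\<close>

lemma borel_measurable_lsin [measurable]: "lsin \<in> borel_measurable borel"
  unfolding lsin_def[abs_def] by measurable

lemma set_integrable_lsin_half: "set_integrable lborel {0..1/2} lsin"
proof -
  have "((\<lambda>t. t powr (-1/2)) has_integral ((1/2) powr (-1/2+1) / (-1/2+1))) {0..1/2::real}"
    by (rule has_integral_powr_from_0) auto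
  hence "(\<lambda>t::real. t powr (-1/2)) integrable_on {0..1/2}" by blast
  hence "(\<lambda>t::real. t powr (-1/2)) absolutely_integrable_on {0..1/2}"
    by (rule nonnegative_absolutely_integrable_1) auto
  hence "set_integrable lborel {0..1/2} (\<lambda>t::real. t powr (-1/2))"
    by (simp add: set_integrable_def integrable_completion)
  hence "set_integrable lborel {0..1/2} (\<lambda>t::real. 3 * t powr (-1/2))"
    by (rule set_integrable_mult_right)
  thus ?thesis
  proof (rule set_integrable_bound)
    show "set_borel_measurable lborel {0..1/2} lsin"
      unfolding set_borel_measurable_def by measurable
    show "AE t in lborel. t \<in> {0..1/2} \<longrightarrow> norm (lsin t) \<le> norm (3 * t powr (-1/2))"
    proof (intro AE_I2 impI)
      fix t :: real assume t: "t \<in> {0..1/2}"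
      \<comment> \<open>\<open>ln y \<le> y - 1\<close> at \<open>y = t powr (-1/2)\<close> produces
        the integrable majorant.\<close>
      have "- ln t \<le> 2 * t powr (-1/2) - 2" if "t > 0"
        using ln_le_minus_one[of "t powr (-1/2)"] that by (simp add: ln_powr)
      thus "norm (lsin t) \<le> norm (3 * t powr (-1/2))"
        using abs_lsin_le[of t] t by (cases "t = 0") (simp_all add: abs_mult lsin_def)
    qed
  qed
qed

lemma lsin_absolutely_integrable_half: "lsin absolutely_integrable_on {0..1/2}"
proof -
  show ?thesis
    using set_integrable_lsin_half by (simp add: set_integrable_def integrable_completion)
qed

lemma lsin_continuous_on: "S \<subseteq> {0<..<1} \<Longrightarrow> continuous_on S lsin"
  by (intro continuous_at_imp_continuous_on ballI DERIV_isCont[OF has_real_derivative_lsin]) auto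

lemma lsin_absolutely_integrable:
  assumes "0 \<le> u" "v < 1"
  shows "lsin absolutely_integrable_on {u..v}"
proof -
  have "lsin absolutely_integrable_on {1/2..max v (1/2)}"
    using assms by (intro absolutely_integrable_continuous_real lsin_continuous_on) auto
  hence "lsin absolutely_integrable_on ({0..1/2} \<union> {1/2..max v (1/2)})"
    by (intro absolutely_integrable_Un lsin_absolutely_integrable_half)
  thus ?thesis
    by (rule set_integrable_subset) (use assms in auto)
qed

lemma lsin_integrable_on: "0 \<le> u \<Longrightarrow> v < 1 \<Longrightarrow> lsin integrable_on {u..v}"
  using lsin_absolutely_integrable by (auto simp: absolutely_integrable_on_def)

text \<open>The duplication \<open>lsin (2*t) = lsin t + lsin (1/2 - t)\<close> on
  \<open>(0, 1/4)\<close> integrates to \<open>I/2 = I\<close>, since the two summands on the right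
  together cover \<open>[0, 1/2]\<close>.\<close>

lemma integral_lsin_half: "integral {0..1/2} lsin = 0"
proof -
  let ?I = "integral {0..1/2} lsin"
  have int: "(lsin has_integral integral {0..v} lsin) {0..v}" if "v < 1" for v
    using lsin_integrable_on[of 0 v] that by (simp add: has_integral_iff)
  have 1: "((\<lambda>t. lsin (2 * t)) has_integral ?I / 2) {0..1/4}"
    using has_integral_stretch_real[OF int[of "1/2"], of 2] by (simp add: image_divide_atLeastAtMost)
  have "(lsin has_integral integral {1/4..1/2} lsin) {1/4..1/2}"
    using lsin_integrable_on[of "1/4" "1/2"] by (simp add: has_integral_iff)
  from has_integral_affinity[of lsin _ "1/4" "1/2" "-1" "1/2"] this
  have 2: "((\<lambda>t. lsin (1/2 - t)) has_integral integral {1/4..1/2} lsin) {0..1/4}"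
    by (simp add: algebra_simps)
  have "((\<lambda>t. lsin t + lsin (1/2 - t)) has_integral (integral {0..1/4} lsin + integral {1/4..1/2} lsin)) {0..1/4}"
    by (intro has_integral_add int 2) auto
  also have "integral {0..1/4} lsin + integral {1/4..1/2} lsin = ?I"
    by (intro Henstock_Kurzweil_Integration.integral_combine lsin_integrable_on) auto
  finally have 3: "((\<lambda>t. lsin t + lsin (1/2 - t)) has_integral ?I) (cbox 0 (1/4))" by simp
  have "((\<lambda>t. lsin (2 * t)) has_integral ?I) (cbox 0 (1/4))"
  \<comment> \<open>The identity is checked in the interior only: at 0 the convention
    \<open>ln 0 = 0\<close> breaks it.\<close>
  proof (rule has_integral_spike_interior[OF 3])
    fix t :: real assume t: "t \<in> box 0 (1/4)"
    have "pi * (1/2 - t) = pi/2 - pi * t" by (simp add: algebra_simps)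
    hence e: "sin (pi * (1/2 - t)) = cos (pi * t)" by (simp add: sin_diff)
    have "sin (pi * t) > 0" "cos (pi * t) > 0"
      using t by (auto intro!: sin_gt_zero cos_gt_zero simp: field_simps)
    moreover have "pi * (2 * t) = 2 * (pi * t)" by simp
    hence "sin (pi * (2 * t)) = 2 * sin (pi * t) * cos (pi * t)" by (simp only: sin_double)
    ultimately show "lsin (2 * t) = lsin t + lsin (1/2 - t)"
    proof -
      assume s: "sin (pi * t) > 0" "cos (pi * t) > 0" "sin (pi * (2 * t)) = 2 * sin (pi * t) * cos (pi * t)"
      have "lsin (2 * t) = ln ((2 * sin (pi * t)) * (2 * cos (pi * t)))"
        unfolding lsin_def s(3) using s(1,2) by (intro arg_cong[of _ _ ln]) (simp add: abs_mult)
      also have "\<dots> = ln (2 * sin (pi * t)) + ln (2 * cos (pi * t))"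
        using s(1,2) by (intro ln_mult_pos) auto
      also have "\<dots> = lsin t + lsin (1/2 - t)" unfolding lsin_def e using s(1,2) by simp
      finally show ?thesis .
    qed
  qed
  from has_integral_unique[OF this[unfolded cbox_interval] 1] show ?thesis by simp
qed

section \<open>Taylor bounds and the numerical value of the integral\<close>

lemma nonneg_by_deriv:
  fixes f f' :: "real \<Rightarrow> real"
  assumes "\<And>u. 0 \<le> u \<Longrightarrow> (f has_real_derivative f' u) (at u)" "\<And>u. 0 \<le> u \<Longrightarrow> f' u \<ge> 0" "f 0 \<ge> 0" "u \<ge> 0"
  shows "f u \<ge> 0"
proof -
  have "f 0 \<le> f u"
    using assms(4) by (rule DERIV_nonneg_imp_nondecreasing) (use assms(1,2) in blast)
  thus ?thesis using assms(3) by simp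
qed

lemma cos_lower_2: "u \<ge> 0 \<Longrightarrow> cos u \<ge> 1 - u^2/2" for u :: real
proof -
  assume u: "u \<ge> 0"
  have "cos u - (1 - u^2/2) \<ge> 0"
    by (rule nonneg_by_deriv[where f' = "\<lambda>u. u - sin u"])
       (auto intro!: derivative_eq_intros sin_x_le_x u)
  thus ?thesis by simp
qed

lemma sin_lower_3: "u \<ge> 0 \<Longrightarrow> sin u \<ge> u - u^3/6" for u :: real
proof -
  assume u: "u \<ge> 0"
  have "sin u - (u - u^3/6) \<ge> 0"
    by (rule nonneg_by_deriv[where f' = "\<lambda>u. cos u - (1 - u^2/2)"])
       (auto intro!: derivative_eq_intros u simp: cos_lower_2)
  thus ?thesis by simp
qed

lemma cos_upper_4: "u \<ge> 0 \<Longrightarrow> cos u \<le> 1 - u^2/2 + u^4/24" for u :: real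
proof -
  assume u: "u \<ge> 0"
  have "(1 - u^2/2 + u^4/24) - cos u \<ge> 0"
    by (rule nonneg_by_deriv[where f' = "\<lambda>u. sin u - (u - u^3/6)"])
       (auto intro!: derivative_eq_intros u simp: sin_lower_3)
  thus ?thesis by simp
qed

lemma sin_upper_5: "u \<ge> 0 \<Longrightarrow> sin u \<le> u - u^3/6 + u^5/120" for u :: real
proof -
  assume u: "u \<ge> 0"
  have "(u - u^3/6 + u^5/120) - sin u \<ge> 0"
    by (rule nonneg_by_deriv[where f' = "\<lambda>u. (1 - u^2/2 + u^4/24) - cos u"])
       (auto intro!: derivative_eq_intros u simp: cos_upper_4)
  thus ?thesis by simp
qed

lemma exp_minus_lower_1: "exp (-u) \<ge> 1 - u" for u :: real
  using exp_ge_add_one_self[of "-u"] by simp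

lemma exp_minus_upper_2: "u \<ge> 0 \<Longrightarrow> exp (-u) \<le> 1 - u + u^2/2" for u :: real
proof -
  assume u: "u \<ge> 0"
  have "(1 - u + u^2/2) - exp (-u) \<ge> 0"
    by (rule nonneg_by_deriv[where f' = "\<lambda>u. exp (-u) - (1 - u)"])
       (auto intro!: derivative_eq_intros u simp: exp_minus_lower_1)
  thus ?thesis by simp
qed

lemma exp_minus_lower_3: "u \<ge> 0 \<Longrightarrow> exp (-u) \<ge> 1 - u + u^2/2 - u^3/6" for u :: real
proof -
  assume u: "u \<ge> 0"
  have "exp (-u) - (1 - u + u^2/2 - u^3/6) \<ge> 0"
    by (rule nonneg_by_deriv[where f' = "\<lambda>u. (1 - u + u^2/2) - exp (-u)"])
       (auto intro!: derivative_eq_intros u simp: exp_minus_upper_2)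
  thus ?thesis by simp
qed

lemma exp_lower_3: "u \<ge> 0 \<Longrightarrow> exp u \<ge> 1 + u + u^2/2 + u^3/6" for u :: real
proof -
  assume u: "u \<ge> 0"
  have "exp u - (1 + u + u^2/2 + u^3/6) \<ge> 0"
    by (rule nonneg_by_deriv[where f' = "\<lambda>u. exp u - (1 + u + u^2/2)"])
       (auto intro!: derivative_eq_intros exp_lower_Taylor_quadratic u)
  thus ?thesis by simp
qed

text \<open>The exponent consists of the first two terms of the series of log (u / sin u). Both
  sides are compared through polynomials in \<open>w = u^2\<close>, whose difference starts with
  \<open>w^3/6480\<close>; for \<open>w \<le> 1\<close> this outweighs the later terms.\<close>

lemma sin_le_exp:
  fixes u :: real
  assumes "0 \<le> u" "u \<le> 1"
  shows "sin u \<le> u * exp (- (u^2/6 + u^4/180))"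
proof -
  define w where "w = u^2"
  have w: "0 \<le> w" "w \<le> 1" using assms by (auto simp: w_def power_le_one)
  let ?y = "w/6 + w^2/180"
  have "w^3/6480 - w^4/16200 - w^5/388800 - w^6/34992000 \<ge> 0"
  proof -
    have "w^4 \<le> w^3" "w^5 \<le> w^3" "w^6 \<le> w^3" using w by (intro power_decreasing; simp)+
    thus ?thesis using zero_le_power[OF w(1), of 3] by linarith
  qed
  moreover have "1 - ?y + ?y^2/2 - ?y^3/6 - (1 - w/6 + w^2/120) =
     w^3/6480 - w^4/16200 - w^5/388800 - w^6/34992000"
    by (simp add: field_simps power2_eq_square power3_eq_cube numeral_eq_Suc)
  ultimately have "1 - w/6 + w^2/120 \<le> 1 - ?y + ?y^2/2 - ?y^3/6" by linarith
  also have "\<dots> \<le> exp (- ?y)" using w by (intro exp_minus_lower_3) auto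
  finally have *: "1 - w/6 + w^2/120 \<le> exp (- ?y)" .
  have "sin u \<le> u - u^3/6 + u^5/120" using assms by (intro sin_upper_5)
  also have "\<dots> = u * (1 - w/6 + w^2/120)"
    by (simp add: w_def algebra_simps power_def numeral_eq_Suc)
  also have "\<dots> \<le> u * exp (- ?y)" using * assms by (intro mult_left_mono) auto
  finally show ?thesis by (simp add: w_def power_mult[symmetric])
qed

lemma arctan_lower_7: "u \<ge> 0 \<Longrightarrow> arctan u \<ge> u - u^3/3 + u^5/5 - u^7/7" for u :: real
proof -
  assume u: "u \<ge> 0"
  have "arctan u - (u - u^3/3 + u^5/5 - u^7/7) \<ge> 0"
  proof (rule nonneg_by_deriv[where f = "\<lambda>u. arctan u - (u - u^3/3 + u^5/5 - u^7/7)" and u = u and f' = "\<lambda>u. inverse (1 + u^2) - (1 - u^2 + u^4 - u^6)"])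
    fix u :: real
    have "inverse (1 + u^2) - (1 - u^2 + u^4 - u^6) = u^8 / (1 + u^2)"
      by (simp add: add_nonneg_eq_0_iff divide_simps) (simp add: algebra_simps numeral_eq_Suc)
    thus "0 \<le> inverse (1 + u^2) - (1 - u^2 + u^4 - u^6)" by simp
  qed (auto intro!: derivative_eq_intros u)
  thus ?thesis by simp
qed

lemma arctan_upper_9: "u \<ge> 0 \<Longrightarrow> arctan u \<le> u - u^3/3 + u^5/5 - u^7/7 + u^9/9" for u :: real
proof -
  assume u: "u \<ge> 0"
  have "(u - u^3/3 + u^5/5 - u^7/7 + u^9/9) - arctan u \<ge> 0"
  proof (rule nonneg_by_deriv[where f = "\<lambda>u. (u - u^3/3 + u^5/5 - u^7/7 + u^9/9) - arctan u" and u = u and f' = "\<lambda>u. (1 - u^2 + u^4 - u^6 + u^8) - inverse (1 + u^2)"])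
    fix u :: real
    have "(1 - u^2 + u^4 - u^6 + u^8) - inverse (1 + u^2) = u^10 / (1 + u^2)"
      by (simp add: add_nonneg_eq_0_iff divide_simps) (simp add: algebra_simps numeral_eq_Suc)
    thus "0 \<le> (1 - u^2 + u^4 - u^6 + u^8) - inverse (1 + u^2)" by simp
  qed (auto intro!: derivative_eq_intros u)
  thus ?thesis by simp
qed

text \<open>Machin's formula with partial sums of the alternating arctangent series.\<close>

lemma pi_bounds: "3.1415 < pi" "pi < 3.1416"
proof -
  have a: "arctan (1/5) \<ge> 1973955/10000000" "arctan (1/5) \<le> 1973956/10000000"
    "arctan (1/239) \<ge> 41840/10000000" "arctan (1/239) \<le> 41841/10000000"
    using arctan_lower_7[of "1/5"] arctan_upper_9[of "1/5"] arctan_lower_7[of "1/239"] arctan_upper_9[of "1/239"]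
    by (simp_all add: power_divide)
  have "pi = 16 * arctan (1/5) - 4 * arctan (1/239)" using machin by simp
  thus "3.1415 < pi" "pi < 3.1416" using a by simp_all
qed

lemma lsin_upper_near_0:
  assumes "0 < t" "t \<le> 1/6"
  shows "lsin t \<le> ln (2 * pi * t) - pi^2 * t^2 / 6 - pi^4 * t^4 / 180"
proof -
  let ?u = "pi * t"
  have u: "0 < ?u" using assms by simp
  have "pi * t \<le> 4 * (1/6)" using pi_less_4 assms by (intro mult_mono) auto
  hence u1: "?u \<le> 1" by simp
  have s: "sin ?u > 0" using u u1 pi_gt3 by (intro sin_gt_zero) linarith+
  have "2 * sin ?u \<le> 2 * (?u * exp (- (?u^2/6 + ?u^4/180)))" using sin_le_exp[of ?u] u u1 by simp
  hence "ln (2 * sin ?u) \<le> ln (2 * ?u * exp (- (?u^2/6 + ?u^4/180)))" using s u by simp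
  also have "\<dots> = ln (2 * ?u) - (?u^2/6 + ?u^4/180)" using u by (subst ln_mult_pos) auto
  finally show ?thesis using assms by (simp add: lsin_eq power_mult_distrib mult.assoc)
qed

text \<open>The precision is dictated by \<open>0.16153 * 36/25 = 0.2326032\<close>. The majorant,
  \<open>ln (2*pi*t)\<close> minus a polynomial, retains the logarithmic singularity exactly and has
  the elementary antiderivative \<open>G\<close>.\<close>

lemma integral_lsin_1_6: "integral {0..1/6} lsin \<le> - 0.16153"
proof -
  define G where "G t = t * ln (2 * pi * t) - t - pi^2 * t^3 / 18 - pi^4 * t^5 / 900" for t
  have cont: "continuous_on {0..1/6} G"
  proof -
    have "continuous (at t within {0..1/6}) (\<lambda>t. t * ln (2 * pi * t))" if t: "t \<in> {0..1/6}" for t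
    proof (cases "t = 0")
      case True
      have "((\<lambda>t. t * ln (2 * pi * t)) \<longlongrightarrow> 0) (at_right 0)" using pi_gt_zero by real_asymp
      hence "((\<lambda>t. t * ln (2 * pi * t)) \<longlongrightarrow> 0) (at 0 within {0..1/6})"
        by (rule filterlim_mono[OF _ order_refl]) (auto intro: at_le simp: at_within_Icc_at_right)
      thus ?thesis using True by (simp add: continuous_within)
    next
      case False
      thus ?thesis using t by (intro continuous_intros) auto
    qed
    hence "continuous_on {0..1/6} (\<lambda>t. t * ln (2 * pi * t))"
      by (simp add: continuous_on_eq_continuous_within)
    moreover have "continuous_on {0..1/6} (\<lambda>t. t + pi^2 * t^3 / 18 + pi^4 * t^5 / 900)"
      by (intro continuous_intros) auto
    ultimately have "continuous_on {0..1/6} (\<lambda>t. t * ln (2 * pi * t) - (t + pi^2 * t^3 / 18 + pi^4 * t^5 / 900))"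
      by (rule continuous_on_diff)
    thus ?thesis unfolding G_def by (simp add: diff_diff_eq)
  qed
  have hi: "((\<lambda>t. ln (2 * pi * t) - pi^2 * t^2 / 6 - pi^4 * t^4 / 180) has_integral (G (1/6) - G 0)) {0..1/6}"
  proof (rule fundamental_theorem_of_calculus_interior)
    fix t :: real assume t: "t \<in> {0<..<1/6}"
    have "(G has_real_derivative (ln (2 * pi * t) - pi^2 * t^2 / 6 - pi^4 * t^4 / 180)) (at t)"
      unfolding G_def using t by (auto intro!: derivative_eq_intros simp: field_simps)
    thus "(G has_vector_derivative (ln (2 * pi * t) - pi^2 * t^2 / 6 - pi^4 * t^4 / 180)) (at t)"
      by (simp add: has_real_derivative_iff_has_vector_derivative)
  qed (use cont in auto)
  have "integral {0..1/6} lsin \<le> G (1/6) - G 0"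
  proof (rule has_integral_le[OF _ hi])
    show "(lsin has_integral integral {0..1/6} lsin) {0..1/6}"
      using lsin_integrable_on[of 0 "1/6"] by (simp add: has_integral_iff)
    show "lsin t \<le> ln (2 * pi * t) - pi^2 * t^2 / 6 - pi^4 * t^4 / 180" if "t \<in> {0..1/6}" for t
      using lsin_upper_near_0[of t] that by (cases "t = 0") (auto simp: lsin_def)
  qed
  moreover have "G 0 = 0" by (simp add: G_def)
  moreover have "G (1/6) \<le> - 0.16153"
  proof -
    have "ln (pi / 3) \<le> 0.046121"
    proof -
      have "pi / 3 \<le> 1.0472" using pi_bounds by simp
      also have "(1.0472::real) \<le> 1 + 0.046121 + 0.046121^2/2 + 0.046121^3/6"
        by (simp add: power2_eq_square power3_eq_cube)
      also have "\<dots> \<le> exp 0.046121" by (rule exp_lower_3) simp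
      finally have "ln (pi / 3) \<le> ln (exp 0.046121)" by (subst ln_le_cancel_iff) auto
      thus ?thesis by simp
    qed
    moreover have "pi^2 \<ge> 3.1415^2" using pi_bounds by (intro power_mono) auto
    moreover have "pi^4 \<ge> 3.1415^4" using pi_bounds by (intro power_mono) auto
    moreover have "G (1/6) = (ln (pi / 3) - 1) / 6 - pi^2 / 3888 - pi^4 / 6998400"
      by (simp add: G_def power_divide field_simps)
    ultimately show ?thesis by (simp add: field_simps)
  qed
  ultimately show ?thesis by simp
qed

lemma pi_sqrt_3_bounds: "5 \<le> pi * sqrt 3" "pi * sqrt 3 \<le> 6"
proof -
  have "sqrt (1.7^2) \<le> sqrt 3" by (subst real_sqrt_le_iff) (simp add: power2_eq_square)
  hence "1.7 \<le> sqrt 3" by simp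
  moreover have "3 \<le> pi" using pi_bounds by simp
  ultimately have "3 * 1.7 \<le> pi * sqrt 3" by (intro mult_mono) auto
  thus "5 \<le> pi * sqrt 3" by simp
  have "sqrt 3 \<le> sqrt (1.8^2)" by (subst real_sqrt_le_iff) (simp add: power2_eq_square)
  hence "sqrt 3 \<le> 1.8" by simp
  moreover have "pi \<le> 3.1416" using pi_bounds by simp
  ultimately have "pi * sqrt 3 \<le> 3.1416 * 1.8" by (intro mult_mono) auto
  thus "pi * sqrt 3 \<le> 6" by simp
qed

lemma lsin_le_tangent_strong:
  assumes "0 < t" "t \<le> 5/6"
  shows "lsin t \<le> 6 * (5/6 - t)"
proof -
  have "pi * sqrt 3 * (5/6 - t) \<le> 6 * (5/6 - t)" using pi_sqrt_3_bounds assms by (intro mult_right_mono) auto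
  thus ?thesis using lsin_below_tangent[of t] assms by (simp add: algebra_simps)
qed

section \<open>The antiderivative of log |2 sin (pi t)|\<close>

definition lsin_prim :: "real \<Rightarrow> real" where
  "lsin_prim t = integral {0..t} lsin"

lemma lsin_prim_diff:
  assumes "0 \<le> u" "u \<le> v" "v < 1"
  shows "lsin_prim v - lsin_prim u = integral {u..v} lsin"
proof -
  have "integral {0..u} lsin + integral {u..v} lsin = integral {0..v} lsin"
    using assms by (intro Henstock_Kurzweil_Integration.integral_combine lsin_integrable_on) auto
  thus ?thesis by (simp add: lsin_prim_def)
qed

lemma LBINT_lsin:
  assumes "0 \<le> u" "u < 1" "0 \<le> v" "v < 1"
  shows "(LBINT x = ereal u..ereal v. ln \<bar>2 * sin (pi * x)\<bar>) = lsin_prim v - lsin_prim u"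
proof -
  have *: "(LBINT x = ereal u..ereal v. ln \<bar>2 * sin (pi * x)\<bar>) = lsin_prim v - lsin_prim u"
    if "0 \<le> u" "u \<le> v" "v < 1" for u v
  proof -
    have "set_integrable lborel {u..v} lsin"
      using lsin_absolutely_integrable[of u v] that by (simp add: set_integrable_def integrable_completion)
    hence "(LBINT x = ereal u..ereal v. lsin x) = integral {u..v} lsin"
      using that by (intro interval_integral_eq_integral)
    thus ?thesis using lsin_prim_diff[OF that] by (simp add: lsin_def)
  qed
  show ?thesis
  proof (cases "u \<le> v")
    case True thus ?thesis using * assms by simp
  next
    case False
    thus ?thesis using *[of v u] assms by (subst interval_integral_endpoints_reverse) simp
  qed
qed

lemma has_integral_lsin:
  assumes "0 \<le> u" "u \<le> v" "v < 1"
  shows "(lsin has_integral (lsin_prim v - lsin_prim u)) {u..v}"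
  using lsin_prim_diff[of u v] lsin_integrable_on[of u v] assms by (simp add: has_integral_iff)

lemma has_integral_const_Icc: "u \<le> v \<Longrightarrow> ((\<lambda>t. k) has_integral k * (v - u)) {u..v}" for k u v :: real
  using has_integral_const_real[of k u v] by (simp add: mult.commute)

lemma lsin_prim_diff_le:
  assumes "0 \<le> u" "u \<le> v" "v < 1" "\<And>t. u \<le> t \<Longrightarrow> t \<le> v \<Longrightarrow> lsin t \<le> c"
  shows "lsin_prim v - lsin_prim u \<le> c * (v - u)"
  by (rule has_integral_le[OF has_integral_lsin has_integral_const_Icc]) (use assms in auto)

lemma lsin_prim_diff_ge:
  assumes "0 \<le> u" "u \<le> v" "v < 1" "\<And>t. u \<le> t \<Longrightarrow> t \<le> v \<Longrightarrow> lsin t \<ge> c"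
  shows "lsin_prim v - lsin_prim u \<ge> c * (v - u)"
  by (rule has_integral_le[OF has_integral_const_Icc has_integral_lsin]) (use assms in auto)

lemma lsin_prim_approx:
  assumes "0 \<le> u" "u \<le> v" "v < 1" "\<And>t. u \<le> t \<Longrightarrow> t \<le> v \<Longrightarrow> \<bar>lsin t - c\<bar> \<le> e"
  shows "\<bar>lsin_prim v - lsin_prim u - c * (v - u)\<bar> \<le> e * (v - u)"
proof -
  have "lsin_prim v - lsin_prim u \<le> (c + e) * (v - u)"
    by (rule lsin_prim_diff_le) (use assms in \<open>force simp: abs_le_iff\<close>)+
  moreover have "lsin_prim v - lsin_prim u \<ge> (c - e) * (v - u)"
    by (rule lsin_prim_diff_ge) (use assms in \<open>force simp: abs_le_iff\<close>)+
  ultimately show ?thesis by (simp add: abs_le_iff algebra_simps)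
qed

lemma has_integral_linear_chord:
  fixes u v c :: real assumes "u \<le> v"
  shows "((\<lambda>t. c * (5/6 - t)) has_integral c * ((5/6 - u)^2 - (5/6 - v)^2) / 2) {u..v}"
proof -
  have "((\<lambda>t. c * (5/6 - t)) has_integral (- c * (5/6 - v)^2 / 2 - (- c * (5/6 - u)^2 / 2))) {u..v}"
    using assms by (intro fundamental_theorem_of_calculus)
      (auto intro!: derivative_eq_intros simp: has_real_derivative_iff_has_vector_derivative[symmetric] field_simps)
  thus ?thesis by (simp add: algebra_simps diff_divide_distrib)
qed

lemma lsin_prim_half: "lsin_prim (1/2) = 0"
  by (simp add: lsin_prim_def integral_lsin_half)

text \<open>\<open>lsin\<close> is symmetric about 1/2 and its integral over \<open>[0, 1/2]\<close>
  vanishes, so the value is minus the integral over \<open>[0, 1/6]\<close>.\<close>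

lemma lsin_prim_5_6: "lsin_prim (5/6) \<ge> 0.16153"
proof -
  have "(lsin has_integral integral {1/6..1/2} lsin) (cbox (1/6) (1/2))"
    using lsin_integrable_on[of "1/6" "1/2"] by (simp add: has_integral_iff)
  from has_integral_affinity[OF this, of "-1" 1]
  have "((\<lambda>t. lsin (1 - t)) has_integral integral {1/6..1/2} lsin) {1/2..5/6}"
    by simp
  hence "integral {1/2..5/6} lsin = integral {1/6..1/2} lsin"
    by (simp add: lsin_one_minus integral_unique)
  hence "lsin_prim (5/6) - lsin_prim (1/2) = lsin_prim (1/2) - lsin_prim (1/6)"
    by (subst (1 2) lsin_prim_diff) auto
  thus ?thesis using integral_lsin_1_6 by (simp add: lsin_prim_half) (simp add: lsin_prim_def)
qed

text \<open>Nearly attained at \<open>y = 0\<close>, where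
  \<open>(36/25) * \<integral>\<^bsub>0\<^esub>\<^bsup>5/6\<^esup> log \<bar>2 sin (\<pi> x)\<bar> dx = 0.232607\<dots>\<close>; this is the source of the
  constant 0.2326.\<close>

lemma lsin_prim_quadratic_lower:
  assumes y: "0 \<le> y" "y \<le> 5/6"
  shows "lsin_prim (5/6) - lsin_prim y \<ge> 0.232603 * (5/6 - y)^2"
proof -
  have upper_half: "lsin_prim (5/6) - lsin_prim y \<ge> 3 * ln 2 / 2 * (5/6 - y)^2" if "1/2 \<le> y" "y \<le> 5/6" for y
  proof -
    have "3 * ln 2 * ((5/6 - y)^2 - (5/6 - 5/6)^2) / 2 \<le> lsin_prim (5/6) - lsin_prim y"
    proof (rule has_integral_le[OF has_integral_linear_chord])
      show "(lsin has_integral (lsin_prim (5/6) - lsin_prim y)) {y..5/6}"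
        using that by (intro has_integral_lsin) auto
    qed (use that lsin_ge_chord in auto)
    thus ?thesis by simp
  qed
  \<comment> \<open>Only \<open>y \<le> 1/6\<close> is tight: there
    \<open>lsin_prim y \<le> 0\<close>, and the quadratic is largest at \<open>y = 0\<close>.
    Between 1/6 and 1/2 the nonnegative integral up to 1/2 is dropped; above 1/2 the chord even
    gives a factor larger than 1.\<close>
  consider "y \<le> 1/6" | "1/6 \<le> y" "y \<le> 1/2" | "1/2 \<le> y" by linarith
  thus ?thesis
  proof cases
    case 1
    have "lsin_prim y - lsin_prim 0 \<le> 0 * (y - 0)"
    proof (rule lsin_prim_diff_le)
      show "lsin t \<le> 0" if "0 \<le> t" "t \<le> y" for t
        using lsin_nonpos_left[of t] that 1 by (cases "t = 0") (auto simp: lsin_def)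
    qed (use 1 y in auto)
    moreover have "(5/6 - y)^2 \<le> (5/6)^2" using y by (intro power_mono) auto
    ultimately show ?thesis using lsin_prim_5_6 by (simp add: lsin_prim_def power2_eq_square)
  next
    case 2
    have "lsin_prim (1/2) - lsin_prim y \<ge> 0 * (1/2 - y)"
      using 2 by (intro lsin_prim_diff_ge lsin_nonneg_mid) auto
    moreover have "lsin_prim (5/6) - lsin_prim (1/2) \<ge> ln 2 / 6"
      using upper_half[of "1/2"] by (simp add: power2_eq_square)
    moreover have "(5/6 - y)^2 \<le> (2/3)^2" using 2 by (intro power_mono) auto
    ultimately show ?thesis using ln2_ge_two_thirds by (simp add: power2_eq_square)
  next
    case 3
    have "0.232603 * (5/6 - y)^2 \<le> 3 * ln 2 / 2 * (5/6 - y)^2"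
      using ln2_ge_two_thirds by (intro mult_right_mono) auto
    thus ?thesis using upper_half[of y] 3 y by linarith
  qed
qed

section \<open>Comparison of Riemann sums with the integral\<close>

lemma lsin_node_error:
  fixes a j :: nat and x x' \<sigma> :: real
  assumes x: "x = 1 / (real a + x')" and x': "0 < x'" "x' < 1" and \<sigma>: "0 < \<sigma>" "\<sigma> < 1 + x'"
    and a0: "a > 0" and j: "1 \<le> j" "real (j + 2) / real a \<le> 0.995"
  shows "\<bar>lsin (x * (real j + \<sigma>)) - real a * (lsin_prim (real (j+1) / a) - lsin_prim (real j / a))\<bar> \<le> 1200 / real j"
proof -
  have ja: "j + 2 \<le> a" using j(2) a0 by (simp add: field_simps)
  \<comment> \<open>Both the node and the cell \<open>[j/a, (j+1)/a]\<close> lie in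
    \<open>[L, U]\<close>, because \<open>0 < \<sigma> < 2\<close> and \<open>0 < x' < 1\<close>;
    the oscillation of \<open>lsin\<close> on \<open>[L, U]\<close> controls the error. From
    \<open>U - L \<le> 3/(a+1)\<close> and the Lipschitz bound \<open>400 * (U - L) / L\<close> one
    gets 1200/j.\<close>
  define L U where "L = real j / (real a + 1)" and "U = real (j + 2) / real a"
  have L: "L > 0" using j by (simp add: L_def)
  have U: "U \<le> 0.995" unfolding U_def by (fact j(2))
  have osc: "\<bar>lsin u - lsin v\<bar> \<le> 1200 / real j" if "L \<le> u" "u \<le> v" "v \<le> U" for u v
  proof -
    have "\<bar>lsin v - lsin u\<bar> \<le> 400 * (v - u) / u"
      using that L U by (intro lsin_lipschitz) linarith+
    also have "\<dots> \<le> 400 * (U - L) / L"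
      using that L by (intro frac_le) auto
    also have "\<dots> = 400 * (2 * real a + real j + 2) / (real a * real j)"
    proof -
      have e: "U - L = (2 * real a + real j + 2) / (real a * (real a + 1))"
        using a0 by (simp add: U_def L_def diff_frac_eq algebra_simps)
      show ?thesis unfolding e using a0 j by (simp add: L_def divide_simps)
    qed
    also have "\<dots> \<le> 400 * (3 * real a) / (real a * real j)"
      using ja by (intro divide_right_mono) auto
    also have "\<dots> = 1200 / real j" using a0 by simp
    finally show ?thesis by (simp add: abs_minus_commute)
  qed
  have osc': "\<bar>lsin u - lsin v\<bar> \<le> 1200 / real j" if "u \<in> {L..U}" "v \<in> {L..U}" for u v
    using osc[of u v] osc[of v u] that by (cases "u \<le> v") (auto simp: abs_minus_commute)
  have p: "x * (real j + \<sigma>) \<in> {L..U}"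
  proof -
    have "x * (real j + \<sigma>) = (real j + \<sigma>) / (real a + x')" by (simp add: x)
    moreover have "L \<le> (real j + \<sigma>) / (real a + x')"
      unfolding L_def using x' \<sigma> a0 by (intro frac_le) auto
    moreover have "(real j + \<sigma>) / (real a + x') \<le> U"
      unfolding U_def using x' \<sigma> a0 by (intro frac_le) auto
    ultimately show ?thesis by simp
  qed
  let ?u = "real j / a" and ?v = "real (j+1) / a"
  have uv: "{?u..?v} \<subseteq> {L..U}"
    using a0 by (auto simp: L_def U_def intro!: divide_left_mono divide_right_mono)
       (meson divide_right_mono of_nat_0_le_iff order_trans)?
  have "\<bar>lsin_prim ?v - lsin_prim ?u - lsin (x * (real j + \<sigma>)) * (?v - ?u)\<bar> \<le> (1200 / real j) * (?v - ?u)"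
  proof (rule lsin_prim_approx)
    show "?v < 1" using ja a0 by (simp add: field_simps)
    show "\<bar>lsin t - lsin (x * (real j + \<sigma>))\<bar> \<le> 1200 / real j" if "?u \<le> t" "t \<le> ?v" for t
      using osc'[OF _ p, of t] uv that by auto
  qed (auto intro!: divide_right_mono)
  moreover have vu: "?v - ?u = 1 / a" by (simp add: diff_divide_distrib[symmetric])
  ultimately have "\<bar>lsin_prim ?v - lsin_prim ?u - lsin (x * (real j + \<sigma>)) * (1 / a)\<bar> \<le> (1200 / real j) * (1 / a)"
    by (simp only: vu)
  hence "\<bar>lsin_prim ?v - lsin_prim ?u - lsin (x * (real j + \<sigma>)) * (1 / a)\<bar> * a \<le> (1200 / real j) * (1 / a) * a"
    by (intro mult_right_mono) auto
  also have "\<bar>lsin_prim ?v - lsin_prim ?u - lsin (x * (real j + \<sigma>)) * (1 / a)\<bar> * a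
      = \<bar>a * (lsin_prim ?v - lsin_prim ?u) - lsin (x * (real j + \<sigma>))\<bar>"
    using a0 abs_mult_pos[of "real a" "lsin_prim ?v - lsin_prim ?u - lsin (x * (real j + \<sigma>)) * (1 / a)"]
    by (simp add: algebra_simps)
  also have "(1200 / real j) * (1 / a) * a = 1200 / real j" using a0 by simp
  finally show ?thesis by (simp add: abs_minus_commute)
qed

lemma has_integral_ln_from_0:
  fixes c :: real assumes "c > 0"
  shows "(ln has_integral (c * ln c - c)) {0..c}"
proof -
  have cont: "continuous_on {0..c} (\<lambda>t. t * ln t - t)"
  proof -
    have "continuous (at t within {0..c}) (\<lambda>t. t * ln t)" if t: "t \<in> {0..c}" for t
    proof (cases "t = 0")
      case True
      have "((\<lambda>t::real. t * ln t) \<longlongrightarrow> 0) (at_right 0)" by real_asymp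
      hence "((\<lambda>t. t * ln t) \<longlongrightarrow> 0) (at 0 within {0..c})"
        using assms by (simp add: at_within_Icc_at_right)
      thus ?thesis using True by (simp add: continuous_within)
    next
      case False
      thus ?thesis using t by (intro continuous_intros) auto
    qed
    hence "continuous_on {0..c} (\<lambda>t. t * ln t)"
      by (simp add: continuous_on_eq_continuous_within)
    thus ?thesis by (intro continuous_on_diff continuous_on_id)
  qed
  have "(ln has_integral ((c * ln c - c) - (0 * ln 0 - 0))) {0..c}"
  proof (rule fundamental_theorem_of_calculus_interior)
    fix t :: real assume "t \<in> {0<..<c}"
    hence "((\<lambda>t. t * ln t - t) has_real_derivative ln t) (at t)"
      by (auto intro!: derivative_eq_intros)
    thus "((\<lambda>t. t * ln t - t) has_vector_derivative ln t) (at t)"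
      by (simp add: has_real_derivative_iff_has_vector_derivative)
  qed (use cont assms in auto)
  thus ?thesis by simp
qed

lemma lsin_prim_near_0:
  assumes "0 < c" "c \<le> 1/2"
  shows "\<bar>lsin_prim c\<bar> \<le> c * (2 - ln c)"
proof -
  have L: "(lsin has_integral (lsin_prim c - lsin_prim 0)) {0..c}"
    using assms by (intro has_integral_lsin) auto
  have B: "((\<lambda>t. 1 - ln t) has_integral (1 * (c - 0) - (c * ln c - c))) {0..c}"
    using assms by (intro has_integral_diff has_integral_const_Icc has_integral_ln_from_0) auto
  have le: "\<bar>lsin t\<bar> \<le> 1 - ln t" if "t \<in> {0..c}" for t
    using abs_lsin_le[of t] that assms by (cases "t = 0") (auto simp: lsin_def)
  have "lsin_prim c - lsin_prim 0 \<le> 1 * (c - 0) - (c * ln c - c)"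
    by (rule has_integral_le[OF L B]) (use le in \<open>force simp: abs_le_iff\<close>)
  moreover have "- (1 * (c - 0) - (c * ln c - c)) \<le> lsin_prim c - lsin_prim 0"
    by (rule has_integral_le[OF has_integral_neg[OF B] L]) (use le in \<open>force simp: abs_le_iff\<close>)
  moreover have "lsin_prim 0 = 0" by (simp add: lsin_prim_def)
  ultimately show ?thesis by (simp add: abs_le_iff algebra_simps)
qed

section \<open>Estimates for a single Ostrowski digit\<close>

text \<open>The chain \<open>4*r \<le> 2 * sin (pi*r) \<le> exp 2 * r\<close> places
  \<open>lsin r\<close> within 2 of \<open>ln r\<close>.\<close>

lemma ldsin_near_0:
  assumes x: "0 < x" "x < 1" and r: "0 < r" "r < x/2"
  shows "\<bar>ldsin x r - ln r\<bar> \<le> 1 / (2*x) + 2"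
proof -
  have "ln 2 / (2*x) \<le> 1 / (2*x)"
    using x ln_le_minus_one[of "2::real"] by (intro divide_right_mono) auto
  hence 1: "\<bar>ldsin x r - lsin r\<bar> \<le> 1 / (2*x)" using ldsin_bound_left[OF assms] by linarith
  have s: "sin (pi * r) \<ge> 2 * r" using sin_pi_ge_twice[of r] assms by auto
  have s': "sin (pi * r) \<le> pi * r" using assms by (intro sin_x_le_x) auto
  have "lsin r \<ge> ln (4 * r)" using s assms by (subst lsin_eq) auto
  moreover have "ln (4 * r) \<ge> ln r" using assms by simp
  moreover have "lsin r \<le> ln (exp 2 * r)"
  proof -
    have e: "2 * pi \<le> exp 2"
      using exp_lower_3[of 2] pi_bounds by (simp add: power3_eq_cube)
    have "2 * sin (pi * r) \<le> 2 * pi * r" using s' by simp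
    also have "\<dots> \<le> exp 2 * r" using e assms by (intro mult_right_mono) auto
    finally show ?thesis using s assms by (subst lsin_eq) auto
  qed
  moreover have "ln (exp 2 * r) = 2 + ln r" using assms by (subst ln_mult_pos) auto
  ultimately show ?thesis using 1 by linarith
qed

lemma ldsin_bound':
  assumes "0 < x" "x < 1" "x/2 \<le> v" "v \<le> 1 + x/2"
  shows "\<bar>ldsin x v\<bar> \<le> 1 / (2*x)"
proof -
  have "ln 2 / (2*x) \<le> 1 / (2*x)"
    using assms ln_le_minus_one[of "2::real"] by (intro divide_right_mono) auto
  thus ?thesis using ldsin_bound[OF assms] by linarith
qed

lemma sum_shift_linear: "(\<Sum>j=m..<m+n. (real j - real m - 2)) = (real n^2 - 5 * real n) / 2"
  by (induction n) (auto simp: power2_eq_square field_simps)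

text \<open>One digit in isolation: \<open>a\<close> is the partial quotient, \<open>b\<close> and
  \<open>bs\<close> are the digits of the two expansions, \<open>x\<close> and \<open>x'\<close> are
  consecutive iterates of the Gauss map, and \<open>\<sigma>\<close>, \<open>\<tau>\<close> stand
  for \<open>1 - s\<close> of the higher digits in either expansion. All influence of the higher
  digits passes through these numbers, which makes uniform constants possible.\<close>

locale ostrowski_digit =
  fixes a b bs :: nat and x x' \<sigma> \<tau> :: real
  assumes a: "a \<ge> 1" and x': "0 < x'" "x' < 1" and x_eq: "x = 1 / (real a + x')"
    and \<sigma>: "0 < \<sigma>" "\<sigma> < 1 + x'" and \<tau>: "0 < \<tau>" "\<tau> < 1 + x'"
    and b: "b \<le> a" and bs: "real bs \<le> 5/6 * real a" "5/6 * real a < real bs + 1"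
begin

lemma x_bounds: "0 < x" "x < 1 / real a" "1 / (real a + 1) < x" "x < 1" "x * (real a + x') = 1"
proof -
  show "0 < x" "x < 1 / real a" "1 / (real a + 1) < x" "x * (real a + x') = 1"
    using x' a by (auto simp: x_eq field_simps)
  have "x < 1 / real a" by fact
  also have "\<dots> \<le> 1" using a by simp
  finally show "x < 1" .
qed

lemma node_bounds:
  assumes "j < a" "0 < \<rho>" "\<rho> < 1 + x'"
  shows "0 < x * (real j + \<rho>)" "x * (real j + \<rho>) < 1"
proof -
  show "0 < x * (real j + \<rho>)" using x_bounds assms by (intro mult_pos_pos) auto
  have "x * (real j + \<rho>) < x * (real a + x')"
    using x_bounds assms by (intro mult_strict_left_mono) auto
  thus "x * (real j + \<rho>) < 1" using x_bounds by simp
qed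

lemma ldsin_telescope:
  assumes "m + n \<le> a"
  shows "ldsin x (x * (real (m + n) + \<sigma>)) = ldsin x (x * (real m + \<sigma>)) - (\<Sum>j=m..<m+n. lsin (x * (real j + \<sigma>)))"
  using assms
proof (induction n)
  case (Suc n)
  have "x * (real (m + Suc n) + \<sigma>) = x * (real (m + n) + \<sigma>) + x" by (simp add: algebra_simps)
  thus ?case using Suc ldsin_add_x[of x "x * (real (m + n) + \<sigma>)"] node_bounds[of "m+n" \<sigma>] \<sigma> x_bounds(1) by simp
qed simp

lemma bs_le_a: "bs \<le> a"
  using bs by linarith

lemma ldsin_near_5_6:
  assumes a40: "a \<ge> 40" and \<rho>: "0 < \<rho>" "\<rho> < \<rho>'" "\<rho>' < 1 + x'"
  shows "\<bar>ldsin x (x * (real bs + \<rho>')) - ldsin x (x * (real bs + \<rho>))\<bar> \<le> 9600 / real a"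
proof -
  let ?u = "x * (real bs + \<rho>)" and ?v = "x * (real bs + \<rho>')"
  \<comment> \<open>These points are within \<open>3*x\<close> of 5/6, the zero of
    \<open>lsin\<close>. For \<open>a \<ge> 40\<close> they stay in \<open>[1/2, 0.995]\<close>, so
    the Lipschitz bound gives \<open>2400*x\<close>.\<close>
  have inner: "\<bar>lsin t\<bar> \<le> 2400 / real a" if t: "x * (real bs - 1) \<le> t" "t \<le> x * (real bs + 2)" for t
  proof -
    have "x * (5/6 * real a) \<le> x * (real bs + 1)" using bs x_bounds by (intro mult_left_mono) auto
    moreover have "x * (5/6 * real a) = 5/6 - 5/6 * (x * x')" using x_bounds(5) by (simp add: algebra_simps)
    moreover have "x * x' \<le> x" using x_bounds x' by (simp add: mult_left_le)
    moreover have "x * real bs \<le> x * (5/6 * real a)" using bs x_bounds by (intro mult_left_mono) auto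
    moreover have "x * x' \<ge> 0" using x_bounds x' by simp
    ultimately have t': "5/6 - 3 * x \<le> t" "t \<le> 5/6 + 2 * x" using t by (simp_all add: algebra_simps)
    have "1 / real a \<le> 1/40" using a40 by (intro divide_left_mono) auto
    hence xa: "x \<le> 1/40" using x_bounds(2) by linarith
    have lip: "\<bar>lsin p - lsin q\<bar> \<le> 400 * (3 * x) / (1/2)"
      if "1/2 \<le> q" "q \<le> p" "p \<le> 0.995" "p - q \<le> 3 * x" for p q
    proof -
      have "\<bar>lsin p - lsin q\<bar> \<le> 400 * (p - q) / q" using that by (intro lsin_lipschitz) auto
      also have "\<dots> \<le> 400 * (3 * x) / (1/2)" using that x_bounds by (intro frac_le) auto
      finally show ?thesis .
    qed
    have "\<bar>lsin t - lsin (5/6)\<bar> \<le> 400 * (3 * x) / (1/2)"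
    proof (cases "t \<le> 5/6")
      case True thus ?thesis using lip[of t "5/6"] t' xa by (simp add: abs_minus_commute)
    next
      case False thus ?thesis using lip[of "5/6" t] t' xa x_bounds by simp
    qed
    also have "400 * (3 * x) / (1/2) \<le> 2400 * (1 / real a)" using x_bounds by simp
    finally show ?thesis by simp
  qed
  \<comment> \<open>Room for one more step to the left within the range of convexity.\<close>
  have c1: "(1 + x)/2 \<le> ?u - x"
  proof -
    have "x * (5/6 * real a) \<le> x * (real bs + 1)" using bs x_bounds by (intro mult_left_mono) auto
    moreover have "x * (5/6 * real a) = 5/6 - 5/6 * (x * x')" using x_bounds(5) by (simp add: algebra_simps)
    moreover have "x * x' \<le> x" using x_bounds x' by (simp add: mult_left_le)
    moreover have "1 / real a \<le> 1/40" using a40 by (intro divide_left_mono) auto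
    hence "x \<le> 1/40" using x_bounds(2) by linarith
    moreover have "x * \<rho> > 0" using x_bounds \<rho> by simp
    ultimately have h: "5/6 - 5/6 * (x * x') \<le> x * real bs + x" "x * x' \<le> x" "x \<le> 1/40" "0 < x * \<rho>"
      by (simp_all only: distrib_left mult_1_right)
    have "(1 + x)/2 \<le> x * real bs + x * \<rho> - x"
      using h by argo
    thus ?thesis by (simp only: distrib_left)
  qed
  have c2: "?u < ?v" using x_bounds \<rho> by simp
  have c3: "?v < 1" using node_bounds[of bs \<rho>'] \<rho> bs a40 by auto
  note sl = ldsin_slope_bounds[OF x_bounds(1) c1 c2 c3]
  have b1: "\<bar>lsin ?v\<bar> \<le> 2400 / real a" using x' \<rho> x_bounds by (intro inner) auto
  have b2: "\<bar>lsin (?u - x)\<bar> \<le> 2400 / real a" using x' \<rho> x_bounds by (intro inner) (auto simp: algebra_simps)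
  let ?s = "(ldsin x ?v - ldsin x ?u) / (?v - ?u)"
  have "\<bar>?s\<bar> \<le> (2400 / real a) / x"
  proof -
    have "- lsin ?v / x \<le> (2400 / real a) / x" using b1 x_bounds by (intro divide_right_mono) auto
    moreover have "lsin (?u - x) / x \<le> (2400 / real a) / x" using b2 x_bounds by (intro divide_right_mono) auto
    hence "- ((2400 / real a) / x) \<le> - lsin (?u - x) / x" by (simp only: minus_divide_left[symmetric] neg_le_iff_le)
    ultimately have "?s \<le> (2400 / real a) / x" "- ((2400 / real a) / x) \<le> ?s"
      using order_trans[OF sl(1)] order_trans[OF _ sl(2)] by blast+
    thus ?thesis by (simp only: abs_le_iff neg_le_iff_le minus_le_iff[of ?s])
  qed
  moreover have vu: "?v - ?u \<le> 2 * x"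
  proof -
    have "x * (\<rho>' - \<rho>) \<le> x * 2" using \<rho> x' x_bounds by (intro mult_left_mono) auto
    thus ?thesis by (simp add: algebra_simps)
  qed
  moreover have "0 \<le> (2400 / real a) / x" using x_bounds by simp
  ultimately have "\<bar>?s\<bar> * (?v - ?u) \<le> (2400 / real a) / x * (2 * x)"
    using c2 \<rho> by (intro mult_mono) simp_all
  moreover have "\<bar>?s\<bar> * (?v - ?u) = \<bar>ldsin x ?v - ldsin x ?u\<bar>" using c2 by (simp add: abs_divide)
  moreover have "(2400 / real a) / x * (2 * x) = 4800 / real a" using x_bounds by simp
  moreover have "4800 / real a \<le> 9600 / real a" by (intro divide_right_mono) auto
  ultimately show ?thesis by linarith
qed

lemma ldsin_near_5_6':
  assumes "a \<ge> 40"
  shows "\<bar>ldsin x (x * (real bs + \<sigma>)) - ldsin x (x * (real bs + \<tau>))\<bar> \<le> 9600 / real a"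
  using ldsin_near_5_6[OF assms, of \<sigma> \<tau>] ldsin_near_5_6[OF assms, of \<tau> \<sigma>] \<sigma> \<tau>
  by (cases \<sigma> \<tau> rule: linorder_cases) (auto simp: abs_minus_commute)

lemma node_sum_error:
  assumes "1 \<le> m" "real (m + n + 1) / real a \<le> 0.995"
  shows "\<bar>(\<Sum>j=m..<m+n. lsin (x * (real j + \<sigma>))) - real a * (lsin_prim (real (m + n) / a) - lsin_prim (real m / a))\<bar>
     \<le> (\<Sum>j=m..<m+n. 1200 / real j)"
  using assms(2)
proof (induction n)
  case (Suc n)
  have "real (m + n + 1) / real a \<le> real (m + Suc n + 1) / real a" by (intro divide_right_mono) auto
  hence IH: "\<bar>(\<Sum>j=m..<m+n. lsin (x * (real j + \<sigma>))) - real a * (lsin_prim (real (m + n) / a) - lsin_prim (real m / a))\<bar>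
     \<le> (\<Sum>j=m..<m+n. 1200 / real j)" using Suc by linarith
  have "\<bar>lsin (x * (real (m+n) + \<sigma>)) - real a * (lsin_prim (real (m+n+1) / a) - lsin_prim (real (m+n) / a))\<bar> \<le> 1200 / real (m+n)"
    using Suc.prems assms(1) a by (intro lsin_node_error[OF x_eq x' \<sigma>]) (auto simp: add_ac)
  thus ?case using IH by (simp add: algebra_simps)
qed simp

text \<open>Of order \<open>n/a\<close> when \<open>m\<close> is comparable to \<open>a\<close>; for
  small \<open>m\<close> the harmonic bound that follows takes its place.\<close>

lemma sum_inverse_le1:
  assumes "1 \<le> m"
  shows "(\<Sum>j=m..<m+n. 1200 / real j) \<le> 1200 * real n / real m"
proof -
  have "(\<Sum>j=m..<m+n. 1200 / real j) \<le> of_nat (card {m..<m+n}) * (1200 / real m)"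
    using assms by (intro sum_bounded_above divide_left_mono) auto
  thus ?thesis by (simp add: mult.commute)
qed

lemma sum_inverse_le2:
  assumes "1 \<le> m" "m + n \<le> a"
  shows "(\<Sum>j=m..<m+n. 1200 / real j) \<le> 1200 * (1 + ln (real a))"
proof -
  have "(\<Sum>j=m..<m+n. 1 / real j) \<le> (\<Sum>j=1..a. 1 / real j)"
    using assms by (intro sum_mono2) auto
  also have "\<dots> = harm a" by (simp add: harm_def inverse_eq_divide)
  also have "\<dots> \<le> 1 + ln (real a)"
    using euler_mascheroni_sequence_decreasing[of 1 a] a by (simp add: harm_expand)
  finally have "1200 * (\<Sum>j=m..<m+n. 1 / real j) \<le> 1200 * (1 + ln (real a))" by simp
  thus ?thesis by (simp add: sum_distrib_left)
qed

section \<open>The digit term against the integral\<close>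

definition D where "D = ldsin x (x * (real b + \<sigma>)) - ldsin x (x * (real bs + \<tau>))"
definition I where "I = real a * (lsin_prim (real bs / a) - lsin_prim (real b / a))"

lemma D_left:
  assumes "a \<ge> 40" "b \<le> bs"
  shows "\<bar>D - (\<Sum>j=b..<bs. lsin (x * (real j + \<sigma>)))\<bar> \<le> 9600 / real a"
  using ldsin_near_5_6'[OF assms(1)] ldsin_telescope[of b "bs - b"] assms(2) bs_le_a
  by (simp add: D_def of_nat_diff)

lemma D_right:
  assumes "a \<ge> 40" "bs \<le> b"
  shows "\<bar>D + (\<Sum>j=bs..<b. lsin (x * (real j + \<sigma>)))\<bar> \<le> 9600 / real a"
  using ldsin_near_5_6'[OF assms(1)] ldsin_telescope[of bs "b - bs"] assms(2) b
  by (simp add: D_def of_nat_diff)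

text \<open>All nodes have index at least \<open>0.01 * a\<close>, which turns 1200/j into 120000/a
  per node. For \<open>a \<ge> 200\<close> one further node fits between 0.99 and 0.995.\<close>

lemma D_approx_mid:
  assumes a200: "a \<ge> 200" and bb: "0.01 * real a < real b" "real b \<le> 0.99 * real a"
  shows "\<bar>D - I\<bar> \<le> 9600 / real a + 120000 * \<bar>real b - real bs\<bar> / real a"
proof -
  have a200': "real a \<ge> 200" using a200 by simp
  have bb': "real a / 100 < real b" "real b \<le> 99/100 * real a" using bb by simp_all
  show ?thesis
  proof (cases "b \<le> bs")
    case True
    have "real bs + 1 \<le> 199/200 * real a" using bs a200' by linarith
    hence c: "real (b + (bs - b) + 1) / real a \<le> 0.995" using True a200 by (simp add: divide_le_eq)
    have b1: "1 \<le> b" using bb' a200' by linarith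
    have "\<bar>(\<Sum>j=b..<bs. lsin (x * (real j + \<sigma>))) - I\<bar> \<le> (\<Sum>j=b..<b+(bs-b). 1200 / real j)"
      using node_sum_error[OF b1 c] True by (simp add: I_def of_nat_diff)
    also have "\<dots> \<le> 1200 * real (bs - b) / real b" by (rule sum_inverse_le1[OF b1])
    also have "\<dots> \<le> 1200 * real (bs - b) / (0.01 * real a)"
      using bb b1 a200 by (intro divide_left_mono) auto
    also have "\<dots> = 120000 * \<bar>real b - real bs\<bar> / real a" using True by (simp add: of_nat_diff)
    finally show ?thesis using D_left True a200 by linarith
  next
    case False
    have "real b + 1 \<le> 199/200 * real a" using bb' a200' by linarith
    hence c: "real (bs + (b - bs) + 1) / real a \<le> 0.995" using False a200 by (simp add: divide_le_eq)
    have b1: "1 \<le> bs" using bs a200' by linarith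
    have "\<bar>(\<Sum>j=bs..<b. lsin (x * (real j + \<sigma>))) + I\<bar> \<le> (\<Sum>j=bs..<bs+(b-bs). 1200 / real j)"
      using node_sum_error[OF b1 c] False by (simp add: I_def of_nat_diff algebra_simps)
    also have "\<dots> \<le> 1200 * real (b - bs) / real bs" by (rule sum_inverse_le1[OF b1])
    also have "\<dots> \<le> 1200 * real (b - bs) / (0.01 * real a)"
    proof (intro divide_left_mono)
      show "0.01 * real a \<le> real bs" using bs a200' by simp
    qed (use b1 a200 in auto)
    also have "\<dots> = 120000 * \<bar>real b - real bs\<bar> / real a" using False by (simp add: of_nat_diff)
    finally show ?thesis using D_right False a200 by linarith
  qed
qed

lemma D_approx_low_aux:
  assumes a200: "a \<ge> 200" and m: "1 \<le> m" "m \<le> bs"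
  shows "\<bar>(\<Sum>j=m..<bs. lsin (x * (real j + \<sigma>))) - real a * (lsin_prim (real bs / a) - lsin_prim (real m / a))\<bar>
    \<le> 1200 * (1 + ln (real a))"
proof -
  have "real a \<ge> 200" using a200 by simp
  hence "real bs + 1 \<le> 199/200 * real a" using bs by linarith
  hence c: "real (m + (bs - m) + 1) / real a \<le> 0.995" using m a200 by (simp add: divide_le_eq)
  have "\<bar>(\<Sum>j=m..<bs. lsin (x * (real j + \<sigma>))) - real a * (lsin_prim (real bs / a) - lsin_prim (real m / a))\<bar> \<le> (\<Sum>j=m..<m+(bs-m). 1200 / real j)"
    using node_sum_error[OF m(1) c] m by (simp add: of_nat_diff)
  also have "\<dots> \<le> 1200 * (1 + ln (real a))" using m bs_le_a by (intro sum_inverse_le2) auto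
  finally show ?thesis .
qed

text \<open>\<open>\<sigma>\<close> may be arbitrarily small, so its logarithm is split off instead
  of being bounded; a correction term will cancel it.\<close>

lemma lsin_first_node:
  assumes "a \<ge> 200"
  shows "\<bar>lsin (x * \<sigma>) - ln \<sigma>\<bar> \<le> ln (real a)"
proof -
  have p0: "0 < x * \<sigma>" using x_bounds \<sigma> by simp
  have "x * \<sigma> \<le> 1 / real a * 2" using x_bounds \<sigma> x' by (intro mult_mono) auto
  also have "\<dots> \<le> 1/2" using assms by (simp add: field_simps)
  finally have p1: "x * \<sigma> \<le> 1/2" .
  have s: "sin (pi * (x * \<sigma>)) \<ge> 2 * (x * \<sigma>)" using p0 p1 by (intro sin_pi_ge_twice) auto
  have s': "sin (pi * (x * \<sigma>)) \<le> pi * (x * \<sigma>)" using p0 by (intro sin_x_le_x) auto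
  have "1 / real a \<le> 4 * (1 / (real a + 1))" using assms by (simp add: field_simps)
  also have "\<dots> \<le> 4 * x" using x_bounds(3) by simp
  finally have "1 / real a \<le> 4 * x" .
  hence "(1 / real a) * \<sigma> \<le> 2 * sin (pi * (x * \<sigma>))"
    using s \<sigma> mult_right_mono[of "1 / real a" "4 * x" \<sigma>] by linarith
  hence "ln ((1 / real a) * \<sigma>) \<le> lsin (x * \<sigma>)"
  proof -
    have "0 < (1 / real a) * \<sigma>" using \<sigma> assms by simp
    moreover have "0 < 2 * sin (pi * (x * \<sigma>))" using s p0 by linarith
    ultimately have "ln ((1 / real a) * \<sigma>) \<le> ln (2 * sin (pi * (x * \<sigma>)))"
      using \<open>(1 / real a) * \<sigma> \<le> _\<close> by (subst ln_le_cancel_iff)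
    thus ?thesis using p0 p1 by (subst lsin_eq) auto
  qed
  moreover have "ln ((1 / real a) * \<sigma>) = ln \<sigma> - ln (real a)"
    using \<sigma> assms by (simp add: ln_div)
  moreover have "lsin (x * \<sigma>) \<le> ln \<sigma>"
  proof -
    have "pi * x \<le> 4 * (1 / real a)" using x_bounds pi_less_4 by (intro mult_mono) auto
    also have "\<dots> \<le> 1/2" using assms by (simp add: field_simps)
    finally have "(pi * x) * \<sigma> \<le> 1/2 * \<sigma>" using \<sigma> by (intro mult_right_mono) auto
    hence "2 * sin (pi * (x * \<sigma>)) \<le> \<sigma>" using s' by (simp add: mult.assoc)
    thus ?thesis using p0 p1 s \<sigma> by (subst lsin_eq) auto
  qed
  moreover have "ln (real a) \<ge> 0" using assms by simp
  ultimately show ?thesis by linarith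
qed

lemma D_approx_low_pos:
  assumes a200: "a \<ge> 200" and b1: "1 \<le> b" "real b \<le> 0.01 * real a"
  shows "\<bar>D - I\<bar> \<le> 9600 / real a + 1200 * (1 + ln (real a))"
proof -
  have "real b \<le> real a / 100" "real a \<ge> 200" using b1 a200 by simp_all
  hence "real b \<le> real bs" using bs by linarith
  hence le: "b \<le> bs" by simp
  show ?thesis using D_left D_approx_low_aux[OF a200 b1(1) le] le a200 unfolding I_def abs_le_iff by simp
qed

text \<open>The node \<open>j = 0\<close> has no error bound of type 1200/j. It is evaluated
  separately, and so is the first cell \<open>[0, 1/a]\<close>, whose integral times
  \<open>a\<close> is at most \<open>2 + ln a\<close> in absolute value.\<close>

lemma D_approx_zero:
  assumes a200: "a \<ge> 200" and b0: "b = 0"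
  shows "\<bar>D - ln \<sigma> - I\<bar> \<le> 9600 / real a + 1202 * (1 + ln (real a))"
proof -
  have le: "1 \<le> bs" using bs a200 by linarith
  have "(\<Sum>j=b..<bs. lsin (x * (real j + \<sigma>))) = lsin (x * \<sigma>) + (\<Sum>j=1..<bs. lsin (x * (real j + \<sigma>)))"
    using le b0 by (simp add: sum.atLeast_Suc_lessThan)
  moreover have "\<bar>lsin_prim (1 / real a)\<bar> \<le> (1 / real a) * (2 - ln (1 / real a))"
    using a200 by (intro lsin_prim_near_0) auto
  hence "real a * \<bar>lsin_prim (1 / real a)\<bar> \<le> real a * ((1 / real a) * (2 - ln (1 / real a)))"
    by (intro mult_left_mono) auto
  hence "\<bar>real a * lsin_prim (1 / real a)\<bar> \<le> 2 + ln (real a)"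
    using a200 by (simp add: abs_mult ln_div)
  moreover have "lsin_prim 0 = 0" by (simp add: lsin_prim_def)
  moreover have "I = real a * lsin_prim (real bs / a)"
    unfolding I_def using b0 \<open>lsin_prim 0 = 0\<close> by simp
  moreover have "\<bar>D - (\<Sum>j=b..<bs. lsin (x * (real j + \<sigma>)))\<bar> \<le> 9600 / real a"
    using a200 b0 by (intro D_left) auto
  moreover have "\<bar>(\<Sum>j=1..<bs. lsin (x * (real j + \<sigma>))) - (real a * lsin_prim (real bs / a) - real a * lsin_prim (1 / a))\<bar>
    \<le> 1200 * (1 + ln (real a))"
    using D_approx_low_aux[OF a200 _ le] by (simp add: right_diff_distrib)
  moreover have "\<bar>d - l - i\<bar> \<le> e + 1202 * (1 + la)"
    if "s = f + s1" "\<bar>t1\<bar> \<le> 2 + la" "i = t2" "\<bar>d - s\<bar> \<le> e" "\<bar>s1 - (t2 - t1)\<bar> \<le> 1200 * (1 + la)" "\<bar>f - l\<bar> \<le> la"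
    for s f s1 t1 la i t2 d l e :: real
    using that by argo
  ultimately show ?thesis using lsin_first_node[OF a200] by blast
qed

text \<open>A one-sided bound that survives up to the singularity at 1: the convex function
  \<open>- lsin\<close> lies above its tangent at 5/6, of slope \<open>pi * sqrt 3\<close>, and the
  node with index \<open>j\<close> exceeds 5/6 by at least \<open>x * (j - bs - 2)\<close>.\<close>

lemma node_tangent_sum:
  assumes "bs + n \<le> a"
  shows "- (\<Sum>j=bs..<bs+n. lsin (x * (real j + \<sigma>))) \<ge> (1.25 * real n^2 - 20 * real n) / real a"
proof -
  have node: "- lsin (x * (real j + \<sigma>)) \<ge> (pi * sqrt 3) * (x * (real j - real bs - 2))" if "j < a" for j
  proof -
    have "x * (5/6 * (real a + x')) \<le> x * (real bs + 2)"
      using bs x' x_bounds by (intro mult_left_mono) auto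
    moreover have "x * (5/6 * (real a + x')) = 5/6"
    proof -
      have "x * (5/6 * (real a + x')) = 5/6 * (x * (real a + x'))" by (simp only: mult_ac)
      thus ?thesis using x_bounds(5) by simp
    qed
    moreover have "x * \<sigma> > 0" using x_bounds \<sigma> by simp
    ultimately have "x * (real j - real bs - 2) \<le> x * (real j + \<sigma>) - 5/6" by (simp add: algebra_simps)
    hence "(pi * sqrt 3) * (x * (real j - real bs - 2)) \<le> (pi * sqrt 3) * (x * (real j + \<sigma>) - 5/6)"
      by (intro mult_left_mono) auto
    also have "\<dots> \<le> - lsin (x * (real j + \<sigma>))"
      using lsin_below_tangent[OF node_bounds[OF that \<sigma>]] by (simp add: algebra_simps)
    finally show ?thesis .
  qed
  \<comment> \<open>\<open>q\<close> is negative for \<open>0 < n < 5\<close>, so the factor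
    \<open>\<kappa>\<close> has to be bounded from both sides.\<close>
  define q where "q = (real n^2 - 5 * real n) / 2"
  define \<kappa> where "\<kappa> = pi * sqrt 3 * x"
  have "(\<Sum>j=bs..<bs+n. (pi * sqrt 3) * (x * (real j - real bs - 2))) \<le> (\<Sum>j=bs..<bs+n. - lsin (x * (real j + \<sigma>)))"
    using assms by (intro sum_mono node) auto
  moreover have "(\<Sum>j=bs..<bs+n. (pi * sqrt 3) * (x * (real j - real bs - 2))) = \<kappa> * q"
    unfolding sum_distrib_left[symmetric] sum_shift_linear q_def \<kappa>_def by simp
  ultimately have S: "- (\<Sum>j=bs..<bs+n. lsin (x * (real j + \<sigma>))) \<ge> \<kappa> * q" by (simp add: sum_negf)
  have x_lower: "1 / (2 * real a) \<le> x"
  proof -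
    have "1 / (2 * real a) \<le> 1 / (real a + 1)" using a by (intro divide_left_mono) auto
    thus ?thesis using x_bounds(3) by simp
  qed
  have k1: "\<kappa> \<ge> 5 * (1 / (2 * real a))"
    unfolding \<kappa>_def using pi_sqrt_3_bounds x_lower by (intro mult_mono) auto
  have k2: "\<kappa> \<le> 6 * (1 / real a)"
    unfolding \<kappa>_def using pi_sqrt_3_bounds x_bounds by (intro mult_mono) auto
  have "\<kappa> * q \<ge> (1.25 * real n^2 - 20 * real n) / real a"
  proof (cases "n \<ge> 5")
    case True
    hence "real n * 5 \<le> real n * real n" by (intro mult_left_mono) auto
    hence "q \<ge> 0" by (simp add: q_def power2_eq_square)
    hence "5 * (1 / (2 * real a)) * q \<le> \<kappa> * q" using k1 by (intro mult_right_mono) auto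
    moreover have "5 * (1 / (2 * real a)) * q = (1.25 * real n^2 - 6.25 * real n) / real a"
      using a by (simp add: q_def field_simps)
    moreover have "(1.25 * real n^2 - 20 * real n) / real a \<le> (1.25 * real n^2 - 6.25 * real n) / real a"
      by (intro divide_right_mono) auto
    ultimately show ?thesis by linarith
  next
    case False
    hence "real n * real n \<le> real n * 5" by (intro mult_left_mono) auto
    hence "q \<le> 0" by (simp add: q_def power2_eq_square)
    hence "6 * (1 / real a) * q \<le> \<kappa> * q" using k2 by (intro mult_right_mono_neg) auto
    moreover have "6 * (1 / real a) * q = (3 * real n^2 - 15 * real n) / real a"
      using a by (simp add: q_def field_simps)
    moreover have "(1.25 * real n^2 - 20 * real n) / real a \<le> (3 * real n^2 - 15 * real n) / real a"
      by (intro divide_right_mono) auto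
    ultimately show ?thesis by linarith
  qed
  thus ?thesis using S by linarith
qed

lemma D_lower_right:
  assumes a40: "a \<ge> 40" and le: "bs \<le> b"
  shows "D \<ge> 0.2326 * (real b - real bs)^2 / real a - 9700 / real a"
proof -
  define n where "n = real b - real bs"
  have "- (\<Sum>j=bs..<b. lsin (x * (real j + \<sigma>))) \<ge> (1.25 * n^2 - 20 * n) / real a"
    using node_tangent_sum[of "b - bs"] le b by (simp add: n_def of_nat_diff)
  hence "D \<ge> (1.25 * n^2 - 20 * n) / real a - 9600 / real a"
    using D_right[OF a40 le] by linarith
  \<comment> \<open>\<open>(n - 10)^2 \<ge> 0\<close> trades the linear term for the constant 100,
    as the two quadratic coefficients differ by more than 1.\<close>
  moreover have "0.2326 * n^2 - 100 \<le> 1.25 * n^2 - 20 * n"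
  proof -
    have "0 \<le> (n - 10)^2" by simp
    hence "n^2 - 20 * n + 100 \<ge> 0" by (simp add: power2_diff algebra_simps)
    moreover have "n^2 \<ge> 0" by simp
    ultimately have "2326/10000 * n^2 - 100 \<le> 125/100 * n^2 - 20 * n" by linarith
    thus ?thesis by simp
  qed
  hence "(0.2326 * n^2 - 100) / real a \<le> (1.25 * n^2 - 20 * n) / real a" by (intro divide_right_mono) auto
  moreover have "(0.2326 * n^2 - 100) / real a = 0.2326 * n^2 / real a - 100 / real a"
    by (rule diff_divide_distrib)
  moreover have "9700 / real a = 9600 / real a + 100 / real a"
    by (simp add: add_divide_distrib[symmetric])
  ultimately show ?thesis unfolding n_def[symmetric] by linarith
qed

text \<open>When \<open>b\<close> is close to \<open>a\<close>, the last node lies at distance \<open>1 + x - x (b + \<sigma>)\<close> from the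
  singularity at \<open>1\<close>; its contribution absorbs the logarithm of that distance.\<close>

lemma D_lower_right_log:
  assumes a1000: "a \<ge> 1000" and bb: "real b > 0.99 * real a"
  shows "D + ln (1 + x - x * (real b + \<sigma>)) \<ge> 0.2326 * (real b - real bs)^2 / real a - 9700 / real a"
proof -
  have ar: "real a \<ge> 1000" using a1000 by simp
  have bb': "real b > 99/100 * real a" using bb by simp
  have "real bs < real b" using bb' bs ar by linarith
  hence le: "Suc bs \<le> b" by simp
  define m where "m = b - 1 - bs"
  have b_eq: "b = Suc (bs + m)" using le by (simp add: m_def)
  have ma: "bs + m < a" using b b_eq by simp
  let ?p = "x * (real (bs + m) + \<sigma>)"
  have p: "0 < ?p" "?p < 1" using node_bounds[OF ma \<sigma>] by auto
  \<comment> \<open>The last node is one step \<open>x\<close> before the argument in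
    \<open>D\<close>, so its distance to 1 equals the distance of that argument to the pole
    \<open>1 + x\<close>; the two logarithms cancel with a loss of at most 2.\<close>
  have p_eq: "1 + x - x * (real b + \<sigma>) = 1 - ?p" by (simp add: b_eq algebra_simps)
  have last: "- lsin ?p \<ge> - ln (1 - ?p) - 2"
  proof -
    have s: "sin (pi * (1 - ?p)) > 0" using p by (intro sin_gt_zero) auto
    have "sin (pi * (1 - ?p)) \<le> pi * (1 - ?p)" using p by (intro sin_x_le_x) auto
    hence "2 * sin (pi * (1 - ?p)) \<le> 2 * pi * (1 - ?p)" by simp
    also have "\<dots> \<le> exp 2 * (1 - ?p)"
      using p exp_lower_3[of 2] pi_bounds by (intro mult_right_mono) (simp_all add: power3_eq_cube)
    finally have "lsin (1 - ?p) \<le> ln (exp 2 * (1 - ?p))" using s p by (subst lsin_eq) auto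
    also have "\<dots> = 2 + ln (1 - ?p)" using p by (subst ln_mult_pos) auto
    finally show ?thesis by (simp add: lsin_one_minus)
  qed
  have "- (\<Sum>j=bs..<b. lsin (x * (real j + \<sigma>))) = - (\<Sum>j=bs..<bs+m. lsin (x * (real j + \<sigma>))) - lsin ?p"
    by (simp add: b_eq)
  hence D1: "D + ln (1 - ?p) \<ge> (1.25 * real m^2 - 20 * real m) / real a - 2 - 9600 / real a"
    using D_right[of] node_tangent_sum[of m] ma le a1000 last by linarith
  define n where "n = real b - real bs"
  have m_eq: "real m = n - 1" by (simp add: n_def b_eq)
  have n_lower: "n \<ge> 3/20 * real a" using bb' bs by (simp add: n_def)
  have "real m \<ge> 0" by simp
  \<comment> \<open>The loss 2 becomes \<open>2*a\<close> after multiplication by \<open>a\<close>.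
    Since \<open>b > 0.99*a\<close> forces \<open>n \<ge> 0.15*a\<close>, the quadratic surplus
    covers it.\<close>
  have key: "0.2326 * n^2 \<le> 1.25 * real m^2 - 20 * real m - 2 * real a"
  proof -
    have "n * (n - 23) \<ge> (3/20 * real a) * 100"
      using n_lower ar by (intro mult_mono) auto
    hence "n^2 - 23 * n \<ge> 15 * real a" by (simp add: power2_eq_square algebra_simps)
    moreover have "1.25 * real m^2 - 20 * real m = 1.25 * n^2 - 22.5 * n + 21.25"
      by (simp add: m_eq power2_diff field_simps)
    moreover have "n^2 \<ge> 0" by simp
    moreover have "n \<ge> 0" using n_lower ar by linarith
    ultimately show ?thesis using ar by simp
  qed
  hence "0.2326 * n^2 / real a \<le> (1.25 * real m^2 - 20 * real m - 2 * real a) / real a"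
    by (intro divide_right_mono) auto
  also have "\<dots> = (1.25 * real m^2 - 20 * real m) / real a - 2" using a by (simp add: diff_divide_distrib)
  finally have "0.2326 * n^2 / real a \<le> (1.25 * real m^2 - 20 * real m) / real a - 2" .
  moreover have "9600 / real a \<le> 9700 / real a" by (intro divide_right_mono) auto
  ultimately show ?thesis using D1 unfolding p_eq n_def[symmetric] by linarith
qed

text \<open>The quadratic inequality ends at 5/6. Stopping at \<open>bs/a\<close> instead omits an
  interval of length at most 1/a on which \<open>lsin \<le> 6/a\<close>, which costs 6/a after
  multiplication by \<open>a\<close>.\<close>

lemma I_lower:
  assumes "b \<le> bs"
  shows "I \<ge> 0.232603 * (real b - real bs)^2 / real a - 6 / real a"
proof -
  let ?u = "real b / a" and ?v = "real bs / a"
  have a0: "real a > 0" using a by simp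
  have "(5/6 * real a - 1) / real a \<le> ?v" using bs by (intro divide_right_mono) auto
  hence v: "5/6 - 1 / real a \<le> ?v" using a0 by (simp add: diff_divide_distrib)
  have v': "?v \<le> 5/6" using bs a0 by (simp add: divide_le_eq)
  have u: "0 \<le> ?u" "?u \<le> ?v" using assms by (auto intro: divide_right_mono)
  have "lsin_prim (5/6) - lsin_prim ?v \<le> (6 / real a) * (5/6 - ?v)"
  proof (rule lsin_prim_diff_le)
    fix t assume t: "?v \<le> t" "t \<le> 5/6"
    show "lsin t \<le> 6 / real a"
    proof (cases "t > 0")
      case True
      have "lsin t \<le> 6 * (5/6 - t)" using True t by (intro lsin_le_tangent_strong) auto
      also have "\<dots> \<le> 6 * (1 / real a)" using t v v' by (intro mult_left_mono) auto
      finally show ?thesis by simp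
    next
      case False
      hence "t = 0" using t u by linarith
      thus ?thesis by (simp add: lsin_def)
    qed
  qed (use u v v' in auto)
  also have "\<dots> \<le> (6 / real a) * (1 / real a)" using v v' a0 by (intro mult_left_mono) auto
  finally have 1: "lsin_prim (5/6) - lsin_prim ?v \<le> (6 / real a) * (1 / real a)" .
  have "0.232603 * ((real bs - real b) / real a)^2 \<le> 0.232603 * (5/6 - ?u)^2"
    using u v v' by (intro mult_left_mono power_mono) (auto simp: diff_divide_distrib)
  also have "\<dots> \<le> lsin_prim (5/6) - lsin_prim ?u"
    using u order_trans[OF u(2) v'] by (intro lsin_prim_quadratic_lower)
  finally have "lsin_prim ?v - lsin_prim ?u \<ge> 0.232603 * ((real bs - real b) / real a)^2 - (6 / real a) * (1 / real a)"
    using 1 by linarith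
  hence "I \<ge> real a * (0.232603 * ((real bs - real b) / real a)^2 - (6 / real a) * (1 / real a))"
    unfolding I_def by (intro mult_left_mono) auto
  also have "real a * (0.232603 * ((real bs - real b) / real a)^2 - (6 / real a) * (1 / real a))
    = 0.232603 * (real b - real bs)^2 / real a - 6 / real a"
    using a0 by (simp add: field_simps power2_eq_square)
  finally show ?thesis .
qed

end

section \<open>Digit terms with the singularities transferred\<close>

lemma lsin_prim_bounded: "\<exists>B>0. \<forall>t\<in>{0..0.99}. \<bar>lsin_prim t\<bar> \<le> B"
proof -
  have "continuous_on {0..0.99} (\<lambda>t. integral {0..t} lsin)"
    by (intro indefinite_integral_continuous_1 lsin_integrable_on) auto
  hence "bounded ((\<lambda>t. integral {0..t} lsin) ` {0..0.99})"
    by (intro compact_imp_bounded compact_continuous_image) auto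
  then obtain B where "B > 0" "\<forall>y\<in>(\<lambda>t. integral {0..t} lsin) ` {0..0.99}. norm y \<le> B"
    unfolding bounded_pos by blast
  thus ?thesis by (intro exI[of _ B]) (auto simp: lsin_prim_def)
qed

text \<open>\<open>\<nu>\<close> compensates the zero of S met when \<open>b = 0\<close> and
  \<open>\<sigma>\<close> is small, \<open>\<mu>\<close> the pole met when
  \<open>x * (b + \<sigma>)\<close> approaches \<open>1 + x\<close>. For \<open>b = 0\<close> an
  absent compensation means \<open>\<sigma> \<ge> 1/200\<close>; within \<open>x/2\<close> of the
  pole compensation is mandatory. The last assumption keeps the reference digit away from both
  singularities.\<close>

locale ostrowski_digit_corr = ostrowski_digit +
  fixes \<mu> \<nu> :: real
  assumes next0: "b = 0 \<Longrightarrow> \<nu> = - ln \<sigma> \<or> (\<nu> = 0 \<and> \<sigma> \<ge> 1/200)"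
    and next_pos: "b > 0 \<Longrightarrow> \<nu> = 0"
    and cur: "\<mu> = 0 \<or> \<mu> = - ln (1 + x - x * (real b + \<sigma>))"
    and cur_small: "real b \<le> 0.99 * real a \<Longrightarrow> \<mu> = 0"
    and cur_large: "1 + x - x * (real b + \<sigma>) < x / 2 \<Longrightarrow> \<mu> = - ln (1 + x - x * (real b + \<sigma>))"
    and star: "1/12 \<le> \<tau>" "1/12 \<le> 1 + x - x * (real bs + \<tau>)"
begin

definition D' where "D' = D + \<nu> - \<mu>"

lemma D'_approx_large:
  assumes a200: "a \<ge> 200" and bb: "real b \<le> 0.99 * real a"
  shows "\<bar>D' - I\<bar> \<le> 9600 / real a + 120000 * \<bar>real b - real bs\<bar> / real a
     + (if real b \<le> 0.01 * real a then 4000 * ln (real a) else 0)"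
proof -
  have nn: "120000 * \<bar>real b - real bs\<bar> / real a \<ge> 0" by simp
  have "real a \<ge> 200" using a200 by simp
  hence "exp 1 \<le> real a" using exp_le by linarith
  hence la: "ln (real a) \<ge> 1" using a200 by (subst ln_ge_iff) auto
  have l0: "\<mu> = 0" using cur_small bb .
  have D'D: "D' = D + \<nu>" unfolding D'_def by (simp add: l0)
  consider "b = 0" | "b \<ge> 1" "real b \<le> 0.01 * real a" | "real b > 0.01 * real a" by linarith
  thus ?thesis
  proof cases
    case 1
    have "\<bar>ln \<sigma> + \<nu>\<bar> \<le> ln (real a)"
    proof (cases "\<nu> = - ln \<sigma>")
      case True thus ?thesis using la by simp
    next
      case False
      hence s: "\<nu> = 0" "\<sigma> \<ge> 1/200" using next0[OF 1] by auto
      have "ln \<sigma> \<le> ln (real a)" using \<sigma> x' a200 by (subst ln_le_cancel_iff) auto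
      moreover have "ln (1 / real a) \<le> ln \<sigma>"
      proof (subst ln_le_cancel_iff)
        have "1 / real a \<le> 1 / 200" using a200 by (intro divide_left_mono) auto
        thus "1 / real a \<le> \<sigma>" using s by linarith
      qed (use \<sigma> a200 in auto)
      moreover have "ln (1 / real a) = - ln (real a)" using a200 by (simp add: ln_div)
      ultimately show ?thesis using s(1) unfolding abs_le_iff by linarith
    qed
    moreover have "\<bar>D - ln \<sigma> - I\<bar> \<le> 9600 / real a + 1202 * (1 + ln (real a))"
      by (rule D_approx_zero[OF a200 1])
    ultimately have "\<bar>D' - I\<bar> \<le> 9600 / real a + 4000 * ln (real a)"
      using la unfolding D'D by argo
    moreover have "real b \<le> 0.01 * real a" using 1 by simp
    ultimately show ?thesis unfolding if_P[OF \<open>real b \<le> 0.01 * real a\<close>] using nn by linarith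
  next
    case 2
    have "\<bar>D' - I\<bar> \<le> 9600 / real a + 1200 * (1 + ln (real a))"
      using D_approx_low_pos[OF a200 2] next_pos 2 unfolding D'D by simp
    hence "\<bar>D' - I\<bar> \<le> 9600 / real a + 4000 * ln (real a)" using la by argo
    thus ?thesis unfolding if_P[OF 2(2)] using nn by linarith
  next
    case 3
    have "b > 0" using 3 a by (cases b) auto
    thus ?thesis using D_approx_mid[OF a200 3 bb] next_pos 3 unfolding D'D by simp
  qed
qed

text \<open>The surplus 0.000003 of \<open>I_lower\<close> has to absorb the errors of the
  approximation by \<open>I\<close>. For \<open>b \<le> 0.01*a\<close> one has
  \<open>n \<ge> 0.8*a\<close>, and \<open>0.000003 * 0.8^2 > 0.0000019\<close> explains the
  hypothesis on \<open>a\<close>. To the right of \<open>bs\<close> the tangent bounds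
  apply.\<close>

lemma D'_lower_large:
  assumes a1000: "a \<ge> 1000"
    and A: "0.0000019 * real a \<ge> 130000 + 4000 * ln (real a)"
  shows "D' \<ge> 0.2326 * (real b - real bs)^2 / real a - 2 * 10^15 / real a"
proof (cases "bs \<le> b")
  case True
  have ar: "real a \<ge> 1000" using a1000 by simp
  have "real bs > 0" using bs ar by linarith
  hence l': "\<nu> = 0" using next_pos True by simp
  have big: "9700 / real a \<le> 2 * 10^15 / real a" by (intro divide_right_mono) auto
  show ?thesis
  proof (cases "\<mu> = 0")
    case True
    have "D' = D" unfolding D'_def by (simp add: True l')
    moreover have "D \<ge> 0.2326 * (real b - real bs)^2 / real a - 9700 / real a"
      using a1000 \<open>bs \<le> b\<close> by (intro D_lower_right) auto
    ultimately show ?thesis using big by linarith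
  next
    case False
    have "\<not> real b \<le> 0.99 * real a" using cur_small False by blast
    hence "real b > 0.99 * real a" by (simp only: not_le)
    have "\<mu> = - ln (1 + x - x * (real b + \<sigma>))" using cur False by blast
    have "D' = D + ln (1 + x - x * (real b + \<sigma>))"
      unfolding D'_def by (simp add: l' \<open>\<mu> = - ln (1 + x - x * (real b + \<sigma>))\<close>)
    thus ?thesis using D_lower_right_log[OF a1000 \<open>real b > 0.99 * real a\<close>] big by linarith
  qed
next
  case False
  hence le: "b \<le> bs" by simp
  have ar: "real a \<ge> 1000" using a1000 by simp
  define n where "n = real bs - real b"
  have n: "n \<ge> 0" "\<bar>real b - real bs\<bar> = n" "(real b - real bs)^2 = n^2" "n \<le> real a"
    using le bs by (auto simp: n_def power2_commute)
  have bb: "real b \<le> 0.99 * real a"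
  proof -
    have "real b \<le> real bs" using le by simp
    thus ?thesis using bs by simp
  qed
  have approx: "\<bar>D' - I\<bar> \<le> 9600 / real a + 120000 * n / real a + (if real b \<le> 0.01 * real a then 4000 * ln (real a) else 0)"
    using D'_approx_large[OF _ bb] a1000 n(2) by simp
  have I: "I \<ge> 0.232603 * n^2 / real a - 6 / real a"
    using I_lower[OF le] n(3) by simp
  have main: "D' \<ge> (0.232603 * n^2 - 120000 * n - 9606) / real a - (if real b \<le> 0.01 * real a then 4000 * ln (real a) else 0)"
    using approx I by (simp add: diff_divide_distrib abs_le_iff)
  show ?thesis
  proof (cases "real b \<le> 0.01 * real a")
    case True
    have nl: "n \<ge> 4/5 * real a" using True bs ar by (simp add: n_def)
    have "0.000003 * n^2 \<ge> 0.000003 * (4/5 * real a)^2" using nl by (intro mult_left_mono power_mono) auto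
    moreover have "real a * real a \<ge> 0" by simp
    moreover have "0.000003 * (4/5 * real a)^2 = 192/100000000 * (real a * real a)"
      by (simp add: power2_eq_square)
    ultimately have "19/10000000 * (real a * real a) \<le> 0.000003 * n^2" by linarith
    hence "0.000003 * n^2 \<ge> 0.0000019 * real a * real a" by simp
    moreover have "(130000 + 4000 * ln (real a)) * real a \<le> 0.0000019 * real a * real a"
      using A by (intro mult_right_mono) auto
    moreover have "9606 \<le> 10000 * real a" using ar by linarith
    ultimately have "0.2326 * n^2 + 4000 * ln (real a) * real a \<le> 0.232603 * n^2 - 120000 * n - 9606"
      using n(4) by (simp add: algebra_simps)
    hence "(0.2326 * n^2 + 4000 * ln (real a) * real a) / real a \<le> (0.232603 * n^2 - 120000 * n - 9606) / real a"
      by (intro divide_right_mono) auto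
    moreover have "(0.2326 * n^2 + 4000 * ln (real a) * real a) / real a = 0.2326 * n^2 / real a + 4000 * ln (real a)"
      using a by (simp add: add_divide_distrib)
    ultimately have "D' \<ge> 0.2326 * n^2 / real a" using main True by simp
    moreover have "2 * 10^15 / real a \<ge> 0" by simp
    ultimately show ?thesis unfolding n(3) by linarith
  next
    case False
    \<comment> \<open>Completing the square: \<open>0.000003 * n^2\<close> absorbs
      \<open>120000 * n\<close> at the price of \<open>1.2 * 10^15\<close>, the source of
      \<open>2 * 10^15\<close>.\<close>
    have "0 \<le> (n - 2*10^10)^2" by simp
    hence "0.000003 * n^2 - 120000 * n + 1200000000000000 \<ge> 0"
      by (simp add: power2_diff algebra_simps)
    hence "0.2326 * n^2 - 2 * 10^15 \<le> 0.232603 * n^2 - 120000 * n - 9606" by simp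
    hence "(0.2326 * n^2 - 2 * 10^15) / real a \<le> (0.232603 * n^2 - 120000 * n - 9606) / real a"
      by (intro divide_right_mono) auto
    thus ?thesis using main False unfolding n(3) by (simp add: diff_divide_distrib)
  qed
qed

lemma abs_ldsin_star: "\<bar>ldsin x (x * (real bs + \<tau>))\<bar> \<le> 100 / x"
proof -
  let ?r = "x * (real bs + \<tau>)"
  have ix: "1 / x \<ge> 1" using x_bounds by simp
  have lower: "?r \<ge> x / 12"
    using mult_left_mono[of "1/12" "real bs + \<tau>" x] star x_bounds by simp
  have key: "\<bar>ldsin x r\<bar> \<le> 100 / x" if r: "x/12 \<le> r" "r < x/2" for r
  proof -
    have "\<bar>ldsin x r - ln r\<bar> \<le> 1 / (2*x) + 2" using r x_bounds by (intro ldsin_near_0) auto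
    moreover have "ln r \<le> 0" using r x_bounds by simp
    moreover have "- ln r \<le> 12 / x"
    proof -
      have "ln (1 / r) \<le> 1 / r - 1" using r x_bounds by (intro ln_le_minus_one) auto
      moreover have "1 / r \<le> 1 / (x/12)" using r x_bounds by (intro divide_left_mono) auto
      ultimately show ?thesis using r x_bounds by (simp add: ln_div)
    qed
    moreover have "1 / (2*x) = 1/2 * (1/x)" "12 / x = 12 * (1/x)" "100 / x = 100 * (1/x)" by simp_all
    ultimately show ?thesis using ix by argo
  qed
  consider "?r < x/2" | "x/2 \<le> ?r" "?r \<le> 1 + x/2" | "?r > 1 + x/2" by linarith
  thus ?thesis
  proof cases
    case 1 thus ?thesis using key lower by blast
  next
    case 2
    hence "\<bar>ldsin x ?r\<bar> \<le> 1 / (2*x)" using x_bounds by (intro ldsin_bound') auto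
    moreover have "1 / (2*x) = 1/2 * (1/x)" "100 / x = 100 * (1/x)" by simp_all
    ultimately show ?thesis using ix by argo
  next
    case 3
    have "\<bar>ldsin x (1 + x - ?r)\<bar> \<le> 100 / x" using 3 star x_bounds by (intro key) auto
    thus ?thesis by (simp add: ldsin_reflect)
  qed
qed

text \<open>Serves the partial quotients below the threshold. Near 0 and near \<open>1 + x\<close>
  the corrections cancel the logarithm in \<open>ldsin\<close>; in between, \<open>ldsin\<close> and
  the corrections are bounded separately by multiples of 1/x.\<close>

lemma abs_D'_crude: "\<bar>D'\<bar> \<le> 1000 * real a"
proof -
  let ?r = "x * (real b + \<sigma>)"
  have ix: "1 / x \<ge> 1" using x_bounds by simp
  have e: "1 / (2*x) = 1/2 * (1/x)" "100 / x = 100 * (1/x)" "2 / x = 2 * (1/x)" by simp_all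
  have rpos: "?r > 0" using x_bounds \<sigma> by simp
  have rlt: "1 + x - ?r > 0"
  proof -
    have "?r < x * (real a + (1 + x'))" using b \<sigma> x_bounds by (intro mult_strict_left_mono) auto
    also have "\<dots> = x * (real a + x') + x" by (simp add: algebra_simps)
    finally show ?thesis using x_bounds(5) by simp
  qed
  have ln2: "ln 2 \<le> (1::real)" using ln_le_minus_one[of "2::real"] by simp
  have lnx: "- ln x \<le> 1 / x" "ln x \<le> 0"
    using ln_le_minus_one[of "1/x"] x_bounds by (auto simp: ln_div)
  consider "?r < x/2" | "x/2 \<le> ?r" "?r \<le> 1 + x/2" | "?r > 1 + x/2" by linarith
  hence main: "\<bar>ldsin x ?r + \<nu> - \<mu>\<bar> \<le> 300 / x"
  proof cases
    case 1
    have "real b < 1/2"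
    proof (rule ccontr)
      assume "\<not> real b < 1/2"
      hence "x * (1/2) \<le> ?r" using \<sigma> x_bounds by (intro mult_left_mono) auto
      thus False using 1 by simp
    qed
    hence b0: "b = 0" by simp
    have l0: "\<mu> = 0" using cur_small b0 by simp
    have "\<bar>ln \<sigma> + \<nu>\<bar> \<le> 200"
    proof (cases "\<nu> = - ln \<sigma>")
      case False
      hence s: "\<nu> = 0" "\<sigma> \<ge> 1/200" using next0[OF b0] by auto
      have "ln \<sigma> \<le> \<sigma> - 1" using \<sigma> by (intro ln_le_minus_one) auto
      moreover have "ln (1/\<sigma>) \<le> 1/\<sigma> - 1" using \<sigma> by (intro ln_le_minus_one) auto
      moreover have "1/\<sigma> \<le> 1/(1/200)" using s \<sigma> by (intro divide_left_mono) auto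
      ultimately show ?thesis using s \<sigma> x' by (simp add: ln_div)
    qed simp
    moreover have "\<bar>ldsin x ?r - ln ?r\<bar> \<le> 1 / (2*x) + 2"
      using 1 rpos x_bounds by (intro ldsin_near_0) auto
    moreover have "ln ?r = ln x + ln \<sigma>" using x_bounds \<sigma> b0 by (simp add: ln_mult_pos)
    moreover have "300 / x = 300 * (1/x)" by simp
    ultimately show ?thesis using l0 ix e lnx by argo
  next
    case 2
    have "\<bar>ldsin x ?r\<bar> \<le> 1 / (2*x)" using 2 x_bounds by (intro ldsin_bound') auto
    moreover have "\<bar>\<nu>\<bar> \<le> 1"
    proof (cases "b = 0")
      case True
      have "x * (1/2) \<le> x * \<sigma>" using 2 True by simp
      hence s: "\<sigma> \<ge> 1/2" using x_bounds by simp
      have "ln \<sigma> \<le> \<sigma> - 1" using \<sigma> by (intro ln_le_minus_one) auto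
      moreover have "ln (1/\<sigma>) \<le> 1/\<sigma> - 1" using \<sigma> by (intro ln_le_minus_one) auto
      moreover have "1/\<sigma> \<le> 1/(1/2)" using s \<sigma> by (intro divide_left_mono) auto
      ultimately have "\<bar>ln \<sigma>\<bar> \<le> 1" using \<sigma> x' by (simp add: ln_div)
      thus ?thesis using next0[OF True] by auto
    qed (use next_pos in auto)
    moreover have "\<bar>\<mu>\<bar> \<le> 2 / x"
    proof -
      let ?q = "1 + x - ?r"
      have q: "x/2 \<le> ?q" using 2 by simp
      have q': "?q \<le> 2" using rpos x_bounds(4) by linarith
      have "ln ?q \<le> ?q - 1" using rlt by (intro ln_le_minus_one) auto
      moreover have "ln (1/?q) \<le> 1/?q - 1" using rlt by (intro ln_le_minus_one) auto
      moreover have "1/?q \<le> 1/(x/2)" using q x_bounds rlt by (intro divide_left_mono) auto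
      moreover have "ln (1/?q) = - ln ?q" using rlt by (simp add: ln_div)
      moreover have "1/(x/2) = 2 * (1/x)" by simp
      ultimately have "\<bar>ln ?q\<bar> \<le> 2/x" using q' ix e unfolding abs_le_iff by argo
      thus ?thesis using cur x_bounds by auto
    qed
    moreover have "300 / x = 300 * (1/x)" by simp
    ultimately show ?thesis using ix e by argo
  next
    case 3
    have b0: "b > 0"
    proof (rule ccontr)
      assume "\<not> b > 0"
      hence "?r < x * (1 + x')" using \<sigma> x_bounds by simp
      also have "\<dots> \<le> x * (real a + x')" using a x_bounds by (intro mult_left_mono) auto
      finally show False using 3 x_bounds by simp
    qed
    have "1 + x - ?r < x/2" using 3 by simp
    hence "\<mu> = - ln (1 + x - ?r)" by (rule cur_large)
    moreover have "\<bar>ldsin x (1 + x - ?r) - ln (1 + x - ?r)\<bar> \<le> 1 / (2*x) + 2"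
      using 3 rlt x_bounds by (intro ldsin_near_0) auto
    moreover have "300 / x = 300 * (1/x)" by simp
    ultimately show ?thesis using next_pos[OF b0] ix e unfolding ldsin_reflect by argo
  qed
  have "\<bar>D'\<bar> \<le> 400 / x"
  proof -
    have "400 / x = 300 / x + 100 / x" by (simp add: add_divide_distrib[symmetric])
    thus ?thesis using main abs_ldsin_star unfolding D'_def D_def by argo
  qed
  also have "400 / x = 400 * (real a + x')" by (simp add: x_eq)
  also have "\<dots> \<le> 1000 * real a" using x' a by simp
  finally show ?thesis .
qed

end

theorem ostrowski_digit_estimates:
  "\<exists>C>0. \<forall>a b bs x x' \<sigma> \<tau> \<mu> \<nu>. ostrowski_digit_corr a b bs x x' \<sigma> \<tau> \<mu> \<nu> \<longrightarrow>
     ldsin x (x * (real b + \<sigma>)) - ldsin x (x * (real bs + \<tau>)) + \<nu> - \<mu>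
       \<ge> 0.2326 * (real b - real bs)^2 / real a - C / real a \<and>
     (real b \<le> 0.99 * real a \<longrightarrow>
       \<bar>ldsin x (x * (real b + \<sigma>)) - ldsin x (x * (real bs + \<tau>)) + \<nu> - \<mu>
         - real a * (lsin_prim (real bs / a) - lsin_prim (real b / a))\<bar>
       \<le> C * (1 / real a + \<bar>real b - real bs\<bar> / real a + (if real b \<le> 0.01 * real a then ln (real a) else 0)))"
proof -
  have "eventually (\<lambda>y::real. 0.0000019 * y \<ge> 130000 + 4000 * ln y) at_top" by real_asymp
  then obtain Y :: real where Y: "\<And>y. y \<ge> Y \<Longrightarrow> 0.0000019 * y \<ge> 130000 + 4000 * ln y"
    unfolding eventually_at_top_linorder by blast
  obtain B where B: "B > 0" "\<And>t. t \<in> {0..0.99} \<Longrightarrow> \<bar>lsin_prim t\<bar> \<le> B"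
    using lsin_prim_bounded by blast
  \<comment> \<open>From \<open>A\<close> on the asymptotic bounds apply. Below \<open>A\<close>
    both \<open>D'\<close> and \<open>I\<close> are bounded in terms of \<open>A\<close> and
    \<open>B\<close>; the outer factor \<open>A\<close> in \<open>C\<close> makes up for the
    division by \<open>a\<close>.\<close>
  define A where "A = max 1000 Y"
  define C where "C = 2 * 10^15 + A * (2000 * A + 2 * A * B)"
  have A1: "A \<ge> 1000" by (simp add: A_def)
  have C: "C \<ge> 2 * 10^15" "C \<ge> A * (2000 * A + 2 * A * B)" using A1 B by (auto simp: C_def)
  show ?thesis
  proof (intro exI[of _ C] conjI allI impI)
    show "C > 0" using C(1) by simp
  next
    fix a b bs :: nat and x x' \<sigma> \<tau> \<mu> \<nu> :: real
    assume "ostrowski_digit_corr a b bs x x' \<sigma> \<tau> \<mu> \<nu>"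
    then interpret ostrowski_digit_corr a b bs x x' \<sigma> \<tau> \<mu> \<nu> .
    have D'_eq: "ldsin x (x * (real b + \<sigma>)) - ldsin x (x * (real bs + \<tau>)) + \<nu> - \<mu> = D'"
      by (simp add: D'_def D_def)
    have n_le: "(real b - real bs)^2 \<le> real a * real a"
    proof -
      have "\<bar>real b - real bs\<bar> \<le> real a" using b bs by auto
      hence "\<bar>real b - real bs\<bar>^2 \<le> real a^2" by (intro power_mono) auto
      thus ?thesis by (simp add: power2_eq_square)
    qed
    show "ldsin x (x * (real b + \<sigma>)) - ldsin x (x * (real bs + \<tau>)) + \<nu> - \<mu>
       \<ge> 0.2326 * (real b - real bs)^2 / real a - C / real a"
      unfolding D'_eq
    proof (cases "real a \<ge> A")
      case True
      have "D' \<ge> 0.2326 * (real b - real bs)^2 / real a - 2 * 10^15 / real a"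
        using True Y[of "real a"] by (intro D'_lower_large) (auto simp: A_def)
      moreover have "2 * 10^15 / real a \<le> C / real a" using C by (intro divide_right_mono) auto
      ultimately show "D' \<ge> 0.2326 * (real b - real bs)^2 / real a - C / real a" by linarith
    next
      case False
      have "0.2326 * (real b - real bs)^2 / real a \<le> 1 * (real a * real a) / real a"
        using n_le by (intro divide_right_mono mult_mono) auto
      also have "\<dots> = real a" by simp
      finally have 1: "0.2326 * (real b - real bs)^2 / real a \<le> real a" .
      have "2000 * A * real a \<le> 2000 * A * A" using False A1 by (intro mult_left_mono) auto
      also have "\<dots> \<le> C"
      proof -
        have "A * (A * B) \<ge> 0" using A1 B by simp
        thus ?thesis using C(2) by (simp add: algebra_simps)
      qed
      finally have "2000 * A * real a / real a \<le> C / real a" by (intro divide_right_mono) auto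
      hence "2000 * A \<le> C / real a" using a by simp
      thus "D' \<ge> 0.2326 * (real b - real bs)^2 / real a - C / real a"
        using 1 abs_D'_crude False by argo
    qed
    assume bb: "real b \<le> 0.99 * real a"
    have ll: "(if real b \<le> 0.01 * real a then ln (real a) else 0) \<ge> 0" using a by simp
    show "\<bar>ldsin x (x * (real b + \<sigma>)) - ldsin x (x * (real bs + \<tau>)) + \<nu> - \<mu>
         - real a * (lsin_prim (real bs / a) - lsin_prim (real b / a))\<bar>
       \<le> C * (1 / real a + \<bar>real b - real bs\<bar> / real a + (if real b \<le> 0.01 * real a then ln (real a) else 0))"
      unfolding D'_eq I_def[symmetric]
    proof (cases "real a \<ge> A")
      case True
      have "\<bar>D' - I\<bar> \<le> 9600 / real a + 120000 * \<bar>real b - real bs\<bar> / real a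
         + (if real b \<le> 0.01 * real a then 4000 * ln (real a) else 0)"
        using True A1 bb by (intro D'_approx_large) auto
      also have "\<dots> = 9600 * (1 / real a) + 120000 * (\<bar>real b - real bs\<bar> / real a)
         + 4000 * (if real b \<le> 0.01 * real a then ln (real a) else 0)" by simp
      also have "\<dots> \<le> C * (1 / real a) + C * (\<bar>real b - real bs\<bar> / real a)
         + C * (if real b \<le> 0.01 * real a then ln (real a) else 0)"
        using C(1) ll by (intro add_mono mult_right_mono) auto
      finally show "\<bar>D' - I\<bar> \<le> C * (1 / real a + \<bar>real b - real bs\<bar> / real a + (if real b \<le> 0.01 * real a then ln (real a) else 0))"
        by (simp add: distrib_left)
    next
      case False
      have a0: "real a > 0" using a by simp
      have "\<bar>lsin_prim (real bs / a)\<bar> \<le> B" "\<bar>lsin_prim (real b / a)\<bar> \<le> B"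
        using bb bs a0 by (auto intro!: B(2) simp: divide_le_eq)
      hence "\<bar>lsin_prim (real bs / a) - lsin_prim (real b / a)\<bar> \<le> 2 * B" by linarith
      hence "\<bar>I\<bar> \<le> real a * (2 * B)" unfolding I_def abs_mult by (intro mult_mono) auto
      hence "\<bar>D' - I\<bar> \<le> 1000 * real a + real a * (2 * B)" using abs_D'_crude by linarith
      also have "\<dots> \<le> 2000 * A + 2 * A * B"
      proof -
        have "real a * (2 * B) \<le> A * (2 * B)" using False B by (intro mult_right_mono) auto
        moreover have "A * (2 * B) = 2 * A * B" by simp
        moreover have "1000 * real a \<le> 2000 * A" using False A1 by linarith
        ultimately show ?thesis by linarith
      qed
      also have "\<dots> \<le> C * (1 / real a)"
      proof -
        have "real a * (2000 * A + 2 * A * B) \<le> A * (2000 * A + 2 * A * B)"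
          using False A1 B by (intro mult_right_mono) auto
        hence "real a * (2000 * A + 2 * A * B) \<le> C" using C(2) by linarith
        thus ?thesis using a0 by (simp add: pos_le_divide_eq mult.commute)
      qed
      also have "\<dots> \<le> C * (1 / real a + \<bar>real b - real bs\<bar> / real a + (if real b \<le> 0.01 * real a then ln (real a) else 0))"
        using C(1) ll by (intro mult_left_mono) auto
      finally show "\<bar>D' - I\<bar> \<le> C * (1 / real a + \<bar>real b - real bs\<bar> / real a + (if real b \<le> 0.01 * real a then ln (real a) else 0))" .
    qed
  qed
qed

section \<open>Ostrowski expansions along the Gauss map\<close>

lemma cf_rem_irrational: "\<alpha> \<notin> \<rat> \<Longrightarrow> cf_rem \<alpha> k \<notin> \<rat>"
proof (induction k)
  case (Suc k)
  have "frac (cf_rem \<alpha> k) \<notin> \<rat>"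
    using Suc by (simp add: frac_def) (metis Rats_add Rats_of_int diff_add_cancel)
  hence "1 / frac (cf_rem \<alpha> k) \<notin> \<rat>"
    by (metis Rats_1 Rats_divide div_by_1 divide_divide_eq_right mult_1)
  thus ?case by simp
qed simp

lemma cf_frac_props:
  assumes "\<alpha> \<notin> \<rat>"
  shows "frac (cf_rem \<alpha> k) \<notin> \<rat>" "0 < frac (cf_rem \<alpha> k)" "frac (cf_rem \<alpha> k) < 1"
    "1 / frac (cf_rem \<alpha> k) = real_of_int (cf_a \<alpha> (Suc k)) + frac (cf_rem \<alpha> (Suc k))"
    "cf_a \<alpha> (Suc k) \<ge> 1"
proof -
  have irr: "cf_rem \<alpha> k \<notin> \<rat>" by (rule cf_rem_irrational[OF assms])
  show "frac (cf_rem \<alpha> k) \<notin> \<rat>"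
    using irr by (simp add: frac_def) (metis Rats_add Rats_of_int diff_add_cancel)
  have "cf_rem \<alpha> k \<notin> \<int>" using irr Ints_subset_Rats by auto
  thus pos: "0 < frac (cf_rem \<alpha> k)" by (simp add: frac_gt_0_iff)
  show lt: "frac (cf_rem \<alpha> k) < 1" by (rule frac_lt_1)
  show "1 / frac (cf_rem \<alpha> k) = real_of_int (cf_a \<alpha> (Suc k)) + frac (cf_rem \<alpha> (Suc k))"
    unfolding cf_a_def cf_rem.simps frac_def[of "1 / frac (cf_rem \<alpha> k)"] by simp
  have "1 \<le> 1 / frac (cf_rem \<alpha> k)" using pos lt by simp
  thus "cf_a \<alpha> (Suc k) \<ge> 1" unfolding cf_a_def cf_rem.simps by (simp only: le_floor_iff of_int_1)
qed

text \<open>The number with Ostrowski digits \<open>b\<^sub>k, \<dots>, b\<^bsub>K-1\<^esub>\<close> with respect to the \<open>k\<close>-th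
  iterate of the Gauss map (\<open>a k\<close> stands for the partial quotient \<open>a\<^bsub>k+1\<^esub>\<close>).\<close>

function ostrowski_tail :: "(nat \<Rightarrow> nat) \<Rightarrow> nat \<Rightarrow> (nat \<Rightarrow> nat) \<Rightarrow> nat \<Rightarrow> nat" where
  "ostrowski_tail a K b k = (if k \<ge> K then 0 else
     b k + a k * ostrowski_tail a K b (Suc k) + ostrowski_tail a K b (Suc (Suc k)))"
  by pat_completeness auto
termination by (relation "Wellfounded.measure (\<lambda>(a, K, b, k). K - k)") auto

declare ostrowski_tail.simps [simp del]

text \<open>Instantiated twice, for the digits of \<open>N\<close> and for \<open>bstar\<close>.
  \<open>n k\<close> is what remains of the integer once the lowest \<open>k\<close> digits are
  removed, read with respect to \<open>x k\<close>; \<open>s k\<close> is its multiple of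
  \<open>x k\<close> modulo 1, and \<open>r k = (n k + 1) * x k - n (Suc k)\<close> is the argument
  in the reciprocity formula.\<close>

locale ostrowski_expansion =
  fixes \<alpha> :: real and K :: nat and b :: "nat \<Rightarrow> nat"
  assumes irr: "\<alpha> \<notin> \<rat>" and digits_le: "\<And>k. k < K \<Longrightarrow> int (b k) \<le> cf_a \<alpha> (Suc k)"
begin

definition a where "a k = nat (cf_a \<alpha> (Suc k))"
definition x where "x k = frac (cf_rem \<alpha> k)"
definition n where "n k = ostrowski_tail a K b k"
definition s where "s k = x k * real (n k) - real (n (Suc k))"
definition r where "r k = s k + x k"

lemma int_a: "int (a k) = cf_a \<alpha> (Suc k)"
  using cf_frac_props(5)[OF irr, of k] by (simp add: a_def)

lemma real_a: "real_of_int (cf_a \<alpha> (Suc k)) = real (a k)"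
  using int_a[of k] by (metis of_int_of_nat_eq)

lemma a_pos: "a k \<ge> 1"
  using int_a[of k] cf_frac_props(5)[OF irr, of k] by linarith

lemma b_le: "k < K \<Longrightarrow> b k \<le> a k"
  using digits_le[of k] int_a[of k] by linarith

lemma x_props: "0 < x k" "x k < 1" "x k \<notin> \<rat>" "1 / x k = real (a k) + x (Suc k)" "x k * (real (a k) + x (Suc k)) = 1"
proof -
  show "0 < x k" "x k < 1" "x k \<notin> \<rat>" and *: "1 / x k = real (a k) + x (Suc k)"
    using cf_frac_props[OF irr, of k] by (simp_all add: x_def real_a)
  show "x k * (real (a k) + x (Suc k)) = 1" unfolding *[symmetric] using \<open>0 < x k\<close> by simp
qed

lemma x_eq: "x k = 1 / (real (a k) + x (Suc k))"
  unfolding x_props(4)[symmetric] by simp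

lemma n_rec: "k < K \<Longrightarrow> n k = b k + a k * n (Suc k) + n (Suc (Suc k))"
  by (subst n_def, subst ostrowski_tail.simps) (simp add: n_def)

lemma n_ge_K: "k \<ge> K \<Longrightarrow> n k = 0"
  by (simp add: n_def ostrowski_tail.simps)

lemma n_0: "int (n 0) = (\<Sum>k<K. int (b k) * cf_q \<alpha> k)"
proof -
  \<comment> \<open>\<open>p k\<close> is \<open>cf_q\<close> at \<open>k - 1\<close>, with value 0
    at \<open>k = 0\<close>, so that the recursion for \<open>cf_q\<close> holds from the
    start.\<close>
  define p where "p k = (case k of 0 \<Rightarrow> 0 | Suc j \<Rightarrow> cf_q \<alpha> j)" for k
  have q_rec: "cf_q \<alpha> (Suc k) = int (a k) * cf_q \<alpha> k + p k" for k
    by (cases k) (simp_all add: p_def int_a)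
  have "k \<le> K \<Longrightarrow> int (n 0) = (\<Sum>l<k. int (b l) * cf_q \<alpha> l) + cf_q \<alpha> k * int (n k) + p k * int (n (Suc k))" for k
  proof (induction k)
    case 0 thus ?case by (simp add: p_def)
  next
    case (Suc k)
    have "p (Suc k) = cf_q \<alpha> k" by (simp add: p_def)
    thus ?case using Suc n_rec[of k] unfolding q_rec by (simp add: algebra_simps)
  qed
  from this[of K] show ?thesis by (simp add: n_ge_K)
qed

lemma s_rec: "k < K \<Longrightarrow> s k = x k * (real (b k) - s (Suc k))"
proof -
  assume k: "k < K"
  have "s k = x k * (real (b k) + real (a k) * real (n (Suc k)) + real (n (Suc (Suc k)))) - real (n (Suc k)) * (x k * (real (a k) + x (Suc k)))"
    unfolding x_props(5) by (simp add: s_def n_rec[OF k])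
  thus ?thesis by (simp add: s_def algebra_simps)
qed

lemma s_K: "s K = 0"
  by (simp add: s_def n_ge_K)

text \<open>Each bound at \<open>k\<close> follows from the opposite one at \<open>Suc k\<close>, so
  the induction descends from \<open>s K = 0\<close>. The outcome is
  \<open>0 < r k < 1 + x k\<close>, the domain of the reciprocity formula.\<close>

lemma s_bounds: "k \<le> K \<Longrightarrow> - x k < s k \<and> s k < 1"
proof (induction rule: inc_induct)
  case base thus ?case using x_props(1) by (simp add: s_K)
next
  case (step k)
  have "x k * (-1) < x k * (real (b k) - s (Suc k))"
    using step x_props(1)[of k] by (intro mult_strict_left_mono) auto
  moreover have "x k * (real (b k) - s (Suc k)) < x k * (real (a k) + x (Suc k))"
    using step x_props(1)[of k] b_le[of k] by (intro mult_strict_left_mono) auto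
  ultimately show ?case using x_props(5)[of k] s_rec[of k] step by simp
qed

lemma r_eq: "k < K \<Longrightarrow> r k = x k * (real (b k) + (1 - s (Suc k)))"
  by (simp add: r_def s_rec algebra_simps)

text \<open>The left side is the \<open>\<sigma>\<close> of digit \<open>k - 1\<close>, the right
  side the distance of \<open>r k\<close> from the pole of digit \<open>k\<close>; their equality
  lets the two singularities cancel.\<close>

lemma one_minus_s: "k < K \<Longrightarrow> 1 - s k = 1 + x k - x k * (real (b k) + (1 - s (Suc k)))"
  using r_eq[of k] by (simp add: r_def)

text \<open>The factor 1/2 is the lower bound for \<open>x k * a k\<close>. The values 0.99 and 5/6
  of \<open>c\<close> yield the constants 1/200 and 1/12.\<close>

lemma one_minus_s_ge:
  assumes "k < K" "real (b k) \<le> c * real (a k)" "c \<le> 1"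
  shows "1 - s k \<ge> (1 - c) / 2"
proof -
  have s': "s (Suc k) > - x (Suc k)" using s_bounds[of "Suc k"] assms by simp
  have "s k \<le> x k * (c * real (a k) + x (Suc k))"
    unfolding s_rec[OF assms(1)] using assms(2) s' x_props(1)[of k] by (intro mult_left_mono) auto
  also have "\<dots> = x k * (real (a k) + x (Suc k)) - (1 - c) * (x k * real (a k))" by (simp add: algebra_simps)
  finally have 1: "s k \<le> 1 - (1 - c) * (x k * real (a k))" using x_props(5)[of k] by simp
  have "1/2 \<le> x k * real (a k)"
    using x_props(2)[of "Suc k"] x_props(1)[of "Suc k"] a_pos[of k] unfolding x_eq[of k] by (simp add: field_simps)
  hence "(1 - c) * (1/2) \<le> (1 - c) * (x k * real (a k))" using assms(3) by (intro mult_left_mono) auto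
  thus ?thesis using 1 by simp
qed

lemma ln_sudler_eq: "ln (sudler \<alpha> (n 0)) = (\<Sum>k<K. ldsin (x k) (x k) - ldsin (x k) (r k))"
proof -
  have "m \<le> K \<Longrightarrow> ln (sudler (x 0) (n 0)) = (\<Sum>k<m. ldsin (x k) (x k) - ldsin (x k) (r k)) + ln (sudler (x m) (n m))" for m
  proof (induction m)
    case (Suc m)
    have e: "(real (n m) + 1) * x m - real (n (Suc m)) = r m" by (simp add: r_def s_def algebra_simps)
    have "ln (sudler (x m) (n m)) - ln (sudler (1 / x m) (n (Suc m))) = ldsin (x m) (x m) - ldsin (x m) (r m)"
      using sudler_reciprocity[of "x m" "n m" "n (Suc m)"] x_props[of m] s_bounds[of m] Suc.prems
      unfolding e by (simp add: r_def)
    \<comment> \<open>\<open>1 / x m\<close> and \<open>x (Suc m)\<close> differ by the integer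
      \<open>a m\<close>, which does not change Sudler products.\<close>
    moreover have "sudler (1 / x m) (n (Suc m)) = sudler (x (Suc m)) (n (Suc m))"
      using sudler_add_of_int[of "x (Suc m)" "int (a m)" "n (Suc m)"] unfolding x_props(4) by (simp add: add.commute)
    ultimately show ?case using Suc by simp
  qed simp
  from this[of K] have "ln (sudler (x 0) (n 0)) = (\<Sum>k<K. ldsin (x k) (x k) - ldsin (x k) (r k))"
    by (simp add: n_ge_K)
  moreover have "sudler \<alpha> (n 0) = sudler (x 0) (n 0)"
    using sudler_add_of_int[of "x 0" "\<lfloor>\<alpha>\<rfloor>" "n 0"] by (simp add: x_def frac_def)
  ultimately show ?thesis by simp
qed

end

lemma bstar_bounds:
  assumes "\<alpha> \<notin> \<rat>"
  shows "0 \<le> bstar \<alpha> k" "real_of_int (bstar \<alpha> k) \<le> 5/6 * real_of_int (cf_a \<alpha> (Suc k))"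
    "5/6 * real_of_int (cf_a \<alpha> (Suc k)) < real_of_int (bstar \<alpha> k) + 1" "bstar \<alpha> k \<le> cf_a \<alpha> (Suc k)"
proof -
  have a: "cf_a \<alpha> (Suc k) \<ge> 1" by (rule cf_frac_props(5)[OF assms])
  show "0 \<le> bstar \<alpha> k" using a by (simp add: bstar_def)
  show *: "real_of_int (bstar \<alpha> k) \<le> 5/6 * real_of_int (cf_a \<alpha> (Suc k))" unfolding bstar_def by linarith
  show "5/6 * real_of_int (cf_a \<alpha> (Suc k)) < real_of_int (bstar \<alpha> k) + 1" unfolding bstar_def by linarith
  have "real_of_int (bstar \<alpha> k) \<le> real_of_int (cf_a \<alpha> (Suc k))" using * a by linarith
  thus "bstar \<alpha> k \<le> cf_a \<alpha> (Suc k)" by simp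
qed

theorem ln_sudler_decomposition:
  assumes irr: "\<alpha> \<notin> \<rat>" and dig: "ostrowski_digits \<alpha> K b" and N: "int N = (\<Sum>k<K. int (b k) * cf_q \<alpha> k)"
  obtains D' where
    "ln (sudler \<alpha> N) = ln (sudler \<alpha> (nat (\<Sum>k<K. bstar \<alpha> k * cf_q \<alpha> k))) - (\<Sum>k<K. D' k)"
    "\<And>k. k < K \<Longrightarrow> \<exists>x x' \<sigma> \<tau> \<mu> \<nu>.
       ostrowski_digit_corr (nat (cf_a \<alpha> (Suc k))) (b k) (nat (bstar \<alpha> k)) x x' \<sigma> \<tau> \<mu> \<nu> \<and>
       D' k = ldsin x (x * (real (b k) + \<sigma>)) - ldsin x (x * (real (nat (bstar \<alpha> k)) + \<tau>)) + \<nu> - \<mu>"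
proof -
  define bs where "bs k = nat (bstar \<alpha> k)" for k
  have int_bs: "int (bs k) = bstar \<alpha> k" for k using bstar_bounds(1)[OF irr] by (simp add: bs_def)
  interpret E: ostrowski_expansion \<alpha> K b
    using irr dig by unfold_locales (auto simp: ostrowski_digits_def)
  interpret S: ostrowski_expansion \<alpha> K bs
    using irr bstar_bounds(4)[OF irr] by unfold_locales (auto simp: int_bs)
  have NE: "N = E.n 0" using N E.n_0 by simp
  have NS: "nat (\<Sum>k<K. bstar \<alpha> k * cf_q \<alpha> k) = S.n 0" using S.n_0 by (simp add: int_bs)
  \<comment> \<open>A flagged digit hands its pole to the digit before it, which is 0 and carries
    the matching zero. As neither 0 nor \<open>K\<close> is flagged, the corrections telescope to
    0.\<close>
  define flagged where "flagged k \<longleftrightarrow> 0 < k \<and> k < K \<and> b (k - 1) = 0 \<and> real (b k) > 0.99 * real (E.a k)" for k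
  define \<mu> where "\<mu> k = (if flagged k then - ln (1 - E.s k) else 0)" for k
  define D' where "D' k = ldsin (E.x k) (E.r k) - ldsin (E.x k) (S.r k) + \<mu> (Suc k) - \<mu> k" for k
  have "(\<Sum>k<K. \<mu> (Suc k) - \<mu> k) = \<mu> K - \<mu> 0" by (rule sum_lessThan_telescope)
  also have "\<dots> = 0" by (simp add: \<mu>_def flagged_def)
  finally have "(\<Sum>k<K. D' k) = (\<Sum>k<K. ldsin (E.x k) (E.r k) - ldsin (E.x k) (S.r k))"
    unfolding D'_def add_diff_eq[symmetric] sum.distrib by simp
  hence eq: "ln (sudler \<alpha> N) = ln (sudler \<alpha> (nat (\<Sum>k<K. bstar \<alpha> k * cf_q \<alpha> k))) - (\<Sum>k<K. D' k)"
    unfolding NE NS E.ln_sudler_eq S.ln_sudler_eq by (simp add: sum_subtractf)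
  have bsb: "real (bs k) \<le> 5/6 * real (E.a k)" "5/6 * real (E.a k) < real (bs k) + 1" for k
    using bstar_bounds(2,3)[OF irr, of k] by (simp_all add: E.real_a int_bs[symmetric])
  have corr: "ostrowski_digit_corr (E.a k) (b k) (bs k) (E.x k) (E.x (Suc k)) (1 - E.s (Suc k)) (1 - S.s (Suc k)) (\<mu> k) (\<mu> (Suc k))"
    if k: "k < K" for k
  proof unfold_locales
    show "E.a k \<ge> 1" by (rule E.a_pos)
    show "0 < E.x (Suc k)" "E.x (Suc k) < 1" by (rule E.x_props)+
    show "E.x k = 1 / (real (E.a k) + E.x (Suc k))" by (rule E.x_eq)
    show "0 < 1 - E.s (Suc k)" "1 - E.s (Suc k) < 1 + E.x (Suc k)" using E.s_bounds[of "Suc k"] k by auto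
    show "0 < 1 - S.s (Suc k)" "1 - S.s (Suc k) < 1 + E.x (Suc k)" using S.s_bounds[of "Suc k"] k by auto
    show "b k \<le> E.a k" using E.b_le k .
    show "real (bs k) \<le> 5/6 * real (E.a k)" "5/6 * real (E.a k) < real (bs k) + 1" by (rule bsb)+
    show "\<mu> (Suc k) = - ln (1 - E.s (Suc k)) \<or> \<mu> (Suc k) = 0 \<and> 1/200 \<le> 1 - E.s (Suc k)" if b0: "b k = 0"
    proof (cases "flagged (Suc k)")
      case True thus ?thesis by (simp add: \<mu>_def)
    next
      case False
      have "1/200 \<le> 1 - E.s (Suc k)"
      proof (cases "Suc k = K")
        case True thus ?thesis using E.s_K by simp
      next
        case neq: False
        hence "Suc k < K" using k by simp
        moreover from this have "real (b (Suc k)) \<le> 0.99 * real (E.a (Suc k))" using False b0 by (simp add: flagged_def)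
        ultimately have "(1 - 0.99) / 2 \<le> 1 - E.s (Suc k)" by (rule E.one_minus_s_ge) simp
        thus ?thesis by simp
      qed
      thus ?thesis using False by (simp add: \<mu>_def)
    qed
    show "\<mu> (Suc k) = 0" if "b k > 0" using that by (simp add: \<mu>_def flagged_def)
    show "\<mu> k = 0 \<or> \<mu> k = - ln (1 + E.x k - E.x k * (real (b k) + (1 - E.s (Suc k))))"
      unfolding E.one_minus_s[OF k, symmetric] by (simp add: \<mu>_def)
    show "\<mu> k = 0" if "real (b k) \<le> 0.99 * real (E.a k)" using that by (simp add: \<mu>_def flagged_def)
    show "\<mu> k = - ln (1 + E.x k - E.x k * (real (b k) + (1 - E.s (Suc k))))"
      if lt: "1 + E.x k - E.x k * (real (b k) + (1 - E.s (Suc k))) < E.x k / 2"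
    proof -
      \<comment> \<open>Coming within \<open>x/2\<close> of the pole forces the maximal digit; the
        Ostrowski rules then supply \<open>k > 0\<close> and \<open>b (k - 1) = 0\<close>.\<close>
      have "b k = E.a k"
      proof (rule ccontr)
        assume "b k \<noteq> E.a k"
        hence "real (b k) + 1 \<le> real (E.a k)" using E.b_le[OF k] by simp
        hence "E.x k * (real (b k) + (1 - E.s (Suc k))) \<le> E.x k * (real (E.a k) + E.x (Suc k))"
          using E.x_props(1)[of k] E.s_bounds[of "Suc k"] k by (intro mult_left_mono) auto
        thus False using lt E.x_props(5)[of k] E.x_props(1)[of k] by simp
      qed
      hence ba: "int (b k) = cf_a \<alpha> (Suc k)" using E.int_a by simp
      have "k \<noteq> 0" using dig ba k unfolding ostrowski_digits_def by (metis One_nat_def less_irrefl)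
      hence "b (k - 1) = 0" using dig ba k unfolding ostrowski_digits_def by simp
      hence "flagged k" using \<open>k \<noteq> 0\<close> k \<open>b k = E.a k\<close> E.a_pos[of k] by (simp add: flagged_def)
      thus ?thesis unfolding E.one_minus_s[OF k, symmetric] by (simp add: \<mu>_def)
    qed
    have star: "1/12 \<le> 1 - S.s j" if "j \<le> K" for j
    proof (cases "j = K")
      case True thus ?thesis using S.s_K by simp
    next
      case False
      hence "(1 - 5/6) / 2 \<le> 1 - S.s j"
        using that bsb[of j] by (intro S.one_minus_s_ge) auto
      thus ?thesis by simp
    qed
    show "1/12 \<le> 1 - S.s (Suc k)" using k by (intro star) simp
    show "1/12 \<le> 1 + E.x k - E.x k * (real (bs k) + (1 - S.s (Suc k)))"
      using star[of k] k S.one_minus_s[OF k] by simp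
  qed
  show thesis
  proof (rule that[OF eq])
    fix k assume k: "k < K"
    have "D' k = ldsin (E.x k) (E.x k * (real (b k) + (1 - E.s (Suc k)))) - ldsin (E.x k) (E.x k * (real (nat (bstar \<alpha> k)) + (1 - S.s (Suc k)))) + \<mu> (Suc k) - \<mu> k"
      using E.r_eq[OF k] S.r_eq[OF k] by (simp add: D'_def bs_def)
    thus "\<exists>x x' \<sigma> \<tau> \<mu> \<nu>.
       ostrowski_digit_corr (nat (cf_a \<alpha> (Suc k))) (b k) (nat (bstar \<alpha> k)) x x' \<sigma> \<tau> \<mu> \<nu> \<and>
       D' k = ldsin x (x * (real (b k) + \<sigma>)) - ldsin x (x * (real (nat (bstar \<alpha> k)) + \<tau>)) + \<nu> - \<mu>"
      using corr[OF k] unfolding E.a_def bs_def by blast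
  qed
qed

theorem theorem1:
  "\<forall>T::real. T \<ge> 1 \<longrightarrow>
   (\<exists>C::real. C > 0 \<and>
    (\<forall>(\<alpha>::real) (k0::nat). \<alpha> \<notin> \<rat> \<and> k0 \<ge> 1 \<and>
       (\<forall>k\<ge>k0. ln (real_of_int (cf_a \<alpha> k)) / real_of_int (cf_a \<alpha> (Suc k)) \<le> T) \<longrightarrow>
     (\<exists>D::real.
       \<forall>(N::nat) (K::nat) (b::nat \<Rightarrow> nat).
         ostrowski_digits \<alpha> K b \<and> int N = (\<Sum>k<K. int (b k) * cf_q \<alpha> k) \<longrightarrow>
         (\<exists>d::nat \<Rightarrow> real.
            \<bar>ln (sudler \<alpha> N)
               - (ln (sudler \<alpha> (nat (\<Sum>k<K. bstar \<alpha> k * cf_q \<alpha> k))) - (\<Sum>k<K. d k))\<bar>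
              \<le> C * (\<Sum>k=1..K. 1 / real_of_int (cf_a \<alpha> k)) + D
          \<and> (\<forall>k<K.
               d k \<ge> 0.2326 * (real (b k) - real_of_int (bstar \<alpha> k))^2
                          / real_of_int (cf_a \<alpha> (Suc k))
             \<and> (int (b k) = bstar \<alpha> k \<longrightarrow>
                  d k = 0.2326 * (real (b k) - real_of_int (bstar \<alpha> k))^2
                          / real_of_int (cf_a \<alpha> (Suc k))))
          \<and> (\<forall>k<K. real (b k) \<le> 0.99 * real_of_int (cf_a \<alpha> (Suc k)) \<longrightarrow>
               \<bar>d k - real_of_int (cf_a \<alpha> (Suc k)) *
                   (LBINT x = ereal (real (b k) / real_of_int (cf_a \<alpha> (Suc k)))
                           ..ereal (real_of_int (bstar \<alpha> k) / real_of_int (cf_a \<alpha> (Suc k))).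
                      ln \<bar>2 * sin (pi * x)\<bar>)\<bar>
               \<le> C * (\<bar>real (b k) - real_of_int (bstar \<alpha> k)\<bar> / real_of_int (cf_a \<alpha> (Suc k))
                      + (if real (b k) \<le> 0.01 * real_of_int (cf_a \<alpha> (Suc k))
                         then ln (real_of_int (cf_a \<alpha> (Suc k))) else 0)))))))"
proof -
  obtain C where C: "C > 0" and est: "\<And>a b bs x x' \<sigma> \<tau> \<mu> \<nu>. ostrowski_digit_corr a b bs x x' \<sigma> \<tau> \<mu> \<nu> \<Longrightarrow>
     ldsin x (x * (real b + \<sigma>)) - ldsin x (x * (real bs + \<tau>)) + \<nu> - \<mu>
       \<ge> 0.2326 * (real b - real bs)^2 / real a - C / real a \<and>
     (real b \<le> 0.99 * real a \<longrightarrow>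
       \<bar>ldsin x (x * (real b + \<sigma>)) - ldsin x (x * (real bs + \<tau>)) + \<nu> - \<mu>
         - real a * (lsin_prim (real bs / a) - lsin_prim (real b / a))\<bar>
       \<le> C * (1 / real a + \<bar>real b - real bs\<bar> / real a + (if real b \<le> 0.01 * real a then ln (real a) else 0)))"
    using ostrowski_digit_estimates by metis
  have main: "\<exists>d::nat \<Rightarrow> real.
            \<bar>ln (sudler \<alpha> N)
               - (ln (sudler \<alpha> (nat (\<Sum>k<K. bstar \<alpha> k * cf_q \<alpha> k))) - (\<Sum>k<K. d k))\<bar>
              \<le> (3 * C) * (\<Sum>k=1..K. 1 / real_of_int (cf_a \<alpha> k)) + 0
          \<and> (\<forall>k<K.
               d k \<ge> 0.2326 * (real (b k) - real_of_int (bstar \<alpha> k))^2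
                          / real_of_int (cf_a \<alpha> (Suc k))
             \<and> (int (b k) = bstar \<alpha> k \<longrightarrow>
                  d k = 0.2326 * (real (b k) - real_of_int (bstar \<alpha> k))^2
                          / real_of_int (cf_a \<alpha> (Suc k))))
          \<and> (\<forall>k<K. real (b k) \<le> 0.99 * real_of_int (cf_a \<alpha> (Suc k)) \<longrightarrow>
               \<bar>d k - real_of_int (cf_a \<alpha> (Suc k)) *
                   (LBINT x = ereal (real (b k) / real_of_int (cf_a \<alpha> (Suc k)))
                           ..ereal (real_of_int (bstar \<alpha> k) / real_of_int (cf_a \<alpha> (Suc k))).
                      ln \<bar>2 * sin (pi * x)\<bar>)\<bar>
               \<le> (3 * C) * (\<bar>real (b k) - real_of_int (bstar \<alpha> k)\<bar> / real_of_int (cf_a \<alpha> (Suc k))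
                      + (if real (b k) \<le> 0.01 * real_of_int (cf_a \<alpha> (Suc k))
                         then ln (real_of_int (cf_a \<alpha> (Suc k))) else 0)))"
    if irr: "\<alpha> \<notin> \<rat>" and dig: "ostrowski_digits \<alpha> K b" and N: "int N = (\<Sum>k<K. int (b k) * cf_q \<alpha> k)"
    for \<alpha> :: real and N K :: nat and b :: "nat \<Rightarrow> nat"
  proof -
    obtain D' where D'_sum: "ln (sudler \<alpha> N) = ln (sudler \<alpha> (nat (\<Sum>k<K. bstar \<alpha> k * cf_q \<alpha> k))) - (\<Sum>k<K. D' k)"
      and D'_corr: "\<And>k. k < K \<Longrightarrow> \<exists>x x' \<sigma> \<tau> \<mu> \<nu>.
       ostrowski_digit_corr (nat (cf_a \<alpha> (Suc k))) (b k) (nat (bstar \<alpha> k)) x x' \<sigma> \<tau> \<mu> \<nu> \<and>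
       D' k = ldsin x (x * (real (b k) + \<sigma>)) - ldsin x (x * (real (nat (bstar \<alpha> k)) + \<tau>)) + \<nu> - \<mu>"
      using ln_sudler_decomposition[OF irr dig N] by blast
    define a where "a k = real_of_int (cf_a \<alpha> (Suc k))" for k
    define bs where "bs k = real_of_int (bstar \<alpha> k)" for k
    define q where "q k = 0.2326 * (real (b k) - bs k)^2 / a k" for k
    define I where "I k = a k * (lsin_prim (bs k / a k) - lsin_prim (real (b k) / a k))" for k
    define ind where "ind k = (if real (b k) \<le> 0.01 * a k then ln (a k) else 0)" for k
    \<comment> \<open>The maximum makes (i) hold without error, and the value 0 gives equality when
      the digits agree. Either change is at most \<open>C / a k\<close>.\<close>
    define d where "d k = (if int (b k) = bstar \<alpha> k then 0 else max (D' k) (q k))" for k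
    have a1: "a k \<ge> 1" for k using cf_frac_props(5)[OF irr, of k] by (simp add: a_def)
    have bs: "0 \<le> bs k" "bs k \<le> 5/6 * a k" "5/6 * a k < bs k + 1" for k
      using bstar_bounds[OF irr, of k] by (simp_all add: bs_def a_def)
    have conv: "real (nat (cf_a \<alpha> (Suc k))) = a k" "real (nat (bstar \<alpha> k)) = bs k" for k
      using cf_frac_props(5)[OF irr, of k] bstar_bounds(1)[OF irr, of k] by (simp_all add: a_def bs_def)
    have ind0: "ind k \<ge> 0" for k using a1[of k] by (simp add: ind_def)
    have low: "D' k \<ge> q k - C / a k" (is "?low k")
      and app: "real (b k) \<le> 0.99 * a k \<longrightarrow> \<bar>D' k - I k\<bar> \<le> C * (1 / a k + \<bar>real (b k) - bs k\<bar> / a k + ind k)" (is "?app k")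
      if k: "k < K" for k
    proof -
      obtain x x' \<sigma> \<tau> \<mu> \<nu> where *: "ostrowski_digit_corr (nat (cf_a \<alpha> (Suc k))) (b k) (nat (bstar \<alpha> k)) x x' \<sigma> \<tau> \<mu> \<nu>"
        "D' k = ldsin x (x * (real (b k) + \<sigma>)) - ldsin x (x * (real (nat (bstar \<alpha> k)) + \<tau>)) + \<nu> - \<mu>"
        using D'_corr[OF k] by blast
      have "?low k \<and> ?app k"
        using est[OF *(1)] unfolding *(2) conv q_def I_def ind_def .
      thus "?low k" "?app k" by blast+
    qed
    have eq_case: "real (b k) = bs k" if "int (b k) = bstar \<alpha> k" for k
    proof -
      have "real_of_int (int (b k)) = real_of_int (bstar \<alpha> k)" using that by simp
      thus ?thesis by (simp add: bs_def)
    qed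
    \<comment> \<open>Distinct integers differ by at least 1, so an error \<open>1 / a k\<close> is
      dominated by the admissible \<open>\<bar>b k - bs k\<bar> / a k\<close>.\<close>
    have neq_case: "1 \<le> \<bar>real (b k) - bs k\<bar>" if "int (b k) \<noteq> bstar \<alpha> k" for k
    proof -
      have "1 \<le> \<bar>int (b k) - bstar \<alpha> k\<bar>" using that by linarith
      hence "real_of_int 1 \<le> real_of_int \<bar>int (b k) - bstar \<alpha> k\<bar>" by (simp only: of_int_le_iff)
      thus ?thesis by (simp add: bs_def)
    qed
    \<comment> \<open>Equal digits below \<open>0.01 * a k\<close> force \<open>a k = 1\<close>,
      where the logarithm vanishes.\<close>
    have ind_eq: "ind k = 0" if "real (b k) = bs k" for k
    proof (cases "real (b k) \<le> 0.01 * a k")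
      case True
      hence "a k < 2" using bs(3)[of k] that by simp
      hence "cf_a \<alpha> (Suc k) < 2" by (simp add: a_def)
      hence "a k = 1" using cf_frac_props(5)[OF irr, of k] by (simp add: a_def)
      thus ?thesis by (simp add: ind_def)
    qed (simp add: ind_def)
    have close: "\<bar>d k - D' k\<bar> \<le> C / a k" if k: "k < K" for k
    proof (cases "int (b k) = bstar \<alpha> k")
      case True
      have "real (b k) \<le> 0.99 * a k" using eq_case[OF True] bs(2)[of k] a1[of k] by simp
      from app[OF k] this have "\<bar>D' k\<bar> \<le> C * (1 / a k)"
        using eq_case[OF True] ind_eq[of k] by (simp add: I_def)
      thus ?thesis using True by (simp add: d_def)
    next
      case False
      thus ?thesis using low[OF k] C a1[of k] by (simp add: d_def max_def)
    qed
    show ?thesis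
    proof (intro exI[of _ d] conjI allI impI)
      have "\<bar>\<Sum>k<K. d k - D' k\<bar> \<le> (\<Sum>k<K. C / a k)"
        by (rule order_trans[OF sum_abs]) (intro sum_mono close, simp)
      also have "\<dots> = C * (\<Sum>k=1..K. 1 / real_of_int (cf_a \<alpha> k))"
        by (simp add: sum_distrib_left a_def sum.atLeast1_atMost_eq)
      also have "\<dots> \<le> (3 * C) * (\<Sum>k=1..K. 1 / real_of_int (cf_a \<alpha> k))"
      proof (intro mult_right_mono sum_nonneg)
        fix k assume "k \<in> {1..K}"
        then obtain j where "k = Suc j" by (cases k) auto
        thus "0 \<le> 1 / real_of_int (cf_a \<alpha> k)" using a1[of j] by (simp add: a_def)
      qed (use C in simp)
      finally show "\<bar>ln (sudler \<alpha> N)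
               - (ln (sudler \<alpha> (nat (\<Sum>k<K. bstar \<alpha> k * cf_q \<alpha> k))) - (\<Sum>k<K. d k))\<bar>
              \<le> (3 * C) * (\<Sum>k=1..K. 1 / real_of_int (cf_a \<alpha> k)) + 0"
        unfolding D'_sum by (simp add: sum_subtractf)
    next
      fix k assume k: "k < K"
      show "d k \<ge> 0.2326 * (real (b k) - real_of_int (bstar \<alpha> k))^2 / real_of_int (cf_a \<alpha> (Suc k))"
        using eq_case[of k] unfolding bs_def[symmetric] a_def[symmetric] q_def[symmetric]
        by (auto simp: d_def q_def)
      show "d k = 0.2326 * (real (b k) - real_of_int (bstar \<alpha> k))^2 / real_of_int (cf_a \<alpha> (Suc k))"
        if "int (b k) = bstar \<alpha> k"
        using that eq_case[OF that] unfolding bs_def[symmetric] by (simp add: d_def)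
      assume "real (b k) \<le> 0.99 * real_of_int (cf_a \<alpha> (Suc k))"
      hence bb: "real (b k) \<le> 0.99 * a k" by (simp add: a_def)
      have a0: "a k > 0" using a1[of k] by linarith
      have "\<bar>d k - I k\<bar> \<le> (3 * C) * (\<bar>real (b k) - bs k\<bar> / a k + ind k)"
      proof (cases "int (b k) = bstar \<alpha> k")
        case True
        thus ?thesis using eq_case[OF True] ind_eq[of k] by (simp add: d_def I_def)
      next
        case False
        \<comment> \<open>Origin of the factor 3: \<open>1 / a k\<close> occurs twice, from the
          passage from \<open>D'\<close> to \<open>d\<close> and from the digit estimate, and
          \<open>\<bar>b k - bs k\<bar> / a k\<close> once.\<close>
        have "\<bar>d k - I k\<bar> \<le> C / a k + C * (1 / a k + \<bar>real (b k) - bs k\<bar> / a k + ind k)"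
          using close[OF k] app[OF k] bb by linarith
        also have "\<dots> = 2 * C * (1 / a k) + C * (\<bar>real (b k) - bs k\<bar> / a k) + C * ind k"
          by (simp add: algebra_simps)
        also have "\<dots> \<le> 2 * C * (\<bar>real (b k) - bs k\<bar> / a k) + C * (\<bar>real (b k) - bs k\<bar> / a k) + 3 * C * ind k"
          using neq_case[OF False] C ind0[of k] a0
          by (intro add_mono mult_left_mono mult_right_mono divide_right_mono) auto
        finally show ?thesis by (simp add: algebra_simps)
      qed
      moreover have "(LBINT x = ereal (real (b k) / a k)..ereal (bs k / a k). ln \<bar>2 * sin (pi * x)\<bar>)
          = lsin_prim (bs k / a k) - lsin_prim (real (b k) / a k)"
        using bb bs[of k] a0 by (intro LBINT_lsin) (auto simp: divide_less_eq)
      ultimately show "\<bar>d k - real_of_int (cf_a \<alpha> (Suc k)) *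
                   (LBINT x = ereal (real (b k) / real_of_int (cf_a \<alpha> (Suc k)))
                           ..ereal (real_of_int (bstar \<alpha> k) / real_of_int (cf_a \<alpha> (Suc k))).
                      ln \<bar>2 * sin (pi * x)\<bar>)\<bar>
               \<le> (3 * C) * (\<bar>real (b k) - real_of_int (bstar \<alpha> k)\<bar> / real_of_int (cf_a \<alpha> (Suc k))
                      + (if real (b k) \<le> 0.01 * real_of_int (cf_a \<alpha> (Suc k))
                         then ln (real_of_int (cf_a \<alpha> (Suc k))) else 0))"
        unfolding bs_def[symmetric] a_def[symmetric] I_def ind_def by simp
    qed
  qed
  show ?thesis
  proof (intro allI impI, rule exI[of _ "3 * C"], intro conjI allI impI)
    show "3 * C > 0" using C by simp
  next
    fix T \<alpha> :: real and k0 :: nat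
    assume h: "\<alpha> \<notin> \<rat> \<and> 1 \<le> k0 \<and> (\<forall>k\<ge>k0. ln (real_of_int (cf_a \<alpha> k)) / real_of_int (cf_a \<alpha> (Suc k)) \<le> T)"
    show "\<exists>D::real.
       \<forall>(N::nat) (K::nat) (b::nat \<Rightarrow> nat).
         ostrowski_digits \<alpha> K b \<and> int N = (\<Sum>k<K. int (b k) * cf_q \<alpha> k) \<longrightarrow>
         (\<exists>d::nat \<Rightarrow> real.
            \<bar>ln (sudler \<alpha> N)
               - (ln (sudler \<alpha> (nat (\<Sum>k<K. bstar \<alpha> k * cf_q \<alpha> k))) - (\<Sum>k<K. d k))\<bar>
              \<le> (3 * C) * (\<Sum>k=1..K. 1 / real_of_int (cf_a \<alpha> k)) + D
          \<and> (\<forall>k<K.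
               d k \<ge> 0.2326 * (real (b k) - real_of_int (bstar \<alpha> k))^2
                          / real_of_int (cf_a \<alpha> (Suc k))
             \<and> (int (b k) = bstar \<alpha> k \<longrightarrow>
                  d k = 0.2326 * (real (b k) - real_of_int (bstar \<alpha> k))^2
                          / real_of_int (cf_a \<alpha> (Suc k))))
          \<and> (\<forall>k<K. real (b k) \<le> 0.99 * real_of_int (cf_a \<alpha> (Suc k)) \<longrightarrow>
               \<bar>d k - real_of_int (cf_a \<alpha> (Suc k)) *
                   (LBINT x = ereal (real (b k) / real_of_int (cf_a \<alpha> (Suc k)))
                           ..ereal (real_of_int (bstar \<alpha> k) / real_of_int (cf_a \<alpha> (Suc k))).
                      ln \<bar>2 * sin (pi * x)\<bar>)\<bar>
               \<le> (3 * C) * (\<bar>real (b k) - real_of_int (bstar \<alpha> k)\<bar> / real_of_int (cf_a \<alpha> (Suc k))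
                      + (if real (b k) \<le> 0.01 * real_of_int (cf_a \<alpha> (Suc k))
                         then ln (real_of_int (cf_a \<alpha> (Suc k))) else 0))))"
    \<comment> \<open>All errors sit in the sum over the digits, hence the witness 0 for the bounded
      term.\<close>
    proof (rule exI[of _ 0], intro allI impI, elim conjE, rule main)
    qed (use h in simp_all)
  qed
qed

end
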